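(* Let $n$ be an integer, $n \ge 2$. Suppose that there is no prime power $q$ and integer $m \ge 1$ such that $n = q^m + q^{m-1} + \dots + q + 1$. Then every countable group that has Property $P(n-1)$ also has Property $P(n)$.
   Context: Countable means finite or countably infinite. A prime power is an integer $p^k$ with $p$ prime and $k \ge 1$. A subset $F$ of a group $G$ is irreducibly faithful if there exists an irreducible unitary representation $\pi$ of $G$ (in a Hilbert space) such that $\pi(x) \ne \mathrm{id}$ for all $x \in F$ with $x \ne e$. For $n \ge 1$, $G$ has Property $P(n)$ if every subset of $G$ of size at most $n$ is irreducibly faithful. *)

theory Defs
  imports
    "HOL-Analysis.Analysis"
    "HOL-Number_Theory.Prime_Powers"
    "HOL-Algebra.Group_Action"
    "HOL-Algebra.Module"
    "HOL-Algebra.Algebraic_Closure_Type"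
begin

section \<open>Complex Hilbert spaces on a carrier set\<close>

text \<open>
  A Hilbert space is a record, so that one can quantify over Hilbert spaces inside a formula.
  The multiplicative fields inherited from the type of rings by the type of modules play no role.
\<close>

record 'h inner_module = "(complex, 'h) module" +
  cinner :: "'h \<Rightarrow> 'h \<Rightarrow> complex"

abbreviation complex_ring :: "complex ring" where
  "complex_ring \<equiv> ring_of_type_algebra"

definition hnorm :: "('h, 'r) inner_module_scheme \<Rightarrow> 'h \<Rightarrow> real" where
  "hnorm H x = sqrt (Re (cinner H x x))"

text \<open>The library requires a metric to be non-negative and symmetric off the carrier too.\<close>

definition hdist :: "('h, 'r) inner_module_scheme \<Rightarrow> 'h \<Rightarrow> 'h \<Rightarrow> real" where
  "hdist H x y = (if x \<in> carrier H \<and> y \<in> carrier H then hnorm H (x \<ominus>\<^bsub>H\<^esub> y) else 0)"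

locale inner_product_space =
  Module.module complex_ring H for H :: "('h, 'r) inner_module_scheme" +
  assumes cinner_commute:
      "\<lbrakk>x \<in> carrier H; y \<in> carrier H\<rbrakk> \<Longrightarrow> cinner H y x = cnj (cinner H x y)"
    and cinner_add_left:
      "\<lbrakk>x \<in> carrier H; y \<in> carrier H; z \<in> carrier H\<rbrakk> \<Longrightarrow>
        cinner H (x \<oplus>\<^bsub>H\<^esub> y) z = cinner H x z + cinner H y z"
    and cinner_smult_left:
      "\<lbrakk>x \<in> carrier H; y \<in> carrier H\<rbrakk> \<Longrightarrow>
        cinner H (a \<odot>\<^bsub>H\<^esub> x) y = a * cinner H x y"
    and cinner_pos:
      "\<lbrakk>x \<in> carrier H; x \<noteq> \<zero>\<^bsub>H\<^esub>\<rbrakk> \<Longrightarrow> Re (cinner H x x) > 0"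

text \<open>The locale of abstract metric spaces is available by \<open>metric_hdist\<close> below.\<close>

locale hilbert_space = inner_product_space +
  assumes complete: "Metric_space.mcomplete (carrier H) (hdist H)"


section \<open>Irreducible unitary representations\<close>

text \<open>
  A group action already makes every \<open>\<pi> g\<close> a bijection of \<open>carrier H\<close>, so \<open>\<pi>\<close> takes its values in
  the surjective linear isometries.
\<close>

locale unitary_representation =
  G: group G + hilbert_space H + group_action G "carrier H" \<pi>
  for G :: "('g, 'm) monoid_scheme" and H :: "('h, 'r) inner_module_scheme"
    and \<pi> :: "'g \<Rightarrow> 'h \<Rightarrow> 'h" +
  assumes rep_add:
      "\<lbrakk>g \<in> carrier G; x \<in> carrier H; y \<in> carrier H\<rbrakk> \<Longrightarrow> \<pi> g (x \<oplus>\<^bsub>H\<^esub> y) = \<pi> g x \<oplus>\<^bsub>H\<^esub> \<pi> g y"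
    and rep_smult:
      "\<lbrakk>g \<in> carrier G; x \<in> carrier H\<rbrakk> \<Longrightarrow> \<pi> g (a \<odot>\<^bsub>H\<^esub> x) = a \<odot>\<^bsub>H\<^esub> \<pi> g x"
    and rep_cinner:
      "\<lbrakk>g \<in> carrier G; x \<in> carrier H; y \<in> carrier H\<rbrakk> \<Longrightarrow> cinner H (\<pi> g x) (\<pi> g y) = cinner H x y"

locale irreducible_unitary_representation = unitary_representation +
  assumes nonzero: "carrier H \<noteq> {\<zero>\<^bsub>H\<^esub>}"
    and irreducible:
      "\<lbrakk>submodule W complex_ring H;
        closedin (Metric_space.mtopology (carrier H) (hdist H)) W;
        \<And>g. g \<in> carrier G \<Longrightarrow> \<pi> g ` W \<subseteq> W\<rbrakk> \<Longrightarrow> W = {\<zero>\<^bsub>H\<^esub>} \<or> W = carrier H"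

text \<open>
  HOL cannot quantify over the type underlying \<open>H\<close>, so the representation spaces are taken inside
  the functions from the group to the complex numbers. This loses nothing: mapping a vector to its
  matrix coefficients against a fixed nonzero vector is injective on an irreducible representation.
  Lemma \<open>irreducibly_faithfulI\<close> below proves that representations on all other types are covered.
\<close>

definition irreducibly_faithful :: "('g, 'm) monoid_scheme \<Rightarrow> 'g set \<Rightarrow> bool" where
  "irreducibly_faithful G F \<longleftrightarrow>
    (\<exists>(H :: ('g \<Rightarrow> complex) inner_module) \<pi>.
      irreducible_unitary_representation G H \<pi> \<and>
      (\<forall>x\<in>F. x \<noteq> \<one>\<^bsub>G\<^esub> \<longrightarrow> \<pi> x \<noteq> (\<lambda>v\<in>carrier H. v)))"

definition property_P :: "nat \<Rightarrow> ('g, 'm) monoid_scheme \<Rightarrow> bool" where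
  "property_P n G \<longleftrightarrow>
    (\<forall>F. F \<subseteq> carrier G \<and> finite F \<and> card F \<le> n \<longrightarrow> irreducibly_faithful G F)"


section \<open>The metric of an inner product space\<close>

lemma carrier_complex_ring [simp]: "carrier complex_ring = UNIV"
  and complex_ring_simps [simp]:
    "\<zero>\<^bsub>complex_ring\<^esub> = 0" "\<one>\<^bsub>complex_ring\<^esub> = 1"
    "a \<oplus>\<^bsub>complex_ring\<^esub> b = a + b" "a \<otimes>\<^bsub>complex_ring\<^esub> b = a * b"
  by (simp_all add: ring_of_type_algebra_def)

lemma complex_ring_minus [simp]: "\<ominus>\<^bsub>complex_ring\<^esub> a = - a"
proof -
  interpret cring complex_ring by (rule cring_from_type_algebra)
  show ?thesis
    by (rule minus_equality) simp_all
qed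

context inner_product_space
begin

lemma cinner_add_right:
  assumes "x \<in> carrier H" "y \<in> carrier H" "z \<in> carrier H"
  shows "cinner H z (x \<oplus>\<^bsub>H\<^esub> y) = cinner H z x + cinner H z y"
  using assms
  by (metis M.add.m_closed cinner_commute cinner_add_left complex_cnj_add)

lemma cinner_smult_right:
  assumes "x \<in> carrier H" "y \<in> carrier H"
  shows "cinner H x (a \<odot>\<^bsub>H\<^esub> y) = cnj a * cinner H x y"
  using assms cinner_commute[of "a \<odot>\<^bsub>H\<^esub> y" x] cinner_smult_left[of y x a] cinner_commute[of y x]
  by simp

lemma smult_minus1: "x \<in> carrier H \<Longrightarrow> (- 1) \<odot>\<^bsub>H\<^esub> x = \<ominus>\<^bsub>H\<^esub> x"
  using smult_l_minus[of 1 x] smult_one[of x] by simp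

lemma cinner_minus_left:
  "x \<in> carrier H \<Longrightarrow> y \<in> carrier H \<Longrightarrow> cinner H (\<ominus>\<^bsub>H\<^esub> x) y = - cinner H x y"
  using cinner_smult_left[of x y "-1"] by (simp add: smult_minus1)

lemma cinner_minus_right:
  "x \<in> carrier H \<Longrightarrow> y \<in> carrier H \<Longrightarrow> cinner H y (\<ominus>\<^bsub>H\<^esub> x) = - cinner H y x"
  using cinner_smult_right[of y x "-1"] by (simp add: smult_minus1)

lemma cinner_zero_left: "y \<in> carrier H \<Longrightarrow> cinner H \<zero>\<^bsub>H\<^esub> y = 0"
  using cinner_add_left[of "\<zero>\<^bsub>H\<^esub>" "\<zero>\<^bsub>H\<^esub>" y] by simp

lemma cinner_zero_right: "y \<in> carrier H \<Longrightarrow> cinner H y \<zero>\<^bsub>H\<^esub> = 0"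
  using cinner_commute[of "\<zero>\<^bsub>H\<^esub>" y] cinner_zero_left by simp

lemma cinner_self_nonneg: "x \<in> carrier H \<Longrightarrow> 0 \<le> Re (cinner H x x)"
  using cinner_pos[of x] cinner_zero_left[of x] by (cases "x = \<zero>\<^bsub>H\<^esub>") auto

lemma cinner_self: "x \<in> carrier H \<Longrightarrow> cinner H x x = of_real ((hnorm H x)\<^sup>2)"
proof -
  assume x: "x \<in> carrier H"
  then have "Im (cinner H x x) = 0"
    using cinner_commute[OF x x] by (metis complex_cnj_cancel_iff complex_eq_iff cnj.sel(2) neg_equal_zero)
  then show ?thesis
    using cinner_self_nonneg[OF x] by (simp add: hnorm_def complex_eq_iff)
qed

lemma hnorm_nonneg: "x \<in> carrier H \<Longrightarrow> 0 \<le> hnorm H x"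
  by (simp add: hnorm_def cinner_self_nonneg)

lemma hnorm_eq_0_iff: "x \<in> carrier H \<Longrightarrow> hnorm H x = 0 \<longleftrightarrow> x = \<zero>\<^bsub>H\<^esub>"
  using cinner_pos[of x] by (cases "x = \<zero>\<^bsub>H\<^esub>") (auto simp: hnorm_def cinner_zero_left)

lemma hnorm_minus: "x \<in> carrier H \<Longrightarrow> hnorm H (\<ominus>\<^bsub>H\<^esub> x) = hnorm H x"
  by (simp add: hnorm_def cinner_minus_left cinner_minus_right)

lemma Cauchy_Schwarz:
  assumes x: "x \<in> carrier H" and y: "y \<in> carrier H"
  shows "cmod (cinner H x y) \<le> hnorm H x * hnorm H y"
proof (cases "y = \<zero>\<^bsub>H\<^esub>")
  case True
  then show ?thesis
    using x y hnorm_eq_0_iff[OF y] by (simp add: cinner_zero_right)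
next
  case False
  define b where "b = cinner H y y"
  define c where "c = cinner H x y"
  have b: "b = of_real ((hnorm H y)\<^sup>2)"
    by (simp add: b_def cinner_self y)
  have yx: "cinner H y x = cnj c"
    unfolding c_def by (rule cinner_commute[OF x y])
  have pos: "0 < (hnorm H y)\<^sup>2"
    using False hnorm_eq_0_iff[OF y] by simp
  define u where "u = b \<odot>\<^bsub>H\<^esub> x"
  define w where "w = (- c) \<odot>\<^bsub>H\<^esub> y"
  have uw: "u \<in> carrier H" "w \<in> carrier H"
    unfolding u_def w_def using x y by simp_all
  have "cinner H (u \<oplus>\<^bsub>H\<^esub> w) (u \<oplus>\<^bsub>H\<^esub> w) =
      cinner H u u + cinner H u w + (cinner H w u + cinner H w w)"
    using uw by (simp add: cinner_add_left cinner_add_right)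
  also have "\<dots> = b * cnj b * cinner H x x - b * cnj c * c - (c * cnj b * cnj c - c * cnj c * b)"
    unfolding u_def w_def using x y
    by (simp add: cinner_smult_left cinner_smult_right yx flip: c_def b_def)
  also have "\<dots> = of_real ((hnorm H y)\<^sup>2 * ((hnorm H x)\<^sup>2 * (hnorm H y)\<^sup>2 - (cmod c)\<^sup>2))"
    unfolding b cinner_self[OF x]
    by (simp add: algebra_simps complex_norm_square[symmetric] power2_eq_square)
  finally have "0 \<le> (hnorm H y)\<^sup>2 * ((hnorm H x)\<^sup>2 * (hnorm H y)\<^sup>2 - (cmod c)\<^sup>2)"
    using cinner_self_nonneg[of "u \<oplus>\<^bsub>H\<^esub> w"] uw by simp
  then have "0 \<le> (hnorm H x)\<^sup>2 * (hnorm H y)\<^sup>2 - (cmod c)\<^sup>2"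
    using pos by (simp add: zero_le_mult_iff)
  then have "(cmod c)\<^sup>2 \<le> (hnorm H x * hnorm H y)\<^sup>2"
    by (simp add: power_mult_distrib)
  then show ?thesis
    unfolding c_def using hnorm_nonneg[OF x] hnorm_nonneg[OF y]
    by (metis mult_nonneg_nonneg power2_le_imp_le)
qed

lemma hnorm_triangle:
  assumes x: "x \<in> carrier H" and y: "y \<in> carrier H"
  shows "hnorm H (x \<oplus>\<^bsub>H\<^esub> y) \<le> hnorm H x + hnorm H y"
proof -
  have "complex_of_real ((hnorm H (x \<oplus>\<^bsub>H\<^esub> y))\<^sup>2) =
      of_real ((hnorm H x)\<^sup>2) + cinner H x y + (cnj (cinner H x y) + of_real ((hnorm H y)\<^sup>2))"
    using x y cinner_commute[OF x y]
    by (simp add: cinner_add_left cinner_add_right del: of_real_power flip: cinner_self)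
  then have "(hnorm H (x \<oplus>\<^bsub>H\<^esub> y))\<^sup>2 = (hnorm H x)\<^sup>2 + 2 * Re (cinner H x y) + (hnorm H y)\<^sup>2"
    by (simp add: complex_eq_iff)
  also have "\<dots> \<le> (hnorm H x + hnorm H y)\<^sup>2"
    using Cauchy_Schwarz[OF x y] complex_Re_le_cmod[of "cinner H x y"]
    by (simp add: power2_sum)
  finally show ?thesis
    using hnorm_nonneg[OF x] hnorm_nonneg[OF y] by (meson add_nonneg_nonneg power2_le_imp_le)
qed

lemma metric_hdist: "Metric_space (carrier H) (hdist H)"
proof
  fix x y
  show "0 \<le> hdist H x y"
    by (simp add: hdist_def hnorm_nonneg)
  show "hdist H x y = hdist H y x"
  proof (cases "x \<in> carrier H \<and> y \<in> carrier H")
    case True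
    then have "y \<ominus>\<^bsub>H\<^esub> x = \<ominus>\<^bsub>H\<^esub> (x \<ominus>\<^bsub>H\<^esub> y)"
      by (simp add: a_minus_def M.minus_add M.a_comm)
    then show ?thesis
      using True by (simp add: hdist_def hnorm_minus)
  qed (auto simp: hdist_def)
next
  fix x y assume *: "x \<in> carrier H" "y \<in> carrier H"
  then have "x = (x \<ominus>\<^bsub>H\<^esub> y) \<oplus>\<^bsub>H\<^esub> y"
    by (simp add: a_minus_def M.a_assoc M.l_neg)
  then have "x \<ominus>\<^bsub>H\<^esub> y = \<zero>\<^bsub>H\<^esub> \<longleftrightarrow> x = y"
    using * by (metis M.l_zero M.minus_eq M.r_neg)
  then show "hdist H x y = 0 \<longleftrightarrow> x = y"
    using * by (simp add: hdist_def hnorm_eq_0_iff)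
next
  fix x y z assume *: "x \<in> carrier H" "y \<in> carrier H" "z \<in> carrier H"
  then have "x \<ominus>\<^bsub>H\<^esub> z = (x \<ominus>\<^bsub>H\<^esub> y) \<oplus>\<^bsub>H\<^esub> (y \<ominus>\<^bsub>H\<^esub> z)"
    by (simp add: a_minus_def M.a_assoc M.r_neg1)
  then show "hdist H x z \<le> hdist H x y + hdist H y z"
    using * hnorm_triangle[of "x \<ominus>\<^bsub>H\<^esub> y" "y \<ominus>\<^bsub>H\<^esub> z"] by (simp add: hdist_def)
qed

end


section \<open>Independence of the underlying type\<close>

definition transport :: "('h \<Rightarrow> 'k) \<Rightarrow> ('h, 'r) inner_module_scheme \<Rightarrow> 'k inner_module" where
  "transport c H = (let j = inv_into (carrier H) c in
    \<lparr>carrier = c ` carrier H, monoid.mult = (\<lambda>_ _. undefined), one = undefined,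
     ring.zero = c \<zero>\<^bsub>H\<^esub>, add = (\<lambda>x y. c (j x \<oplus>\<^bsub>H\<^esub> j y)),
     smult = (\<lambda>a x. c (a \<odot>\<^bsub>H\<^esub> j x)), cinner = (\<lambda>x y. cinner H (j x) (j y))\<rparr>)"

lemma irreducible_transport:
  fixes G :: "('g, 'm) monoid_scheme" and H :: "('h, 'r) inner_module_scheme" and c :: "'h \<Rightarrow> 'k"
  assumes irr: "irreducible_unitary_representation G H \<pi>"
    and inj: "inj_on c (carrier H)"
  defines "H' \<equiv> transport c H"
  defines "\<pi>' \<equiv> \<lambda>g. \<lambda>x\<in>carrier H'. c (\<pi> g (inv_into (carrier H) c x))"
  shows "irreducible_unitary_representation G H' \<pi>'"
proof -
  interpret irreducible_unitary_representation G H \<pi> by (rule irr)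
  interpret met: Metric_space "carrier H" "hdist H" by (rule metric_hdist)
  define j where "j = inv_into (carrier H) c"
  have jc [simp]: "j (c x) = x" if "x \<in> carrier H" for x
    unfolding j_def using inj that by (rule inv_into_f_f)
  have H': "carrier H' = c ` carrier H" "\<zero>\<^bsub>H'\<^esub> = c \<zero>\<^bsub>H\<^esub>" "x \<oplus>\<^bsub>H'\<^esub> y = c (j x \<oplus>\<^bsub>H\<^esub> j y)"
      "a \<odot>\<^bsub>H'\<^esub> x = c (a \<odot>\<^bsub>H\<^esub> j x)" "cinner H' x y = cinner H (j x) (j y)" for x y a
    by (simp_all add: H'_def transport_def Let_def flip: j_def)
  have cH' [simp]: "c x \<in> carrier H'" if "x \<in> carrier H" for x
    using that by (simp add: H')
  have c_inj: "c x = c y \<longleftrightarrow> x = y" if "x \<in> carrier H" "y \<in> carrier H" for x y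
    using inj that by (auto dest: inj_onD)
  have j_carrier: "j x \<in> carrier H" "c (j x) = x" if "x \<in> carrier H'" for x
    using that by (auto simp: H')
  have ops: "c x \<oplus>\<^bsub>H'\<^esub> c y = c (x \<oplus>\<^bsub>H\<^esub> y)" "a \<odot>\<^bsub>H'\<^esub> c x = c (a \<odot>\<^bsub>H\<^esub> x)"
    "cinner H' (c x) (c y) = cinner H x y" if "x \<in> carrier H" "y \<in> carrier H" for x y a
    using that by (simp_all add: H')
  have ag: "abelian_group H'"
  proof (rule abelian_groupI)
    fix x assume "x \<in> carrier H'"
    then show "\<exists>y\<in>carrier H'. y \<oplus>\<^bsub>H'\<^esub> x = \<zero>\<^bsub>H'\<^esub>"
      by (intro bexI[of _ "c (\<ominus>\<^bsub>H\<^esub> j x)"]) (auto simp: H' M.l_neg)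
  qed (auto simp: H' M.a_ac)
  have "Module.module complex_ring H'"
    by (rule moduleI[OF R.is_cring ag])
      (auto simp: H' smult_l_distr[simplified] smult_r_distr[simplified] smult_assoc1[simplified]
        smult_one[simplified])
  then interpret ips': inner_product_space H'
  proof (rule inner_product_space.intro, unfold_locales)
    fix x assume "x \<in> carrier H'" "x \<noteq> \<zero>\<^bsub>H'\<^esub>"
    then have "j x \<in> carrier H" "j x \<noteq> \<zero>\<^bsub>H\<^esub>"
      by (auto simp: H')
    then show "Re (cinner H' x x) > 0"
      by (simp add: H' cinner_pos)
  next
    fix x y assume "x \<in> carrier H'" "y \<in> carrier H'"
    then show "cinner H' y x = cnj (cinner H' x y)"
      using cinner_commute[of "j x" "j y"] by (simp add: H'(5) j_carrier)
  qed (auto simp: H' cinner_add_left cinner_smult_left)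
  interpret met': Metric_space "carrier H'" "hdist H'" by (rule ips'.metric_hdist)
  have minus': "c x \<ominus>\<^bsub>H'\<^esub> c y = c (x \<ominus>\<^bsub>H\<^esub> y)" if "x \<in> carrier H" "y \<in> carrier H" for x y
  proof -
    have "\<ominus>\<^bsub>H'\<^esub> c y = c (\<ominus>\<^bsub>H\<^esub> y)"
      by (rule ips'.M.minus_equality) (use that in \<open>simp_all add: ops M.l_neg\<close>, simp add: H')
    then show ?thesis
      using that by (simp add: a_minus_def ops)
  qed
  have dist': "hdist H' (c x) (c y) = hdist H x y" if "x \<in> carrier H" "y \<in> carrier H" for x y
    using that by (simp add: hdist_def hnorm_def minus' ops)
  have dist: "hdist H (j x) (j y) = hdist H' x y" if "x \<in> carrier H'" "y \<in> carrier H'" for x y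
    using dist'[of "j x" "j y"] that by (simp add: j_carrier)
  have "met'.mcomplete"
    unfolding met'.mcomplete_def
  proof (intro allI impI)
    fix s assume s: "met'.MCauchy s"
    then have sc: "s n \<in> carrier H'" for n
      by (auto simp: met'.MCauchy_def)
    have "met.MCauchy (j \<circ> s)"
      using s sc by (auto simp: met'.MCauchy_def met.MCauchy_def dist j_carrier)
    then obtain l where "limitin met.mtopology (j \<circ> s) l sequentially"
      using complete by (auto simp: met.mcomplete_def)
    then have l: "l \<in> carrier H" "\<And>e. e > 0 \<Longrightarrow> \<forall>\<^sub>F n in sequentially. hdist H (j (s n)) l < e"
      by (auto simp: met.limitin_metric eventually_conj_iff)
    have "hdist H' (s n) (c l) = hdist H (j (s n)) l" for n
      using dist[of "s n" "c l"] sc l by simp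
    then show "\<exists>x. limitin met'.mtopology s x sequentially"
      using l sc by (intro exI[of _ "c l"]) (auto simp: met'.limitin_metric)
  qed
  then interpret hs': hilbert_space H'
    by unfold_locales
  have rep_carrier [simp]: "\<pi> g x \<in> carrier H" if "g \<in> carrier G" "x \<in> carrier H" for g x
    using that element_image by blast
  have rep': "\<pi>' g (c x) = c (\<pi> g x)" if "x \<in> carrier H" for g x
    using that by (simp add: \<pi>'_def flip: j_def)
  have bij: "\<pi>' g \<in> Bij (carrier H')" if g: "g \<in> carrier G" for g
  proof -
    have "bij_betw (\<pi> g) (carrier H) (carrier H)"
      using bij_prop0[OF g] by (simp add: Bij_def)
    moreover have "bij_betw c (carrier H) (carrier H')"
      using inj by (simp add: bij_betw_def H')
    moreover have "bij_betw j (carrier H') (carrier H)"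
      unfolding j_def H' using inj by (simp add: bij_betw_inv_into inj_on_imp_bij_betw)
    ultimately have "bij_betw (c \<circ> (\<pi> g \<circ> j)) (carrier H') (carrier H')"
      by (blast intro: bij_betw_trans)
    then have "bij_betw (\<pi>' g) (carrier H') (carrier H')"
      by (rule bij_betw_cong[THEN iffD1, rotated]) (simp add: \<pi>'_def j_def)
    then show ?thesis
      by (simp add: Bij_def \<pi>'_def)
  qed
  have "\<pi>' \<in> hom G (BijGroup (carrier H'))"
  proof (rule homI)
    fix g h assume gh: "g \<in> carrier G" "h \<in> carrier G"
    have "\<pi>' (g \<otimes>\<^bsub>G\<^esub> h) = compose (carrier H') (\<pi>' g) (\<pi>' h)"
    proof (rule extensionalityI[of _ "carrier H'"])
      fix x' assume "x' \<in> carrier H'"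
      then obtain x where "x' = c x" "x \<in> carrier H" by (auto simp: H')
      then show "\<pi>' (g \<otimes>\<^bsub>G\<^esub> h) x' = compose (carrier H') (\<pi>' g) (\<pi>' h) x'"
        using gh by (simp add: rep' compose_def composition_rule)
    qed (simp_all add: \<pi>'_def)
    then show "\<pi>' (g \<otimes>\<^bsub>G\<^esub> h) = \<pi>' g \<otimes>\<^bsub>BijGroup (carrier H')\<^esub> \<pi>' h"
      using gh by (simp add: BijGroup_def bij)
  qed (simp add: BijGroup_def bij)
  then have "group_hom G (BijGroup (carrier H')) \<pi>'"
    by (simp add: group_hom_def group_hom_axioms_def G.is_group group_BijGroup)
  then interpret act': group_action G "carrier H'" \<pi>'
    by (rule group_action.intro)
  interpret ur': unitary_representation G H' \<pi>'
  proof
    fix g x' y' a assume g: "g \<in> carrier G" and x': "x' \<in> carrier H'"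
    then obtain x where x: "x' = c x" "x \<in> carrier H" by (auto simp: H')
    show "\<pi>' g (a \<odot>\<^bsub>H'\<^esub> x') = a \<odot>\<^bsub>H'\<^esub> \<pi>' g x'"
      using g x by (simp add: rep' ops rep_smult)
    assume y': "y' \<in> carrier H'"
    then obtain y where y: "y' = c y" "y \<in> carrier H" by (auto simp: H')
    show "\<pi>' g (x' \<oplus>\<^bsub>H'\<^esub> y') = \<pi>' g x' \<oplus>\<^bsub>H'\<^esub> \<pi>' g y'"
      using g x y by (simp add: rep' ops rep_add)
    show "cinner H' (\<pi>' g x') (\<pi>' g y') = cinner H' x' y'"
      using g x y by (simp add: rep' ops rep_cinner)
  qed
  show ?thesis
  proof
    show "carrier H' \<noteq> {\<zero>\<^bsub>H'\<^esub>}"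
    proof
      assume *: "carrier H' = {\<zero>\<^bsub>H'\<^esub>}"
      have "x = \<zero>\<^bsub>H\<^esub>" if "x \<in> carrier H" for x
        using cH'[OF that] that c_inj[of x "\<zero>\<^bsub>H\<^esub>"] unfolding * by (simp add: H')
      then show False
        using nonzero by auto
    qed
  next
    fix W' assume W': "submodule W' complex_ring H'" "closedin met'.mtopology W'"
      and inv: "\<And>g. g \<in> carrier G \<Longrightarrow> \<pi>' g ` W' \<subseteq> W'"
    interpret W': submodule W' complex_ring H' by (rule W')
    define W where "W = {x \<in> carrier H. c x \<in> W'}"
    have W'_eq: "W' = c ` W"
      using W'.subset by (auto simp: W_def H')
    have neg: "c (\<ominus>\<^bsub>H\<^esub> x) = \<ominus>\<^bsub>H'\<^esub> c x" if "x \<in> carrier H" for x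
      using minus'[of "\<zero>\<^bsub>H\<^esub>" x] that by (simp add: a_minus_def) (simp flip: H'(2))
    have "submodule W complex_ring H"
    proof (rule submoduleI)
      show "\<zero>\<^bsub>H\<^esub> \<in> W"
        using W'.one_closed by (simp add: W_def H')
    next
      fix x assume "x \<in> W"
      then show "\<ominus>\<^bsub>H\<^esub> x \<in> W"
        using W'.m_inv_closed[of "c x"] by (simp add: W_def neg flip: a_inv_def)
    next
      fix x y assume "x \<in> W" "y \<in> W"
      then show "x \<oplus>\<^bsub>H\<^esub> y \<in> W"
        using W'.m_closed[of "c x" "c y"] by (simp add: W_def ops)
    next
      fix a x assume "x \<in> W"
      then show "a \<odot>\<^bsub>H\<^esub> x \<in> W"
        using W'.smult_closed[of a "c x"] ops(2)[of x x] by (simp add: W_def)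
    qed (auto simp: W_def)
    moreover have "closedin met.mtopology W"
      unfolding met.closedin_metric
    proof (intro conjI allI impI)
      fix x assume x: "x \<in> carrier H - W"
      then have "c x \<in> carrier H' - W'"
        by (auto simp: W_def)
      then obtain r where r: "r > 0" "disjnt W' (met'.mball (c x) r)"
        using W'(2) by (auto simp: met'.closedin_metric)
      then show "\<exists>r>0. disjnt W (met.mball x r)"
        using x by (intro exI[of _ r]) (simp add: disjnt_iff W_def, metis cH' dist')
    qed (auto simp: W_def)
    moreover have "\<pi> g ` W \<subseteq> W" if "g \<in> carrier G" for g
    proof (clarsimp simp: W_def that)
      fix x assume "x \<in> carrier H" "c x \<in> W'"
      then show "c (\<pi> g x) \<in> W'"
        using inv[OF that] rep'[of x g] by (metis image_subset_iff)
    qed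
    ultimately have "W = {\<zero>\<^bsub>H\<^esub>} \<or> W = carrier H"
      by (rule irreducible)
    then show "W' = {\<zero>\<^bsub>H'\<^esub>} \<or> W' = carrier H'"
      by (auto simp: W'_eq H')
  qed
qed

lemma irreducibly_faithfulI:
  fixes G :: "('g, 'm) monoid_scheme" and H :: "('h, 'r) inner_module_scheme"
  assumes irr: "irreducible_unitary_representation G H \<pi>"
    and faithful: "\<And>x. x \<in> F \<Longrightarrow> x \<noteq> \<one>\<^bsub>G\<^esub> \<Longrightarrow> \<pi> x \<noteq> (\<lambda>v\<in>carrier H. v)"
    and F: "F \<subseteq> carrier G"
  shows "irreducibly_faithful G F"
proof -
  interpret irreducible_unitary_representation G H \<pi> by (rule irr)
  interpret met: Metric_space "carrier H" "hdist H" by (rule metric_hdist)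
  have rep_carrier [simp]: "\<pi> g x \<in> carrier H" if "g \<in> carrier G" "x \<in> carrier H" for g x
    using that element_image by blast
  obtain v where v: "v \<in> carrier H" "v \<noteq> \<zero>\<^bsub>H\<^esub>"
    using nonzero M.zero_closed by blast
  define c where "c x = (\<lambda>g. if g \<in> carrier G then cinner H x (\<pi> g v) else 0)" for x
  define W where "W = {x \<in> carrier H. \<forall>g\<in>carrier G. cinner H x (\<pi> g v) = 0}"
  have "submodule W complex_ring H"
    by (rule submoduleI)
      (auto simp: W_def v cinner_zero_left cinner_minus_left cinner_add_left cinner_smult_left)
  moreover have "closedin met.mtopology W"
    unfolding met.closedin_metric
  proof (intro conjI allI impI)
    fix x assume "x \<in> carrier H - W"
    then obtain g where x: "x \<in> carrier H" and g: "g \<in> carrier G"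
      and nz: "cinner H x (\<pi> g v) \<noteq> 0"
      by (auto simp: W_def)
    define N where "N = hnorm H (\<pi> g v)"
    have N: "N \<ge> 0"
      unfolding N_def by (simp add: hnorm_nonneg g v)
    define r where "r = cmod (cinner H x (\<pi> g v)) / (N + 1)"
    have r: "r > 0"
      using nz N by (simp add: r_def)
    have "y \<notin> W" if y: "y \<in> carrier H" "hdist H x y < r" for y
    proof
      assume "y \<in> W"
      then have "cinner H x (\<pi> g v) = cinner H (x \<ominus>\<^bsub>H\<^esub> y) (\<pi> g v)"
        using x y g v by (simp add: a_minus_def cinner_add_left cinner_minus_left W_def)
      also have "cmod \<dots> \<le> hdist H x y * N"
        unfolding N_def using Cauchy_Schwarz[of "x \<ominus>\<^bsub>H\<^esub> y" "\<pi> g v"] x y g v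
        by (simp add: hdist_def)
      also have "\<dots> \<le> r * N"
        using y N by (intro mult_right_mono) auto
      also have "\<dots> < r * (N + 1)"
        using r by simp
      also have "\<dots> = cmod (cinner H x (\<pi> g v))"
        using N by (simp add: r_def)
      finally show False by simp
    qed
    then show "\<exists>r>0. disjnt W (met.mball x r)"
      using r by (intro exI[of _ r]) (auto simp: disjnt_iff)
  qed (auto simp: W_def)
  moreover have "\<pi> g ` W \<subseteq> W" if g: "g \<in> carrier G" for g
  proof -
    have "cinner H (\<pi> g x) (\<pi> h v) = 0" if x: "x \<in> W" and h: "h \<in> carrier G" for x h
    proof -
      have "\<pi> h v = \<pi> g (\<pi> (inv\<^bsub>G\<^esub> g \<otimes>\<^bsub>G\<^esub> h) v)"
        using composition_rule[OF v(1) g, of "inv\<^bsub>G\<^esub> g \<otimes>\<^bsub>G\<^esub> h"] g h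
        by (simp flip: G.m_assoc)
      then show ?thesis
        using x g h v by (simp add: W_def rep_cinner)
    qed
    then show ?thesis
      using g by (auto simp: W_def)
  qed
  ultimately have "W = {\<zero>\<^bsub>H\<^esub>} \<or> W = carrier H"
    by (rule irreducible)
  moreover have "v \<notin> W"
  proof
    assume "v \<in> W"
    then have "cinner H v (\<pi> \<one>\<^bsub>G\<^esub> v) = 0"
      by (simp add: W_def)
    moreover have "\<pi> \<one>\<^bsub>G\<^esub> v = v"
      using v(1) id_eq_one by (metis restrict_apply')
    ultimately show False
      using cinner_pos[OF v] by simp
  qed
  ultimately have W: "W = {\<zero>\<^bsub>H\<^esub>}"
    using v by auto
  have inj: "inj_on c (carrier H)"
  proof (rule inj_onI)
    fix x y assume xy: "x \<in> carrier H" "y \<in> carrier H" "c x = c y"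
    have "cinner H x (\<pi> g v) = cinner H y (\<pi> g v)" if "g \<in> carrier G" for g
      using fun_cong[OF xy(3), of g] that by (simp add: c_def)
    then have "x \<ominus>\<^bsub>H\<^esub> y \<in> W"
      using xy v by (simp add: W_def a_minus_def cinner_add_left cinner_minus_left)
    then have "hdist H x y = 0"
      using xy hnorm_eq_0_iff[of "\<zero>\<^bsub>H\<^esub>"] by (simp add: W hdist_def)
    then show "x = y"
      using xy by simp
  qed
  define H' where "H' = transport c H"
  define \<pi>' where "\<pi>' = (\<lambda>g. \<lambda>x\<in>carrier H'. c (\<pi> g (inv_into (carrier H) c x)))"
  have "\<pi>' x \<noteq> (\<lambda>v\<in>carrier H'. v)" if x: "x \<in> F" "x \<noteq> \<one>\<^bsub>G\<^esub>" for x
  proof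
    assume *: "\<pi>' x = (\<lambda>v\<in>carrier H'. v)"
    have xG: "x \<in> carrier G"
      using x F by auto
    have "\<pi> x w = w" if w: "w \<in> carrier H" for w
    proof -
      have "c w \<in> carrier H'"
        using w by (simp add: H'_def transport_def Let_def)
      then have "c (\<pi> x w) = c w"
        using fun_cong[OF *, of "c w"] w inj by (simp add: \<pi>'_def)
      then show ?thesis
        using inj w xG by (auto dest: inj_onD)
    qed
    then have "\<pi> x = (\<lambda>v\<in>carrier H. v)"
      using bij_prop0[OF xG]
      by (intro extensionalityI[of _ "carrier H"]) (auto simp: Bij_def)
    then show False
      using faithful x by blast
  qed
  moreover have "irreducible_unitary_representation G H' \<pi>'"
    unfolding H'_def \<pi>'_def by (rule irreducible_transport[OF irr inj])
  ultimately show ?thesis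
    unfolding irreducibly_faithful_def by blast
qed

end

theory Submission
  imports Defs "HOL-Algebra.SndIsomorphismGrp" "HOL-Algebra.Sylow"
begin

text \<open>
  Let \<open>G\<close> be a countable group. A state (normalised function of positive type) that maximises a
  strictly convex functional is extreme, so its GNS representation is irreducible. Starting from a
  character of a finite subgroup \<open>A\<close>, extended by \<open>0\<close>, this yields an irreducible representation that
  is nontrivial on finitely many given normal subgroups, provided that each of them is infinite or
  the character is nontrivial on its intersection with \<open>A\<close>. Conversely, an irreducible
  representation has a common eigenvector for every finite abelian subgroup \<open>V\<close>, and the eigenvalues form
  a character of \<open>V\<close> that is nontrivial on each normal subgroup inside \<open>V\<close> on which the
  representation is nontrivial.

  Nonabelian minimal normal subgroups are no obstruction, so the question becomes one about
  characters of finite abelian normal subgroups. If \<open>P(n - 1)\<close> holds and \<open>P(n)\<close> fails, there is such a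
  subgroup \<open>M\<close> that contains exactly \<open>n\<close> minimal normal subgroups of \<open>G\<close>, all isomorphic to one
  \<open>G\<close>-module \<open>Y\<close>: otherwise characters for the different isomorphism types, which exist by
  \<open>P(n - 1)\<close>, could be multiplied. With \<open>q = |End Y|\<close> one has \<open>n (q - 1) = |Hom(Y, M)| - 1\<close>, where
  \<open>q\<close> and \<open>|Hom(Y, M)|\<close> are powers of the same prime, and hence \<open>n = 1 + q + \<dots> + q\<^sup>m\<close>.
\<close>

section \<open>Completion of a semi-inner product space\<close>

text \<open>The kernel of a representation is normal, so an element can be replaced by a normal
  subgroup inside its normal closure, and faithfulness on a finite set becomes nontriviality on
  finitely many normal subgroups. The obstacle is irreducibility: inducing a character usually gives
  a reducible representation, and passing to a constituent may lose control of where it is trivial.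
  Hence one affine functional of the state watches all the subgroups at once. Each subgroup on which
  the state is constantly 1 contributes 1, no subgroup contributes less than 0, and the total is
  kept below 1 while the state is moved to an extreme one. Countability enters only there, through a
  series over the whole group. The exceptional numbers come from projective geometry. By Schur and
  Wedderburn \<open>End Y\<close> is a field with \<open>q\<close> elements, and the minimal normal
  subgroups in \<open>M\<close> are the points of the projective space of \<open>Hom(Y, M)\<close>.
  A space of dimension s has (q^s - 1) / (q - 1) points, and n \<ge> 2 rules out s \<le> 1.\<close>

locale semi_inner_product =
  fixes add :: "'d \<Rightarrow> 'd \<Rightarrow> 'd" and scale :: "complex \<Rightarrow> 'd \<Rightarrow> 'd"
    and ip :: "'d \<Rightarrow> 'd \<Rightarrow> complex"
  assumes ip_add_left: "ip (add x y) z = ip x z + ip y z"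
    and ip_scale_left: "ip (scale a x) y = a * ip x y"
    and ip_commute: "ip y x = cnj (ip x y)"
    and ip_nonneg: "0 \<le> Re (ip x x)"
begin

definition seminorm :: "'d \<Rightarrow> real" where
  "seminorm x = sqrt (Re (ip x x))"

text \<open>A difference only in the sense of \<open>ip\<close>. No vector space laws are imposed on
  \<open>add\<close> and \<open>scale\<close>; in the later instance \<open>add\<close> is
  concatenation of lists. Identities between vectors are therefore replaced by identities between
  their pairings.\<close>

definition diff :: "'d \<Rightarrow> 'd \<Rightarrow> 'd" where
  "diff x y = add x (scale (- 1) y)"

lemma ip_add_right: "ip x (add y z) = ip x y + ip x z"
  using ip_add_left[of y z x] by (simp add: ip_commute[of x])

lemma ip_scale_right: "ip x (scale a y) = cnj a * ip x y"
  using ip_scale_left[of a y x] by (simp add: ip_commute[of x])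

lemma ip_diff_left: "ip (diff x y) z = ip x z - ip y z"
  by (simp add: diff_def ip_add_left ip_scale_left)

lemma ip_diff_right: "ip x (diff y z) = ip x y - ip x z"
  by (simp add: diff_def ip_add_right ip_scale_right)

lemmas ip_simps = ip_add_left ip_add_right ip_scale_left ip_scale_right ip_diff_left ip_diff_right

lemma seminorm_nonneg: "0 \<le> seminorm x"
  by (simp add: seminorm_def ip_nonneg)

lemma ip_self: "ip x x = of_real ((seminorm x)\<^sup>2)"
proof -
  have "Im (ip x x) = 0"
    using ip_commute[of x x] by (metis cnj.sel(2) equal_neg_zero)
  then show ?thesis
    using ip_nonneg[of x] by (simp add: seminorm_def complex_eq_iff)
qed

text \<open>Nonnegativity of the form at x - t c y, with c = \<open>ip x y\<close> and t real, is a
  quadratic inequality in t. Vectors of seminorm 0 need not pair to 0 by definition, so that case is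
  treated separately.\<close>

lemma semi_Cauchy_Schwarz: "cmod (ip x y) \<le> seminorm x * seminorm y"
proof -
  define c where "c = ip x y"
  have yx: "ip y x = cnj c"
    unfolding c_def by (rule ip_commute)
  have *: "0 \<le> (seminorm x)\<^sup>2 - 2 * t * (cmod c)\<^sup>2 + t\<^sup>2 * (cmod c)\<^sup>2 * (seminorm y)\<^sup>2" for t :: real
  proof -
    define z where "z = diff x (scale (of_real t * c) y)"
    have "ip z z = ip x x - of_real t * cnj c * c - (of_real t * c * cnj c
        - of_real t * c * (of_real t * cnj c) * ip y y)"
      unfolding z_def by (simp add: ip_simps yx algebra_simps flip: c_def)
    also have "\<dots> = of_real ((seminorm x)\<^sup>2 - 2 * t * (cmod c)\<^sup>2 + t\<^sup>2 * (cmod c)\<^sup>2 * (seminorm y)\<^sup>2)"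
    proof -
      have "(complex_of_real (cmod c))\<^sup>2 = c * cnj c"
        using complex_norm_square[of c] by simp
      then show ?thesis
        by (simp add: ip_self) (simp add: power2_eq_square algebra_simps)
    qed
    finally show ?thesis
      using ip_nonneg[of z] by (metis Re_complex_of_real)
  qed
  have "(cmod c)\<^sup>2 \<le> (seminorm x * seminorm y)\<^sup>2"
  proof (cases "c = 0")
    case False
    show ?thesis
    proof (cases "seminorm y = 0")
      case True
      \<comment> \<open>The quadratic term is gone, and this t makes the remaining linear expression
        equal to -1, a contradiction.\<close>
      then show ?thesis
        using *[of "((seminorm x)\<^sup>2 + 1) / (2 * (cmod c)\<^sup>2)"] False by (simp add: field_simps)
    next
      case y: False
      have "0 \<le> (seminorm x)\<^sup>2 - (cmod c)\<^sup>2 / (seminorm y)\<^sup>2"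
        using *[of "1 / (seminorm y)\<^sup>2"] y by (simp add: power2_eq_square)
      then show ?thesis
        using y by (simp add: field_simps power_mult_distrib)
    qed
  qed simp
  then show ?thesis
    unfolding c_def using seminorm_nonneg by (metis mult_nonneg_nonneg power2_le_imp_le)
qed

definition semi_Cauchy :: "(nat \<Rightarrow> 'd) \<Rightarrow> bool" where
  "semi_Cauchy s \<longleftrightarrow> (\<forall>e>0. \<exists>N. \<forall>m\<ge>N. \<forall>n\<ge>N. seminorm (diff (s m) (s n)) < e)"

text \<open>
  Elements of the completion are encoded as functionals, so that no quotient has to be taken: a Cauchy
  sequence \<open>s\<close> stands for \<open>\<lambda>d. lim (\<lambda>n. ip (s n) d)\<close>.
\<close>

definition represents :: "(nat \<Rightarrow> 'd) \<Rightarrow> ('d \<Rightarrow> complex) \<Rightarrow> bool" where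
  "represents s f \<longleftrightarrow> semi_Cauchy s \<and> (\<forall>d. (\<lambda>n. ip (s n) d) \<longlonglongrightarrow> f d)"

lemma seminorm_triangle: "seminorm (add x y) \<le> seminorm x + seminorm y"
proof -
  have "Re (ip (add x y) (add x y)) = Re (ip x x) + Re (ip x y) + (Re (ip y x) + Re (ip y y))"
    by (simp add: ip_simps)
  also have "\<dots> = (seminorm x)\<^sup>2 + 2 * Re (ip x y) + (seminorm y)\<^sup>2"
    by (simp add: ip_self ip_commute[of y x])
  also have "\<dots> \<le> (seminorm x + seminorm y)\<^sup>2"
    using semi_Cauchy_Schwarz[of x y] complex_Re_le_cmod[of "ip x y"] by (simp add: power2_sum)
  finally show ?thesis
    using seminorm_nonneg by (simp add: seminorm_def[of "add x y"] real_le_lsqrt)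
qed

lemma seminorm_le_diff: "seminorm x \<le> seminorm y + seminorm (diff x y)"
proof -
  have "seminorm x = seminorm (add y (diff x y))"
    by (simp add: seminorm_def ip_simps)
  then show ?thesis
    by (simp add: seminorm_triangle)
qed

lemma semi_Cauchy_bounded:
  assumes "semi_Cauchy s"
  obtains C where "C > 0" "\<And>n. seminorm (s n) \<le> C"
proof -
  obtain N where N: "\<And>n. n \<ge> N \<Longrightarrow> seminorm (diff (s n) (s N)) < 1"
    using assms unfolding semi_Cauchy_def by (metis order_refl zero_less_one)
  define C where "C = Max (insert 1 ((\<lambda>n. seminorm (s n) + 1) ` {..N}))"
  have C: "C \<ge> 1" "\<And>n. n \<le> N \<Longrightarrow> seminorm (s n) + 1 \<le> C"
    unfolding C_def by (auto intro: Max_ge simp del: Max_insert)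
  have "seminorm (s n) \<le> C" for n
  proof (cases "n \<le> N")
    case False
    then show ?thesis
      using seminorm_le_diff[of "s n" "s N"] N[of n] C(2)[of N] by simp
  qed (use C(2)[of n] in simp)
  with C(1) that[of C] show thesis by simp
qed

text \<open>Convergence of the functionals is uniform relative to the seminorm of the argument, so
  the argument may itself vary with n.\<close>

lemma represents_dist:
  assumes "represents s f" "e > 0"
  obtains N where "\<And>n d. n \<ge> N \<Longrightarrow> cmod (ip (s n) d - f d) \<le> e * seminorm d"
proof -
  obtain N where N: "\<And>m n. m \<ge> N \<Longrightarrow> n \<ge> N \<Longrightarrow> seminorm (diff (s m) (s n)) < e"
    using assms unfolding represents_def semi_Cauchy_def by metis
  have "cmod (ip (s n) d - f d) \<le> e * seminorm d" if n: "n \<ge> N" for n d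
  proof (rule tendsto_upperbound)
    show "(\<lambda>m. cmod (ip (s n) d - ip (s m) d)) \<longlonglongrightarrow> cmod (ip (s n) d - f d)"
      using assms(1) unfolding represents_def by (intro tendsto_intros) auto
    show "\<forall>\<^sub>F m in sequentially. cmod (ip (s n) d - ip (s m) d) \<le> e * seminorm d"
      using eventually_ge_at_top[of N]
    proof eventually_elim
      case (elim m)
      have "cmod (ip (diff (s n) (s m)) d) \<le> seminorm (diff (s n) (s m)) * seminorm d"
        by (rule semi_Cauchy_Schwarz)
      also have "\<dots> \<le> e * seminorm d"
        using N[OF n elim] by (intro mult_right_mono) (auto simp: seminorm_nonneg)
      finally show ?case by (simp add: ip_simps)
    qed
  qed simp
  then show thesis by (rule that)
qed

lemma represents_bounded:
  assumes "represents s f"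
  obtains C where "C > 0" "\<And>d. cmod (f d) \<le> C * seminorm d"
proof -
  obtain C where C: "C > 0" "\<And>n. seminorm (s n) \<le> C"
    using assms semi_Cauchy_bounded unfolding represents_def by metis
  have "cmod (f d) \<le> C * seminorm d" for d
  proof (rule tendsto_upperbound)
    show "(\<lambda>m. cmod (ip (s m) d)) \<longlonglongrightarrow> cmod (f d)"
      using assms unfolding represents_def by (intro tendsto_intros) auto
    have "cmod (ip (s m) d) \<le> C * seminorm d" for m
      using semi_Cauchy_Schwarz[of "s m" d] C(2)[of m]
      by (meson mult_right_mono order_trans seminorm_nonneg)
    then show "\<forall>\<^sub>F m in sequentially. cmod (ip (s m) d) \<le> C * seminorm d"
      by simp
  qed simp
  with C(1) that show thesis by blast
qed

lemma represents_linear: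
  assumes "represents s f"
  shows "f (add x y) = f x + f y" "f (scale a x) = cnj a * f x" "f (diff x y) = f x - f y"
proof -
  have lim: "(\<lambda>n. ip (s n) d) \<longlonglongrightarrow> f d" for d
    using assms by (simp add: represents_def)
  show "f (add x y) = f x + f y"
    using lim[of "add x y"] tendsto_add[OF lim lim, of x y]
    by (simp add: ip_simps LIMSEQ_unique)
  show "f (scale a x) = cnj a * f x"
    using lim[of "scale a x"] tendsto_mult_left[OF lim, of "cnj a" x]
    by (simp add: ip_simps LIMSEQ_unique)
  show "f (diff x y) = f x - f y"
    using lim[of "diff x y"] tendsto_diff[OF lim lim, of x y]
    by (simp add: ip_simps LIMSEQ_unique)
qed

lemma represents_ip:
  assumes s: "represents s f" and t: "represents t g"
  shows "(\<lambda>n. ip (s n) (t n) - f (t n)) \<longlonglongrightarrow> 0"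
proof (rule LIMSEQ_I)
  fix e :: real assume e: "0 < e"
  obtain C where C: "C > 0" "\<And>n. seminorm (t n) \<le> C"
    using t semi_Cauchy_bounded unfolding represents_def by metis
  obtain N where N: "\<And>n d. n \<ge> N \<Longrightarrow> cmod (ip (s n) d - f d) \<le> e / (2 * C) * seminorm d"
    using represents_dist[OF s, of "e / (2 * C)"] e C(1) by auto
  have "cmod (ip (s n) (t n) - f (t n)) < e" if "n \<ge> N" for n
  proof -
    have "cmod (ip (s n) (t n) - f (t n)) \<le> e / (2 * C) * seminorm (t n)"
      using N[OF that] .
    also have "\<dots> \<le> e / (2 * C) * C"
      using C e by (intro mult_left_mono) auto
    also have "\<dots> < e"
      using C(1) e by (simp add: field_simps)
    finally show ?thesis .
  qed
  then show "\<exists>N. \<forall>n\<ge>N. cmod (ip (s n) (t n) - f (t n) - 0) < e"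
    by auto
qed

text \<open>The first sequence mentions \<open>s\<close> only through its functional, and the third
  mentions \<open>t\<close> only through its functional. The common limit is therefore independent
  of both representing sequences.\<close>

lemma represents_convergent:
  assumes s: "represents s f" and t: "represents t g"
  obtains l where "(\<lambda>n. f (t n)) \<longlonglongrightarrow> l" "(\<lambda>n. ip (s n) (t n)) \<longlonglongrightarrow> l"
    "(\<lambda>n. cnj (g (s n))) \<longlonglongrightarrow> l"
proof -
  obtain C where C: "C > 0" "\<And>d. cmod (f d) \<le> C * seminorm d"
    using represents_bounded[OF s] by metis
  have "Cauchy (\<lambda>n. f (t n))"
  proof (rule metric_CauchyI)
    fix e :: real assume e: "0 < e"
    then obtain N where N: "\<And>m n. m \<ge> N \<Longrightarrow> n \<ge> N \<Longrightarrow> seminorm (diff (t m) (t n)) < e / C"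
      using t C(1) unfolding represents_def semi_Cauchy_def by (metis divide_pos_pos)
    have "dist (f (t m)) (f (t n)) < e" if "m \<ge> N" "n \<ge> N" for m n
      using C(2)[of "diff (t m) (t n)"] N[OF that] C(1)
      by (simp add: dist_norm represents_linear[OF s] field_simps)
    then show "\<exists>M. \<forall>m\<ge>M. \<forall>n\<ge>M. dist (f (t m)) (f (t n)) < e"
      by (intro exI[of _ N]) simp
  qed
  then have "convergent (\<lambda>n. f (t n))"
    by (rule Cauchy_convergent)
  then obtain l where l: "(\<lambda>n. f (t n)) \<longlonglongrightarrow> l"
    by (auto simp: convergent_def)
  moreover from this have ip: "(\<lambda>n. ip (s n) (t n)) \<longlonglongrightarrow> l"
    using tendsto_add[OF represents_ip[OF s t] l] by simp
  moreover have "(\<lambda>n. cnj (g (s n))) \<longlonglongrightarrow> l"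
  proof -
    have "(\<lambda>n. cnj (ip (t n) (s n) - g (s n))) \<longlonglongrightarrow> cnj 0"
      by (intro tendsto_intros represents_ip[OF t s])
    moreover have "cnj (ip (t n) (s n)) = ip (s n) (t n)" for n
      by (rule ip_commute[symmetric])
    ultimately have "(\<lambda>n. ip (s n) (t n) - cnj (g (s n))) \<longlonglongrightarrow> 0"
      by simp
    from tendsto_diff[OF ip this] show ?thesis by simp
  qed
  ultimately show thesis by (rule that)
qed

section \<open>The Hilbert space of represented functionals\<close>

definition completion_carrier :: "('d \<Rightarrow> complex) set" where
  "completion_carrier = {f. \<exists>s. represents s f}"

text \<open>The choice of a sequence for \<open>g\<close> is harmless: every choice gives the limit
  of \<open>cnj (g (s n))\<close>, where \<open>s\<close> represents \<open>f\<close>.\<close>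

definition completion_ip :: "('d \<Rightarrow> complex) \<Rightarrow> ('d \<Rightarrow> complex) \<Rightarrow> complex" where
  "completion_ip f g = lim (\<lambda>n. f ((SOME t. represents t g) n))"

definition completion :: "('d \<Rightarrow> complex) inner_module" where
  "completion = \<lparr>carrier = completion_carrier, monoid.mult = (\<lambda>_ _. undefined), one = undefined,
     ring.zero = (\<lambda>_. 0), add = (\<lambda>f g d. f d + g d), smult = (\<lambda>a f d. a * f d),
     cinner = completion_ip\<rparr>"

lemma completion_ip:
  assumes s: "represents s f" and t: "represents t g"
  shows "(\<lambda>n. f (t n)) \<longlonglongrightarrow> completion_ip f g" "(\<lambda>n. ip (s n) (t n)) \<longlonglongrightarrow> completion_ip f g"
proof -
  define u where "u = (SOME t. represents t g)"
  have u: "represents u g"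
    unfolding u_def by (rule someI[of "\<lambda>t. represents t g", OF t])
  obtain l where l: "(\<lambda>n. f (t n)) \<longlonglongrightarrow> l" "(\<lambda>n. ip (s n) (t n)) \<longlonglongrightarrow> l"
    "(\<lambda>n. cnj (g (s n))) \<longlonglongrightarrow> l"
    using represents_convergent[OF s t] by metis
  obtain l' where l': "(\<lambda>n. f (u n)) \<longlonglongrightarrow> l'" "(\<lambda>n. cnj (g (s n))) \<longlonglongrightarrow> l'"
    using represents_convergent[OF s u] by metis
  have "l' = l"
    using l(3) l'(2) by (rule LIMSEQ_unique[rotated])
  moreover have "completion_ip f g = l'"
    unfolding completion_ip_def u_def[symmetric] using l'(1) by (rule limI)
  ultimately show "(\<lambda>n. f (t n)) \<longlonglongrightarrow> completion_ip f g" "(\<lambda>n. ip (s n) (t n)) \<longlonglongrightarrow> completion_ip f g"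
    using l by auto
qed

lemma represents_const: "represents (\<lambda>_. d) (ip d)"
  by (simp add: represents_def semi_Cauchy_def seminorm_def ip_simps)

lemma represents_add:
  assumes s: "represents s f" and t: "represents t g"
  shows "represents (\<lambda>n. add (s n) (t n)) (\<lambda>d. f d + g d)"
proof -
  have "semi_Cauchy (\<lambda>n. add (s n) (t n))"
    unfolding semi_Cauchy_def
  proof (intro allI impI)
    fix e :: real assume "0 < e"
    then have e: "0 < e / 2" by simp
    obtain N where N: "\<And>m n. m \<ge> N \<Longrightarrow> n \<ge> N \<Longrightarrow> seminorm (diff (s m) (s n)) < e / 2"
      using s e unfolding represents_def semi_Cauchy_def by metis
    obtain M where M: "\<And>m n. m \<ge> M \<Longrightarrow> n \<ge> M \<Longrightarrow> seminorm (diff (t m) (t n)) < e / 2"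
      using t e unfolding represents_def semi_Cauchy_def by metis
    have "seminorm (diff (add (s m) (t m)) (add (s n) (t n))) < e"
      if "m \<ge> max M N" "n \<ge> max M N" for m n
    proof -
      have "seminorm (diff (add (s m) (t m)) (add (s n) (t n))) =
          seminorm (add (diff (s m) (s n)) (diff (t m) (t n)))"
        by (simp add: seminorm_def ip_simps)
      then show ?thesis
        using N[of m n] M[of m n] that
          seminorm_triangle[of "diff (s m) (s n)" "diff (t m) (t n)"] by simp
    qed
    then show "\<exists>N. \<forall>m\<ge>N. \<forall>n\<ge>N. seminorm (diff (add (s m) (t m)) (add (s n) (t n))) < e"
      by blast
  qed
  with s t show ?thesis
    by (simp add: represents_def ip_simps tendsto_add)
qed

lemma represents_scale:
  assumes s: "represents s f"
  shows "represents (\<lambda>n. scale a (s n)) (\<lambda>d. a * f d)"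
proof -
  have *: "seminorm (diff (scale a (s m)) (scale a (s n))) = cmod a * seminorm (diff (s m) (s n))"
    for m n
  proof -
    have "ip (diff (scale a (s m)) (scale a (s n))) (diff (scale a (s m)) (scale a (s n))) =
        (a * cnj a) * ip (diff (s m) (s n)) (diff (s m) (s n))"
      by (simp add: ip_simps algebra_simps)
    also have "\<dots> = of_real ((cmod a)\<^sup>2 * Re (ip (diff (s m) (s n)) (diff (s m) (s n))))"
      by (simp add: ip_self complex_norm_square[symmetric] del: of_real_power)
    finally show ?thesis
      by (simp add: seminorm_def real_sqrt_mult)
  qed
  have "semi_Cauchy (\<lambda>n. scale a (s n))"
    unfolding semi_Cauchy_def
  proof (intro allI impI)
    fix e :: real assume "0 < e"
    then have e: "0 < e / (cmod a + 1)" by (simp add: add_nonneg_pos)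
    obtain N where N: "\<And>m n. m \<ge> N \<Longrightarrow> n \<ge> N \<Longrightarrow> seminorm (diff (s m) (s n)) < e / (cmod a + 1)"
      using s e unfolding represents_def semi_Cauchy_def by metis
    have "cmod a * seminorm (diff (s m) (s n)) < e" if "m \<ge> N" "n \<ge> N" for m n
    proof -
      have "cmod a * seminorm (diff (s m) (s n)) \<le> (cmod a + 1) * seminorm (diff (s m) (s n))"
        by (intro mult_right_mono) (auto simp: seminorm_nonneg)
      also have "\<dots> < e"
        using N[OF that] by (simp add: pos_less_divide_eq add_nonneg_pos mult.commute)
      finally show ?thesis .
    qed
    then show "\<exists>N. \<forall>m\<ge>N. \<forall>n\<ge>N. seminorm (diff (scale a (s m)) (scale a (s n))) < e"
      unfolding * by blast
  qed
  with s show ?thesis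
    by (simp add: represents_def ip_simps tendsto_mult_left)
qed

lemma completion_simps [simp]:
  "carrier completion = completion_carrier" "\<zero>\<^bsub>completion\<^esub> = (\<lambda>_. 0)"
  "f \<oplus>\<^bsub>completion\<^esub> g = (\<lambda>d. f d + g d)" "a \<odot>\<^bsub>completion\<^esub> f = (\<lambda>d. a * f d)"
  "cinner completion f g = completion_ip f g"
  by (simp_all add: completion_def)

lemma completion_carrierE:
  assumes "f \<in> completion_carrier"
  obtains s where "represents s f"
  using assms by (auto simp: completion_carrier_def)

lemma completion_ip_eqI:
  assumes "represents s f" "represents t g" "(\<lambda>n. ip (s n) (t n)) \<longlonglongrightarrow> l"
  shows "completion_ip f g = l"
  using completion_ip(2)[OF assms(1,2)] assms(3) by (rule LIMSEQ_unique)

lemma completion_closed: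
  "(\<lambda>_. 0) \<in> completion_carrier"
  "f \<in> completion_carrier \<Longrightarrow> g \<in> completion_carrier \<Longrightarrow> (\<lambda>d. f d + g d) \<in> completion_carrier"
  "f \<in> completion_carrier \<Longrightarrow> (\<lambda>d. a * f d) \<in> completion_carrier"
proof -
  show scale: "(\<lambda>d. a * f d) \<in> completion_carrier" if "f \<in> completion_carrier" for f a
    using that by (auto simp: completion_carrier_def intro: represents_scale)
  show "(\<lambda>_. 0) \<in> completion_carrier"
    using scale[of "ip undefined" 0] represents_const by (auto simp: completion_carrier_def)
  show "(\<lambda>d. f d + g d) \<in> completion_carrier"
    if "f \<in> completion_carrier" "g \<in> completion_carrier"
    using that by (auto simp: completion_carrier_def intro: represents_add)
qed

sublocale completion: inner_product_space completion
proof (rule inner_product_space.intro)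
  interpret complex: cring complex_ring by (rule cring_from_type_algebra)
  have "abelian_group completion"
  proof (rule abelian_groupI)
    fix f assume "f \<in> carrier completion"
    then show "\<exists>g\<in>carrier completion. g \<oplus>\<^bsub>completion\<^esub> f = \<zero>\<^bsub>completion\<^esub>"
      using completion_closed(3)[of f "- 1"] by (intro bexI[of _ "\<lambda>d. - f d"]) auto
  qed (auto simp: completion_closed ac_simps)
  then show "Module.module complex_ring completion"
    by (intro moduleI complex.is_cring) (auto simp: completion_closed algebra_simps)
  show "inner_product_space_axioms completion"
  proof
    fix f g assume "f \<in> carrier completion" "g \<in> carrier completion"
    then obtain s t where s: "represents s f" and t: "represents t g"
      by (auto elim!: completion_carrierE)
    have "(\<lambda>n. cnj (ip (s n) (t n))) \<longlonglongrightarrow> cnj (completion_ip f g)"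
      by (intro tendsto_intros completion_ip(2)[OF s t])
    moreover have "cnj (ip (s n) (t n)) = ip (t n) (s n)" for n
      by (rule ip_commute[symmetric])
    ultimately show "cinner completion g f = cnj (cinner completion f g)"
      using completion_ip_eqI[OF t s] by simp
  next
    fix f g h assume "f \<in> carrier completion" "g \<in> carrier completion" "h \<in> carrier completion"
    then obtain s t u where s: "represents s f" and t: "represents t g" and u: "represents u h"
      by (auto elim!: completion_carrierE)
    show "cinner completion (f \<oplus>\<^bsub>completion\<^esub> g) h = cinner completion f h + cinner completion g h"
      using tendsto_add[OF completion_ip(2)[OF s u] completion_ip(2)[OF t u]]
      by (simp add: completion_ip_eqI[OF represents_add[OF s t] u] ip_simps)
  next
    fix f g a assume "f \<in> carrier completion" "g \<in> carrier completion"
    then obtain s t where s: "represents s f" and t: "represents t g"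
      by (auto elim!: completion_carrierE)
    show "cinner completion (a \<odot>\<^bsub>completion\<^esub> f) g = a * cinner completion f g"
      using tendsto_mult_left[OF completion_ip(2)[OF s t], of a]
      by (simp add: completion_ip_eqI[OF represents_scale[OF s] t] ip_simps)
  next
    fix f assume f: "f \<in> carrier completion" "f \<noteq> \<zero>\<^bsub>completion\<^esub>"
    then obtain s where s: "represents s f"
      by (auto elim!: completion_carrierE)
    \<comment> \<open>Definiteness: in the limit, Cauchy-Schwarz bounds |f d|^2 by the square norm
      of \<open>f\<close> times that of \<open>d\<close>, so one nonzero value suffices.\<close>
    obtain d where d: "f d \<noteq> 0"
      using f(2) by auto
    have "(\<lambda>n. Re (ip (s n) (s n))) \<longlonglongrightarrow> Re (completion_ip f f)"
      by (intro tendsto_intros completion_ip(2)[OF s s])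
    then have lim: "(\<lambda>n. (seminorm (s n))\<^sup>2) \<longlonglongrightarrow> Re (completion_ip f f)"
      by (simp add: ip_self)
    have "(\<lambda>n. (cmod (ip (s n) d))\<^sup>2) \<longlonglongrightarrow> (cmod (f d))\<^sup>2"
      using s by (intro tendsto_intros) (simp add: represents_def)
    moreover have "(\<lambda>n. (seminorm (s n))\<^sup>2 * (seminorm d)\<^sup>2) \<longlonglongrightarrow>
        Re (completion_ip f f) * (seminorm d)\<^sup>2"
      by (intro tendsto_intros lim)
    moreover have "(cmod (ip (s n) d))\<^sup>2 \<le> (seminorm (s n))\<^sup>2 * (seminorm d)\<^sup>2" for n
      using power_mono[OF semi_Cauchy_Schwarz[of "s n" d], of 2] by (simp add: power_mult_distrib)
    ultimately have "(cmod (f d))\<^sup>2 \<le> Re (completion_ip f f) * (seminorm d)\<^sup>2"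
      by (meson LIMSEQ_le)
    moreover have "0 < (cmod (f d))\<^sup>2"
      using d by simp
    ultimately have "0 < Re (completion_ip f f) * (seminorm d)\<^sup>2"
      by linarith
    then show "0 < Re (cinner completion f f)"
      by (simp add: zero_less_mult_iff)
  qed
qed

lemma embed_carrier: "ip d \<in> completion_carrier"
  using represents_const by (auto simp: completion_carrier_def)

text \<open>The completion is a reproducing kernel space. This is how inner products with embedded
  vectors, and later the matrix coefficients, are computed without limits.\<close>

lemma completion_reproducing:
  assumes "f \<in> completion_carrier"
  shows "completion_ip f (ip d) = f d"
proof -
  obtain s where s: "represents s f"
    using assms by (rule completion_carrierE)
  then show ?thesis
    by (intro completion_ip_eqI[OF s represents_const]) (simp add: represents_def)
qed

lemma completion_minus:
  assumes "f \<in> completion_carrier" "g \<in> completion_carrier"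
  shows "f \<ominus>\<^bsub>completion\<^esub> g = (\<lambda>d. f d - g d)"
proof -
  have "\<ominus>\<^bsub>completion\<^esub> g = (\<lambda>d. - g d)"
    using assms completion.smult_minus1[of g, symmetric] by simp
  then show ?thesis
    by (simp add: a_minus_def)
qed

text \<open>Density of the embedded vectors: the distance to the n-th one is the limit over m of the
  seminorms of the differences, which the Cauchy condition makes small.\<close>

lemma represents_hdist:
  assumes s: "represents s f"
  shows "(\<lambda>n. hdist completion f (ip (s n))) \<longlonglongrightarrow> 0"
proof (rule LIMSEQ_I)
  fix e :: real assume "0 < e"
  then have e: "0 < e / 2" by simp
  have f: "f \<in> completion_carrier"
    using s by (auto simp: completion_carrier_def)
  obtain N where N: "\<And>m n. m \<ge> N \<Longrightarrow> n \<ge> N \<Longrightarrow> seminorm (diff (s m) (s n)) < e / 2"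
    using s e unfolding represents_def semi_Cauchy_def by metis
  have "hdist completion f (ip (s n)) < e" if n: "n \<ge> N" for n
  proof -
    have rep: "represents (\<lambda>m. add (s m) (scale (- 1) (s n))) (\<lambda>d. f d + - 1 * ip (s n) d)"
      by (intro represents_add represents_scale represents_const s)
    then have rep: "represents (\<lambda>m. diff (s m) (s n)) (f \<ominus>\<^bsub>completion\<^esub> ip (s n))"
      by (simp add: diff_def completion_minus f embed_carrier)
    have "(\<lambda>m. Re (ip (diff (s m) (s n)) (diff (s m) (s n)))) \<longlonglongrightarrow>
        Re (completion_ip (f \<ominus>\<^bsub>completion\<^esub> ip (s n)) (f \<ominus>\<^bsub>completion\<^esub> ip (s n)))"
      by (intro tendsto_intros completion_ip(2)[OF rep rep])
    then have "(\<lambda>m. seminorm (diff (s m) (s n))) \<longlonglongrightarrow> hdist completion f (ip (s n))"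
      unfolding seminorm_def hdist_def hnorm_def by (simp add: f embed_carrier tendsto_real_sqrt)
    moreover have "\<forall>\<^sub>F m in sequentially. seminorm (diff (s m) (s n)) \<le> e / 2"
      using eventually_ge_at_top[of N] by eventually_elim (use N n in \<open>simp add: less_imp_le\<close>)
    ultimately have "hdist completion f (ip (s n)) \<le> e / 2"
      by (rule tendsto_upperbound) simp
    with e show ?thesis by simp
  qed
  moreover have "0 \<le> hdist completion f (ip (s n))" for n
    by (rule Metric_space.nonneg[OF completion.metric_hdist])
  ultimately show "\<exists>N. \<forall>n\<ge>N. norm (hdist completion f (ip (s n)) - 0) < e"
    by auto
qed

lemma hdist_embed: "hdist completion (ip x) (ip y) = seminorm (diff x y)"
proof -
  have "ip x \<ominus>\<^bsub>completion\<^esub> ip y = ip (diff x y)"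
    by (auto simp: completion_minus embed_carrier ip_simps)
  then show ?thesis
    by (simp add: hdist_def hnorm_def embed_carrier completion_reproducing seminorm_def)
qed

text \<open>Diagonal approximation: choose \<open>d n\<close> with embedding within 1/(n+1) of the
  n-th functional. Then \<open>d\<close> is Cauchy, and the functional it represents is the
  limit.\<close>

sublocale completion: hilbert_space completion
proof
  interpret met: Metric_space "carrier completion" "hdist completion"
    by (rule completion.metric_hdist)
  show "met.mcomplete"
    unfolding met.mcomplete_def
  proof (intro allI impI)
    fix F assume F: "met.MCauchy F"
    then have Fc: "F n \<in> completion_carrier" for n
      unfolding met.MCauchy_def by auto
    have "\<exists>d. hdist completion (F n) (ip d) < 1 / real (Suc n)" for n
    proof -
      obtain s where "represents s (F n)"
        using Fc[of n] by (rule completion_carrierE)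
      then have "\<forall>\<^sub>F k in sequentially. hdist completion (F n) (ip (s k)) < 1 / real (Suc n)"
        by (intro order_tendstoD(2)[OF represents_hdist]) simp_all
      then show ?thesis
        by (auto dest: eventually_happens'[OF sequentially_bot])
    qed
    then obtain d where d: "\<And>n. hdist completion (F n) (ip (d n)) < 1 / real (Suc n)"
      by metis
    have cauchy: "semi_Cauchy d"
      unfolding semi_Cauchy_def
    proof (intro allI impI)
      fix e :: real assume e: "0 < e"
      obtain N where N: "\<And>m n. m \<ge> N \<Longrightarrow> n \<ge> N \<Longrightarrow> hdist completion (F m) (F n) < e / 3"
        using F e unfolding met.MCauchy_def by (metis divide_pos_pos zero_less_numeral)
      obtain M where M: "1 / real (Suc M) < e / 3"
        using e by (metis divide_pos_pos nat_approx_posE zero_less_numeral)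
      have close: "hdist completion (F n) (ip (d n)) < e / 3" if "n \<ge> M" for n
      proof -
        have "1 / real (Suc n) \<le> 1 / real (Suc M)"
          using that by (intro divide_left_mono) auto
        then show ?thesis using d[of n] M by linarith
      qed
      have "seminorm (diff (d m) (d n)) < e" if "m \<ge> max M N" "n \<ge> max M N" for m n
      proof -
        have "hdist completion (ip (d m)) (ip (d n)) \<le>
            hdist completion (ip (d m)) (F m) + hdist completion (F m) (ip (d n))"
          by (rule met.triangle) (simp_all add: embed_carrier Fc)
        moreover have "hdist completion (F m) (ip (d n)) \<le>
            hdist completion (F m) (F n) + hdist completion (F n) (ip (d n))"
          by (rule met.triangle) (simp_all add: embed_carrier Fc)
        ultimately show ?thesis
          using close[of m] close[of n] N[of m n] that
          by (simp add: hdist_embed met.commute[of "ip (d m)"])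
      qed
      then show "\<exists>N. \<forall>m\<ge>N. \<forall>n\<ge>N. seminorm (diff (d m) (d n)) < e"
        by (intro exI[of _ "max M N"]) simp
    qed
    have "convergent (\<lambda>n. ip (d n) x)" for x
    proof (rule Cauchy_convergent, rule metric_CauchyI)
      fix e :: real assume e: "0 < e"
      define C where "C = seminorm x + 1"
      have C: "C > 0" "seminorm x < C"
        using seminorm_nonneg[of x] by (auto simp: C_def)
      obtain N where N: "\<And>m n. m \<ge> N \<Longrightarrow> n \<ge> N \<Longrightarrow> seminorm (diff (d m) (d n)) < e / C"
        using cauchy e C(1) unfolding semi_Cauchy_def by (metis divide_pos_pos)
      have "dist (ip (d m) x) (ip (d n) x) < e" if "m \<ge> N" "n \<ge> N" for m n
      proof -
        have "dist (ip (d m) x) (ip (d n) x) \<le> seminorm (diff (d m) (d n)) * seminorm x"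
          using semi_Cauchy_Schwarz[of "diff (d m) (d n)" x] by (simp add: dist_norm ip_simps)
        also have "\<dots> \<le> seminorm (diff (d m) (d n)) * C"
          using C(2) by (intro mult_left_mono) (auto simp: seminorm_nonneg)
        also have "\<dots> < e"
          using N[OF that] C(1) by (simp add: pos_less_divide_eq)
        finally show ?thesis .
      qed
      then show "\<exists>M. \<forall>m\<ge>M. \<forall>n\<ge>M. dist (ip (d m) x) (ip (d n) x) < e"
        by (intro exI[of _ N]) simp
    qed
    then have "(\<lambda>n. ip (d n) x) \<longlonglongrightarrow> lim (\<lambda>n. ip (d n) x)" for x
      by (simp add: convergent_LIMSEQ_iff)
    then obtain f where rep: "represents d f"
      using cauchy that[of "\<lambda>x. lim (\<lambda>n. ip (d n) x)"] by (simp add: represents_def)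
    then have f: "f \<in> completion_carrier"
      by (auto simp: completion_carrier_def)
    have "(\<lambda>n. 1 / real (Suc n) + hdist completion f (ip (d n))) \<longlonglongrightarrow> 0 + 0"
      by (intro tendsto_add represents_hdist[OF rep] LIMSEQ_Suc lim_1_over_n)
    then have bound: "(\<lambda>n. 1 / real (Suc n) + hdist completion f (ip (d n))) \<longlonglongrightarrow> 0"
      by simp
    have "hdist completion (F n) f \<le> 1 / real (Suc n) + hdist completion f (ip (d n))" for n
      using met.triangle[of "F n" "ip (d n)" f] d[of n] f Fc embed_carrier
      by (simp add: met.commute[of "ip (d n)" f])
    then have lim: "(\<lambda>n. hdist completion (F n) f) \<longlonglongrightarrow> 0"
      by (intro tendsto_sandwich[OF _ _ tendsto_const bound] always_eventually allI met.nonneg)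
    show "\<exists>f. limitin met.mtopology F f sequentially"
      unfolding met.limitin_metric
    proof (intro exI[of _ f] conjI allI impI)
      fix e :: real assume "0 < e"
      then have "\<forall>\<^sub>F n in sequentially. hdist completion (F n) f < e"
        by (rule order_tendstoD(2)[OF lim])
      then show "\<forall>\<^sub>F n in sequentially. F n \<in> carrier completion \<and> hdist completion (F n) f < e"
        using Fc by simp
    qed (simp add: f)
  qed
qed

end

section \<open>Orthogonal projection\<close>

context inner_product_space
begin

lemma cinner_diff_left:
  "x \<in> carrier H \<Longrightarrow> y \<in> carrier H \<Longrightarrow> z \<in> carrier H \<Longrightarrow>
    cinner H (x \<ominus>\<^bsub>H\<^esub> y) z = cinner H x z - cinner H y z"
  by (simp add: a_minus_def cinner_add_left cinner_minus_left)

lemma cinner_diff_right: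
  "x \<in> carrier H \<Longrightarrow> y \<in> carrier H \<Longrightarrow> z \<in> carrier H \<Longrightarrow>
    cinner H z (x \<ominus>\<^bsub>H\<^esub> y) = cinner H z x - cinner H z y"
  by (simp add: a_minus_def cinner_add_right cinner_minus_right)

lemmas cinner_simps = cinner_add_left cinner_add_right cinner_smult_left cinner_smult_right
  cinner_diff_left cinner_diff_right cinner_minus_left cinner_minus_right

lemma hdist_power2:
  "x \<in> carrier H \<Longrightarrow> y \<in> carrier H \<Longrightarrow>
    (hdist H x y)\<^sup>2 = Re (cinner H (x \<ominus>\<^bsub>H\<^esub> y) (x \<ominus>\<^bsub>H\<^esub> y))"
  by (simp add: hdist_def hnorm_def cinner_self_nonneg)

lemma Re_cinner_commute:
  "x \<in> carrier H \<Longrightarrow> y \<in> carrier H \<Longrightarrow> Re (cinner H x y) = Re (cinner H y x)"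
  using cinner_commute[of x y] by simp

lemma cinner_self_eq_0_iff: "x \<in> carrier H \<Longrightarrow> cinner H x x = 0 \<longleftrightarrow> x = \<zero>\<^bsub>H\<^esub>"
  using cinner_pos[of x] cinner_zero_left[of x] by (cases "x = \<zero>\<^bsub>H\<^esub>") auto

lemma diff_eq_zero_iff:
  "x \<in> carrier H \<Longrightarrow> y \<in> carrier H \<Longrightarrow> x \<ominus>\<^bsub>H\<^esub> y = \<zero>\<^bsub>H\<^esub> \<longleftrightarrow> x = y"
  using Metric_space.zero[OF metric_hdist, of x y] hnorm_eq_0_iff[of "x \<ominus>\<^bsub>H\<^esub> y"]
  by (simp add: hdist_def)

text \<open>Serves to show that a subspace is closed: a point outside it is separated by a
  functional that vanishes on it.\<close>

lemma continuous_cinner_left: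
  assumes "x \<in> carrier H" and "y \<in> carrier H" and nz: "cinner H x y \<noteq> 0"
  obtains r where "r > 0"
    "\<And>z. z \<in> carrier H \<Longrightarrow> hdist H x z < r \<Longrightarrow> cinner H z y \<noteq> 0"
proof
  show "0 < cmod (cinner H x y) / (hnorm H y + 1)"
    using nz hnorm_nonneg[OF assms(2)] by simp
  fix z assume z: "z \<in> carrier H" "hdist H x z < cmod (cinner H x y) / (hnorm H y + 1)"
  show "cinner H z y \<noteq> 0"
  proof
    assume 0: "cinner H z y = 0"
    have "hdist H x z * (hnorm H y + 1) < cmod (cinner H x y)"
      using z hnorm_nonneg[OF assms(2)] by (simp add: pos_less_divide_eq)
    moreover have "cmod (cinner H x y) \<le> hdist H x z * hnorm H y"
      using Cauchy_Schwarz[of "x \<ominus>\<^bsub>H\<^esub> z" y] assms z 0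
      by (simp add: cinner_diff_left hdist_def)
    ultimately show False
      using Metric_space.nonneg[OF metric_hdist, of x z] by (simp add: algebra_simps)
  qed
qed

end

context hilbert_space
begin

text \<open>The projection is a closest point. The parallelogram law makes a minimising sequence
  Cauchy, and a nonzero pairing of x - p with some w would allow p to be moved closer to x along
  w.\<close>

lemma orthogonal_projection:
  assumes W: "submodule W complex_ring H"
    and cl: "closedin (Metric_space.mtopology (carrier H) (hdist H)) W"
    and x: "x \<in> carrier H"
  obtains p where "p \<in> W" "\<And>w. w \<in> W \<Longrightarrow> cinner H (x \<ominus>\<^bsub>H\<^esub> p) w = 0"
proof -
  interpret met: Metric_space "carrier H" "hdist H"
    by (rule metric_hdist)
  interpret W: submodule W complex_ring H
    by (rule W)
  have Wc: "w \<in> carrier H" if "w \<in> W" for w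
    using that W.subset by auto
  have W_add: "u \<oplus>\<^bsub>H\<^esub> v \<in> W" if "u \<in> W" "v \<in> W" for u v
    using W.m_closed[of u v] that by simp
  define q where "q w = (hdist H x w)\<^sup>2" for w
  have q: "q w = Re (cinner H x x) - 2 * Re (cinner H x w) + Re (cinner H w w)"
    if "w \<in> carrier H" for w
    using that x Re_cinner_commute[of x w] by (simp add: q_def hdist_power2 cinner_simps)
  define D where "D = Inf (q ` W)"
  have bdd: "bdd_below (q ` W)"
    by (intro bdd_belowI[of _ 0]) (auto simp: q_def)
  have D_le: "D \<le> q w" if "w \<in> W" for w
    unfolding D_def using that bdd by (intro cInf_lower) auto
  have "W \<noteq> {}"
    using W.one_closed by auto
  then have "\<exists>w\<in>W. q w < D + 1 / real (Suc n)" for n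
    using cInf_lessD[of "q ` W" "D + 1 / real (Suc n)"] by (auto simp flip: D_def)
  then obtain s where s: "\<And>n. s n \<in> W" "\<And>n. q (s n) < D + 1 / real (Suc n)"
    by metis
  have sc: "s n \<in> carrier H" for n
    using s Wc by blast
  \<comment> \<open>The midpoint of two approximants lies in \<open>W\<close>, so its square
    distance to x is at least \<open>D\<close>; this bounds the distance between the
    approximants.\<close>
  have parallelogram: "(hdist H (s m) (s n))\<^sup>2 \<le> 2 / real (Suc m) + 2 / real (Suc n)" for m n
  proof -
    define u where "u = (1 / 2) \<odot>\<^bsub>H\<^esub> (s m \<oplus>\<^bsub>H\<^esub> s n)"
    have "u \<in> W"
      unfolding u_def by (intro W.smult_closed W_add s) simp
    then have "D \<le> q u"
      by (rule D_le)
    moreover have "(hdist H (s m) (s n))\<^sup>2 = 2 * q (s m) + 2 * q (s n) - 4 * q u"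
      using x sc[of m] sc[of n] Re_cinner_commute[of "s m" "s n"]
      by (simp add: q u_def hdist_power2 cinner_simps) (simp add: field_simps)
    ultimately show ?thesis
      using s(2)[of m] s(2)[of n] by simp
  qed
  have "met.MCauchy s"
    unfolding met.MCauchy_def
  proof (intro conjI allI impI)
    fix e :: real assume e: "0 < e"
    then have "0 < e\<^sup>2 / 4" by simp
    then obtain N where N: "1 / real (Suc N) < e\<^sup>2 / 4"
      by (metis nat_approx_posE)
    have "hdist H (s m) (s n) < e" if "N \<le> m" "N \<le> n" for m n
    proof -
      have "1 / real (Suc m) \<le> 1 / real (Suc N)" "1 / real (Suc n) \<le> 1 / real (Suc N)"
        using that by (auto intro!: divide_left_mono)
      then have "(hdist H (s m) (s n))\<^sup>2 < e\<^sup>2"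
        using parallelogram[of m n] N by linarith
      then show ?thesis
        using e by (meson less_imp_le power2_less_imp_less)
    qed
    then show "\<exists>N. \<forall>n n'. N \<le> n \<longrightarrow> N \<le> n' \<longrightarrow> hdist H (s n) (s n') < e"
      by (intro exI[of _ N]) simp
  qed (use sc in auto)
  then obtain p where p: "limitin met.mtopology s p sequentially"
    using complete by (auto simp: met.mcomplete_def)
  have "p \<in> W"
    using limitin_closedin[OF p cl] s(1) by simp
  note pc = Wc[OF this]
  have "q p \<le> D"
  proof -
    have "(\<lambda>n. hdist H (s n) p) \<longlonglongrightarrow> 0"
    proof (rule LIMSEQ_I)
      fix e :: real assume "0 < e"
      then have "\<forall>\<^sub>F n in sequentially. hdist H (s n) p < e"
        using p by (auto simp: met.limitin_metric elim: eventually_mono)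
      then show "\<exists>N. \<forall>n\<ge>N. norm (hdist H (s n) p - 0) < e"
        by (auto simp: eventually_sequentially)
    qed
    moreover have "(\<lambda>n. sqrt (D + 1 / real (Suc n))) \<longlonglongrightarrow> sqrt (D + 0)"
      by (intro tendsto_intros LIMSEQ_Suc lim_1_over_n)
    ultimately have "(\<lambda>n. sqrt (D + 1 / real (Suc n)) + hdist H (s n) p) \<longlonglongrightarrow> sqrt (D + 0) + 0"
      by (intro tendsto_add)
    then have lim: "(\<lambda>n. sqrt (D + 1 / real (Suc n)) + hdist H (s n) p) \<longlonglongrightarrow> sqrt D"
      by simp
    have "hdist H x p \<le> sqrt (D + 1 / real (Suc n)) + hdist H (s n) p" for n
    proof -
      have "hdist H x (s n) \<le> sqrt (D + 1 / real (Suc n))"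
        using s(2)[of n] unfolding q_def by (intro real_le_rsqrt) simp
      then show ?thesis
        using met.triangle[of x "s n" p] x sc pc by simp
    qed
    then have "hdist H x p \<le> sqrt D"
      by (intro tendsto_lowerbound[OF lim]) auto
    moreover have "0 \<le> D"
      unfolding D_def using \<open>W \<noteq> {}\<close> by (intro cInf_greatest) (auto simp: q_def)
    ultimately show ?thesis
      unfolding q_def using met.nonneg[of x p]
      by (metis power_mono real_sqrt_pow2)
  qed
  have "cinner H (x \<ominus>\<^bsub>H\<^esub> p) w = 0" if w: "w \<in> W" for w
  proof (rule ccontr)
    define c where "c = cinner H (x \<ominus>\<^bsub>H\<^esub> p) w"
    assume "cinner H (x \<ominus>\<^bsub>H\<^esub> p) w \<noteq> 0"
    then have c: "(cmod c)\<^sup>2 > 0"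
      by (simp add: c_def)
    note wc = Wc[OF w]
    define B where "B = Re (cinner H w w)"
    have B: "B \<ge> 0"
      unfolding B_def by (rule cinner_self_nonneg[OF wc])
    \<comment> \<open>Moving p by t c w changes the square distance by t |c|^2 (t B - 2), which is
      negative because t B < 1.\<close>
    define t where "t = 1 / (B + 1)"
    define v where "v = p \<oplus>\<^bsub>H\<^esub> (of_real t * c) \<odot>\<^bsub>H\<^esub> w"
    have "v \<in> W"
      unfolding v_def by (intro W_add W.smult_closed \<open>p \<in> W\<close> w) simp
    then have "q p \<le> q v"
      using D_le \<open>q p \<le> D\<close> by force
    moreover have "q v = q p - 2 * t * (cmod c)\<^sup>2 + t\<^sup>2 * (cmod c)\<^sup>2 * B"
    proof -
      have "x \<ominus>\<^bsub>H\<^esub> v = (x \<ominus>\<^bsub>H\<^esub> p) \<ominus>\<^bsub>H\<^esub> (of_real t * c) \<odot>\<^bsub>H\<^esub> w"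
        unfolding v_def using x pc wc by (simp add: a_minus_def M.minus_add M.a_ac)
      moreover define y where "y = x \<ominus>\<^bsub>H\<^esub> p"
      ultimately have "q v = Re (cinner H (y \<ominus>\<^bsub>H\<^esub> (of_real t * c) \<odot>\<^bsub>H\<^esub> w) (y \<ominus>\<^bsub>H\<^esub> (of_real t * c) \<odot>\<^bsub>H\<^esub> w))"
        unfolding q_def using x wc pc by (simp add: hdist_power2 v_def)
      moreover have y: "y \<in> carrier H" "cinner H y w = c" "cinner H w y = cnj c"
        using x pc wc cinner_commute[of y w] by (simp_all add: y_def c_def)
      moreover have "cinner H w w = of_real B"
        unfolding B_def using cinner_self[OF wc] by simp
      moreover have "q p = Re (cinner H y y)"
        unfolding q_def y_def using x pc by (simp add: hdist_power2)
      ultimately show ?thesis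
        using wc by (simp add: cinner_simps) (simp add: cmod_power2, simp add: power2_eq_square algebra_simps)
    qed
    ultimately have "2 * t * (cmod c)\<^sup>2 \<le> t\<^sup>2 * (cmod c)\<^sup>2 * B"
      by simp
    then have "t * (cmod c)\<^sup>2 * 2 \<le> t * (cmod c)\<^sup>2 * (t * B)"
      by (simp add: power2_eq_square algebra_simps)
    moreover have "t > 0"
      using B by (simp add: t_def)
    ultimately have "2 \<le> t * B"
      using c by (simp add: mult_le_cancel_left_pos)
    then show False
      using B by (simp add: t_def field_simps)
  qed
  with \<open>p \<in> W\<close> show thesis
    by (rule that)
qed

end

section \<open>States and the GNS construction\<close>

text \<open>
  A list of pairs \<open>(a\<^sub>i, g\<^sub>i)\<close> stands for the element \<open>\<Sum> a\<^sub>i g\<^sub>i\<close> of the group algebra. Pairs outside the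
  group are allowed but contribute \<open>0\<close>.
\<close>

definition kernel_form :: "('g, 'm) monoid_scheme \<Rightarrow> ('g \<Rightarrow> complex) \<Rightarrow>
    (complex \<times> 'g) list \<Rightarrow> (complex \<times> 'g) list \<Rightarrow> complex" where
  "kernel_form G \<phi> xs ys = (\<Sum>x\<leftarrow>xs. \<Sum>y\<leftarrow>ys. fst x * cnj (fst y) *
    (if snd x \<in> carrier G \<and> snd y \<in> carrier G then \<phi> (inv\<^bsub>G\<^esub> snd y \<otimes>\<^bsub>G\<^esub> snd x) else 0))"

text \<open>The bound by 1 places the states in a product of closed discs, and vanishing off the
  carrier makes a state determined by its values on the group.\<close>

definition states :: "('g, 'm) monoid_scheme \<Rightarrow> ('g \<Rightarrow> complex) set" where
  "states G = {\<phi>. (\<forall>g. g \<notin> carrier G \<longrightarrow> \<phi> g = 0) \<and> \<phi> \<one>\<^bsub>G\<^esub> = 1 \<and>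
    (\<forall>g\<in>carrier G. \<phi> (inv\<^bsub>G\<^esub> g) = cnj (\<phi> g)) \<and> (\<forall>g. cmod (\<phi> g) \<le> 1) \<and>
    (\<forall>xs. 0 \<le> Re (kernel_form G \<phi> xs xs))}"

text \<open>Left multiplication in the group algebra. Pairs outside the carrier stay fixed, so that
  translations compose like group elements on all lists.\<close>

definition translate :: "('g, 'm) monoid_scheme \<Rightarrow> 'g \<Rightarrow> (complex \<times> 'g) list \<Rightarrow> (complex \<times> 'g) list"
  where "translate G g xs = map (\<lambda>x. (fst x, if snd x \<in> carrier G then g \<otimes>\<^bsub>G\<^esub> snd x else snd x)) xs"

abbreviation scale_list :: "complex \<Rightarrow> (complex \<times> 'g) list \<Rightarrow> (complex \<times> 'g) list" where
  "scale_list a \<equiv> map (\<lambda>x. (a * fst x, snd x))"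

lemma kernel_form_Cons_left:
  "kernel_form G \<phi> (x # xs) ys = kernel_form G \<phi> [x] ys + kernel_form G \<phi> xs ys"
  by (simp add: kernel_form_def)

lemma kernel_form_Cons_right:
  "kernel_form G \<phi> xs (y # ys) = kernel_form G \<phi> xs [y] + kernel_form G \<phi> xs ys"
  by (simp add: kernel_form_def sum_list_addf)

lemma kernel_form_Nil [simp]: "kernel_form G \<phi> [] ys = 0" "kernel_form G \<phi> xs [] = 0"
  by (simp_all add: kernel_form_def)

lemma kernel_form_single:
  "kernel_form G \<phi> [(a, g)] [(b, h)] = a * cnj b *
    (if g \<in> carrier G \<and> h \<in> carrier G then \<phi> (inv\<^bsub>G\<^esub> h \<otimes>\<^bsub>G\<^esub> g) else 0)"
  by (simp add: kernel_form_def)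

lemma kernel_form_append:
  "kernel_form G \<phi> (xs @ zs) ys = kernel_form G \<phi> xs ys + kernel_form G \<phi> zs ys"
  by (simp add: kernel_form_def)

lemma kernel_form_scale: "kernel_form G \<phi> (scale_list a xs) ys = a * kernel_form G \<phi> xs ys"
  unfolding kernel_form_def
  by (simp add: o_def sum_list_const_mult[symmetric] mult.assoc cong: if_cong)

lemma kernel_form_mult: "kernel_form G (\<lambda>g. c * \<phi> g) xs ys = c * kernel_form G \<phi> xs ys"
proof -
  have "(if P then c * z else 0) = c * (if P then z else 0)" for P and z :: complex
    by simp
  then show ?thesis
    unfolding kernel_form_def
    by (simp only: sum_list_const_mult[symmetric] mult.left_commute)
qed

text \<open>The kernel depends only on the quotient of the two group elements, so the adjoint of a
  translation is the translation by the inverse. Unitarity of the GNS representation rests on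
  this.\<close>

lemma (in group) kernel_form_translate:
  assumes g: "g \<in> carrier G"
  shows "kernel_form G \<phi> (translate G g xs) ys = kernel_form G \<phi> xs (translate G (inv g) ys)"
proof -
  have *: "(if h \<in> carrier G then g \<otimes> h else h) \<in> carrier G \<longleftrightarrow> h \<in> carrier G"
    "(if h \<in> carrier G then inv g \<otimes> h else h) \<in> carrier G \<longleftrightarrow> h \<in> carrier G" for h
    using g by auto
  have "(if h \<in> carrier G \<and> k \<in> carrier G
      then \<phi> (inv k \<otimes> (if h \<in> carrier G then g \<otimes> h else h)) else 0) =
    (if h \<in> carrier G \<and> k \<in> carrier G
      then \<phi> (inv (if k \<in> carrier G then inv g \<otimes> k else k) \<otimes> h) else 0)" for h k
    using g by (simp add: inv_mult_group m_assoc)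
  then show ?thesis
    unfolding kernel_form_def translate_def
    by (simp add: o_def * cong: if_cong)
qed

lemma (in group) translate_compose:
  assumes "g \<in> carrier G" "h \<in> carrier G"
  shows "translate G g (translate G h xs) = translate G (g \<otimes> h) xs"
  using assms by (auto simp: translate_def m_assoc)

lemma (in group) translate_one: "translate G \<one> xs = xs"
  by (induction xs) (auto simp: translate_def)

section \<open>Matrix coefficients as states\<close>

context unitary_representation
begin

lemma rep_carrier [simp]: "g \<in> carrier G \<Longrightarrow> x \<in> carrier H \<Longrightarrow> \<pi> g x \<in> carrier H"
  using element_image by blast

lemma rep_one [simp]: "x \<in> carrier H \<Longrightarrow> \<pi> \<one>\<^bsub>G\<^esub> x = x"
  using id_eq_one by (metis restrict_apply')

lemma rep_inv [simp]:
  assumes "g \<in> carrier G" "x \<in> carrier H"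
  shows "\<pi> (inv\<^bsub>G\<^esub> g) (\<pi> g x) = x" "\<pi> g (\<pi> (inv\<^bsub>G\<^esub> g) x) = x"
  using composition_rule[of x "inv\<^bsub>G\<^esub> g" g] composition_rule[of x g "inv\<^bsub>G\<^esub> g"] assms
  by simp_all

lemma cinner_rep_left:
  assumes "g \<in> carrier G" "x \<in> carrier H" "y \<in> carrier H"
  shows "cinner H (\<pi> g x) y = cinner H x (\<pi> (inv\<^bsub>G\<^esub> g) y)"
  using rep_cinner[of g x "\<pi> (inv\<^bsub>G\<^esub> g) y"] assms by simp

text \<open>The form is the square norm of the vector \<open>c xs\<close>, the sum of the a \<pi>(g)
  p over those pairs (a, g) of \<open>xs\<close> that lie over the group.\<close>

lemma kernel_form_nonneg:
  assumes p: "p \<in> carrier H"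
  defines "\<psi> \<equiv> \<lambda>g. if g \<in> carrier G then cinner H (\<pi> g p) p else 0"
  shows "0 \<le> Re (kernel_form G \<psi> xs xs)"
proof -
  define v where "v = foldr (\<lambda>(a, g) v. if g \<in> carrier G then a \<odot>\<^bsub>H\<^esub> \<pi> g p \<oplus>\<^bsub>H\<^esub> v else v)"
  define c where "c xs = v xs \<zero>\<^bsub>H\<^esub>" for xs
  have c_simps: "c [] = \<zero>\<^bsub>H\<^esub>"
    "c ((a, g) # xs) = (if g \<in> carrier G then a \<odot>\<^bsub>H\<^esub> \<pi> g p \<oplus>\<^bsub>H\<^esub> c xs else c xs)" for a g xs
    by (simp_all add: c_def v_def)
  have c_carrier [simp]: "c xs \<in> carrier H" for xs
    by (induction xs) (auto simp: c_simps p)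
  have single: "cinner H (a \<odot>\<^bsub>H\<^esub> \<pi> g p) (b \<odot>\<^bsub>H\<^esub> \<pi> h p) = kernel_form G \<psi> [(a, g)] [(b, h)]"
    if "g \<in> carrier G" "h \<in> carrier G" for a b g h
  proof -
    have "cinner H (\<pi> g p) (\<pi> h p) = cinner H (\<pi> (inv\<^bsub>G\<^esub> h) (\<pi> g p)) p"
      using that p cinner_rep_left[of "inv\<^bsub>G\<^esub> h" "\<pi> g p" p] by simp
    also have "\<pi> (inv\<^bsub>G\<^esub> h) (\<pi> g p) = \<pi> (inv\<^bsub>G\<^esub> h \<otimes>\<^bsub>G\<^esub> g) p"
      using that p composition_rule[of p "inv\<^bsub>G\<^esub> h" g] by simp
    finally show ?thesis
      using that p by (simp add: kernel_form_single \<psi>_def cinner_simps)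
  qed
  have right: "cinner H (a \<odot>\<^bsub>H\<^esub> \<pi> g p) (c ys) = kernel_form G \<psi> [(a, g)] ys"
    if "g \<in> carrier G" for a g ys
  proof (induction ys)
    case (Cons y ys)
    obtain b h where y: "y = (b, h)" by force
    show ?case
      using Cons that p unfolding y kernel_form_Cons_right[of G \<psi> "[(a, g)]" "(b, h)" ys]
      by (auto simp: c_simps cinner_add_right single) (simp add: kernel_form_single)
  qed (use that p in \<open>simp add: c_simps cinner_zero_right\<close>)
  have "cinner H (c xs) (c ys) = kernel_form G \<psi> xs ys" for xs ys
  proof (induction xs)
    case (Cons x xs)
    obtain a g where x: "x = (a, g)" by force
    show ?case
      using Cons p unfolding x kernel_form_Cons_left[of G \<psi> "(a, g)" xs]
      by (auto simp: c_simps cinner_add_left right) (simp add: kernel_form_def)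
  qed (simp add: c_simps cinner_zero_left)
  from this[of xs xs] show ?thesis
    using cinner_self_nonneg[of "c xs"] by simp
qed

text \<open>Supplies the two states into which a state splits along an invariant subspace.\<close>

lemma coefficient_state:
  assumes p: "p \<in> carrier H" "p \<noteq> \<zero>\<^bsub>H\<^esub>"
  shows "(\<lambda>g. if g \<in> carrier G then cinner H (\<pi> g p) p / cinner H p p else 0) \<in> states G"
proof -
  define t where "t = Re (cinner H p p)"
  have t: "t > 0" "cinner H p p = of_real t" "(hnorm H p)\<^sup>2 = t"
    using cinner_pos[OF p] cinner_self[OF p(1)] by (auto simp: t_def)
  have iso: "hnorm H (\<pi> g p) = hnorm H p" if "g \<in> carrier G" for g
    using that p by (simp add: hnorm_def rep_cinner)
  have bound: "cmod (cinner H (\<pi> g p) p) \<le> t" if "g \<in> carrier G" for g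
    using Cauchy_Schwarz[of "\<pi> g p" p] that p iso[OF that] by (simp add: t(3)[symmetric] power2_eq_square)
  have "0 \<le> Re (kernel_form G (\<lambda>g. if g \<in> carrier G then cinner H (\<pi> g p) p / cinner H p p else 0) xs xs)" for xs
  proof -
    have "(\<lambda>g. if g \<in> carrier G then cinner H (\<pi> g p) p / cinner H p p else 0) =
        (\<lambda>g. of_real (1 / t) * (if g \<in> carrier G then cinner H (\<pi> g p) p else 0))"
      by (auto simp: t)
    then show ?thesis
      using kernel_form_nonneg[OF p(1), of xs] t(1)
      by (simp only: kernel_form_mult Re_complex_of_real times_complex.simps Im_complex_of_real) simp
  qed
  moreover have "cinner H (\<pi> (inv\<^bsub>G\<^esub> g) p) p = cnj (cinner H (\<pi> g p) p)" if "g \<in> carrier G" for g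
    using that p cinner_rep_left[of g p p] cinner_commute[of p "\<pi> (inv\<^bsub>G\<^esub> g) p"] by simp
  ultimately show ?thesis
    using t p bound by (simp add: states_def norm_divide)
qed

end

section \<open>The GNS representation of a state\<close>

locale group_state = group G for G (structure) +
  fixes \<phi>
  assumes state: "\<phi> \<in> states G"
begin

sublocale GNS: semi_inner_product "(@)" scale_list "kernel_form G \<phi>"
proof
  fix xs ys zs :: "(complex \<times> 'a) list" and a
  show "kernel_form G \<phi> (xs @ ys) zs = kernel_form G \<phi> xs zs + kernel_form G \<phi> ys zs"
    by (rule kernel_form_append)
  show "kernel_form G \<phi> (scale_list a xs) ys = a * kernel_form G \<phi> xs ys"
    by (rule kernel_form_scale)
  show "0 \<le> Re (kernel_form G \<phi> xs xs)"
    using state by (simp add: states_def)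
  have single: "kernel_form G \<phi> [y] [x] = cnj (kernel_form G \<phi> [x] [y])" for x y
  proof -
    obtain a g b h where [simp]: "x = (a, g)" "y = (b, h)"
      by force
    have "\<phi> (inv g \<otimes> h) = cnj (\<phi> (inv h \<otimes> g))" if "g \<in> carrier G" "h \<in> carrier G"
    proof -
      have "inv (inv h \<otimes> g) = inv g \<otimes> h"
        using that by (simp add: inv_mult_group)
      moreover have "\<phi> (inv (inv h \<otimes> g)) = cnj (\<phi> (inv h \<otimes> g))"
        using state that by (simp add: states_def)
      ultimately show ?thesis by simp
    qed
    then show ?thesis
      by (simp add: kernel_form_single)
  qed
  have pt: "kernel_form G \<phi> ys [x] = cnj (kernel_form G \<phi> [x] ys)" for x ys
  proof (induction ys)
    case (Cons y ys)
    show ?case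
      unfolding kernel_form_Cons_left[of G \<phi> y ys] kernel_form_Cons_right[of G \<phi> "[x]" y ys]
        single[of x y] Cons.IH by simp
  qed simp
  show "kernel_form G \<phi> ys xs = cnj (kernel_form G \<phi> xs ys)"
  proof (induction xs)
    case (Cons x xs)
    show ?case
      unfolding kernel_form_Cons_left[of G \<phi> x xs] kernel_form_Cons_right[of G \<phi> ys x xs]
        Cons.IH pt by simp
  qed simp
qed

abbreviation "GNS_space \<equiv> GNS.completion"

text \<open>If \<open>s\<close> represents \<open>f\<close>, then the translates of \<open>s\<close>
  by \<open>g\<close> represent the new functional; the inverse appears because translation is moved
  to the other argument of the form.\<close>

definition GNS_rep :: "'a \<Rightarrow> ((complex \<times> 'a) list \<Rightarrow> complex) \<Rightarrow> (complex \<times> 'a) list \<Rightarrow> complex" where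
  "GNS_rep g = (\<lambda>f\<in>carrier GNS_space. \<lambda>xs. f (translate G (inv g) xs))"

lemma represents_translate:
  assumes g: "g \<in> carrier G" and s: "GNS.represents s f"
  shows "GNS.represents (\<lambda>n. translate G g (s n)) (\<lambda>xs. f (translate G (inv g) xs))"
proof -
  have "GNS.diff (translate G g xs) (translate G g ys) = translate G g (GNS.diff xs ys)" for xs ys
    by (auto simp: GNS.diff_def translate_def)
  moreover have "GNS.seminorm (translate G g xs) = GNS.seminorm xs" for xs
    using g by (simp add: GNS.seminorm_def kernel_form_translate translate_compose translate_one)
  ultimately show ?thesis
    using s g by (simp add: GNS.represents_def GNS.semi_Cauchy_def kernel_form_translate)
qed

lemma GNS_rep_carrier:
  "g \<in> carrier G \<Longrightarrow> f \<in> carrier GNS_space \<Longrightarrow> GNS_rep g f \<in> carrier GNS_space"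
  by (auto simp: GNS_rep_def GNS.completion_carrier_def intro: represents_translate)

lemma GNS_rep_compose:
  assumes "g \<in> carrier G" "h \<in> carrier G" "f \<in> carrier GNS_space"
  shows "GNS_rep g (GNS_rep h f) = GNS_rep (g \<otimes> h) f"
  using assms GNS_rep_carrier[of h f]
  by (auto simp: GNS_rep_def translate_compose inv_mult_group)

lemma GNS_rep_one: "f \<in> carrier GNS_space \<Longrightarrow> GNS_rep \<one> f = f"
  by (simp add: GNS_rep_def translate_one)

sublocale GNS: unitary_representation G GNS_space GNS_rep
proof -
  have bij: "GNS_rep g \<in> Bij (carrier GNS_space)" if g: "g \<in> carrier G" for g
  proof -
    have "bij_betw (GNS_rep g) (carrier GNS_space) (carrier GNS_space)"
      by (rule bij_betw_byWitness[of _ "GNS_rep (inv g)"])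
        (use g in \<open>auto simp: GNS_rep_compose GNS_rep_one GNS_rep_carrier
          simp del: GNS.completion_simps\<close>)
    then show ?thesis
      by (simp add: Bij_def GNS_rep_def)
  qed
  have "GNS_rep \<in> hom G (BijGroup (carrier GNS_space))"
  proof (rule homI)
    fix g h assume gh: "g \<in> carrier G" "h \<in> carrier G"
    have "GNS_rep (g \<otimes> h) = compose (carrier GNS_space) (GNS_rep g) (GNS_rep h)"
      by (rule extensionalityI[of _ "carrier GNS_space"])
        (use gh in \<open>auto simp: compose_def GNS_rep_compose simp del: GNS.completion_simps\<close>,
          simp add: GNS_rep_def)
    then show "GNS_rep (g \<otimes> h) = GNS_rep g \<otimes>\<^bsub>BijGroup (carrier GNS_space)\<^esub> GNS_rep h"
      using gh by (simp add: BijGroup_def bij del: GNS.completion_simps)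
  qed (simp add: BijGroup_def bij del: GNS.completion_simps)
  then have act: "group_action G (carrier GNS_space) GNS_rep"
    by (intro group_action.intro)
      (simp add: group_hom_def group_hom_axioms_def is_group group_BijGroup)
  show "unitary_representation G GNS_space GNS_rep"
  proof (intro unitary_representation.intro act GNS.completion.hilbert_space_axioms is_group
      unitary_representation_axioms.intro)
    fix g f f' a assume g: "g \<in> carrier G" and f: "f \<in> carrier GNS_space"
    show "GNS_rep g (a \<odot>\<^bsub>GNS_space\<^esub> f) = a \<odot>\<^bsub>GNS_space\<^esub> GNS_rep g f"
      using f by (simp add: GNS_rep_def GNS.completion_closed)
    assume f': "f' \<in> carrier GNS_space"
    show "GNS_rep g (f \<oplus>\<^bsub>GNS_space\<^esub> f') = GNS_rep g f \<oplus>\<^bsub>GNS_space\<^esub> GNS_rep g f'"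
      using f f' by (simp add: GNS_rep_def GNS.completion_closed)
    obtain s t where s: "GNS.represents s f" and t: "GNS.represents t f'"
      using f f' by (auto elim!: GNS.completion_carrierE)
    have "(\<lambda>n. kernel_form G \<phi> (translate G g (s n)) (translate G g (t n))) \<longlonglongrightarrow>
        GNS.completion_ip f f'"
      using g GNS.completion_ip(2)[OF s t]
      by (simp add: kernel_form_translate translate_compose translate_one)
    then show "cinner GNS_space (GNS_rep g f) (GNS_rep g f') = cinner GNS_space f f'"
      using GNS.completion_ip_eqI[OF represents_translate[OF g s] represents_translate[OF g t]] f f'
      by (simp add: GNS_rep_def)
  qed
qed

end

section \<open>Extreme states and irreducibility\<close>

definition extreme_state :: "('g, 'm) monoid_scheme \<Rightarrow> ('g \<Rightarrow> complex) \<Rightarrow> bool" where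
  "extreme_state G \<phi> \<longleftrightarrow> \<phi> \<in> states G \<and>
    (\<forall>\<phi>1\<in>states G. \<forall>\<phi>2\<in>states G. \<forall>t::real. 0 < t \<and> t < 1 \<and>
      \<phi> = (\<lambda>g. of_real t * \<phi>1 g + of_real (1 - t) * \<phi>2 g) \<longrightarrow> \<phi>1 = \<phi>2)"

context unitary_representation
begin

text \<open>A closed invariant \<open>W\<close> splits the cyclic vector orthogonally into p in
  \<open>W\<close> and q. If both are nonzero, the state is a proper convex combination of their
  normalised coefficients, and extremality makes p a multiple of \<xi>, which contradicts the
  orthogonality of q to p. Cyclicity is expressed by \<open>total\<close>; it gives W = 0 if p = 0
  and W = H if q = 0.\<close>

lemma irreducible_if_extreme:
  assumes xi: "\<xi> \<in> carrier H" "cinner H \<xi> \<xi> = 1"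
    and total: "\<And>x. x \<in> carrier H \<Longrightarrow> (\<And>g. g \<in> carrier G \<Longrightarrow> cinner H x (\<pi> g \<xi>) = 0) \<Longrightarrow> x = \<zero>\<^bsub>H\<^esub>"
    and ext: "extreme_state G \<phi>"
    and coeff: "\<And>g. g \<in> carrier G \<Longrightarrow> \<phi> g = cinner H (\<pi> g \<xi>) \<xi>"
  shows "irreducible_unitary_representation G H \<pi>"
proof
  show "carrier H \<noteq> {\<zero>\<^bsub>H\<^esub>}"
    using xi cinner_zero_left[of "\<zero>\<^bsub>H\<^esub>"] by auto
next
  fix W assume W: "submodule W complex_ring H"
    and cl: "closedin (Metric_space.mtopology (carrier H) (hdist H)) W"
    and inv: "\<And>g. g \<in> carrier G \<Longrightarrow> \<pi> g ` W \<subseteq> W"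
  interpret W: submodule W complex_ring H
    by (rule W)
  have Wc: "w \<in> carrier H" if "w \<in> W" for w
    using that W.subset by auto
  have W0: "\<zero>\<^bsub>H\<^esub> \<in> W"
    using W.one_closed by simp
  have inv': "\<pi> g w \<in> W" if "g \<in> carrier G" "w \<in> W" for g w
    using inv that by blast
  obtain p where p: "p \<in> W" and orth: "\<And>w. w \<in> W \<Longrightarrow> cinner H (\<xi> \<ominus>\<^bsub>H\<^esub> p) w = 0"
    using orthogonal_projection[OF W cl xi(1)] by blast
  note pc = Wc[OF p]
  define q where "q = \<xi> \<ominus>\<^bsub>H\<^esub> p"
  have qc: "q \<in> carrier H"
    unfolding q_def using xi pc by simp
  have xi_eq: "\<xi> = p \<oplus>\<^bsub>H\<^esub> q"
    unfolding q_def using xi(1) pc by (simp add: a_minus_def M.a_ac M.r_neg1 M.r_neg)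
  have orth1: "cinner H q w = 0" if "w \<in> W" for w
    using orth[OF that] by (simp add: q_def)
  have orth2: "cinner H w q = 0" if "w \<in> W" for w
    using orth1[OF that] cinner_commute[OF qc Wc[OF that]] by simp
  have orth3: "cinner H (\<pi> g q) w = 0" if "g \<in> carrier G" "w \<in> W" for g w
    using that qc Wc orth1[OF inv'[of "inv\<^bsub>G\<^esub> g" w]] by (simp add: cinner_rep_left)
  have decomp: "\<phi> g = cinner H (\<pi> g p) p + cinner H (\<pi> g q) q" if g: "g \<in> carrier G" for g
    unfolding coeff[OF g] using g pc qc orth2[OF inv'[OF g p]] orth3[OF g p]
    by (simp add: xi_eq rep_add cinner_simps)
  show "W = {\<zero>\<^bsub>H\<^esub>} \<or> W = carrier H"
  proof (cases "p = \<zero>\<^bsub>H\<^esub>")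
    case True
    then have "q = \<xi>"
      using xi(1) by (simp add: q_def a_minus_def)
    have "w = \<zero>\<^bsub>H\<^esub>" if w: "w \<in> W" for w
    proof (rule total[OF Wc[OF w]])
      fix g assume g: "g \<in> carrier G"
      show "cinner H w (\<pi> g \<xi>) = 0"
        using g w xi(1) Wc orth2[OF inv'[of "inv\<^bsub>G\<^esub> g" w]] cinner_rep_left[of "inv\<^bsub>G\<^esub> g" w \<xi>]
        by (simp add: \<open>q = \<xi>\<close>)
    qed
    then have "W \<subseteq> {\<zero>\<^bsub>H\<^esub>}"
      by blast
    with W0 show ?thesis by blast
  next
    case p0: False
    have "q = \<zero>\<^bsub>H\<^esub>"
    proof (rule ccontr)
      assume q0: "q \<noteq> \<zero>\<^bsub>H\<^esub>"
      define t where "t = Re (cinner H p p)"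
      have t: "cinner H p p = of_real t" "0 < t"
        using cinner_self[OF pc] cinner_pos[OF pc p0] by (auto simp: t_def)
      have "cinner H \<xi> \<xi> = cinner H p p + cinner H q q"
        unfolding xi_eq using pc qc orth1[OF p] orth2[OF p] by (simp add: cinner_simps)
      then have qq: "cinner H q q = of_real (1 - t)"
        using xi(2) t by (simp add: algebra_simps)
      have t1: "t < 1"
        using cinner_pos[OF qc q0] qq by simp
      define \<phi>1 where "\<phi>1 = (\<lambda>g. if g \<in> carrier G then cinner H (\<pi> g p) p / cinner H p p else 0)"
      define \<phi>2 where "\<phi>2 = (\<lambda>g. if g \<in> carrier G then cinner H (\<pi> g q) q / cinner H q q else 0)"
      have st: "\<phi>1 \<in> states G" "\<phi>2 \<in> states G"
        unfolding \<phi>1_def \<phi>2_def using pc qc p0 q0 by (auto intro: coefficient_state)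
      have phi_off: "\<phi> g = 0" if "g \<notin> carrier G" for g
        using ext that by (simp add: extreme_state_def states_def)
      have comb: "\<phi> = (\<lambda>g. of_real t * \<phi>1 g + of_real (1 - t) * \<phi>2 g)"
      proof
        fix g
        have "complex_of_real (1 - t) \<noteq> 0"
          using t1 by (simp only: of_real_eq_0_iff)
        then show "\<phi> g = of_real t * \<phi>1 g + of_real (1 - t) * \<phi>2 g"
          using t t1 decomp[of g] phi_off[of g] by (simp add: \<phi>1_def \<phi>2_def qq del: of_real_diff)
      qed
      then have "\<phi>1 = \<phi>2"
        using ext st t(2) t1 unfolding extreme_state_def by blast
      with comb have phi1: "\<phi> = \<phi>1"
        by (auto simp: algebra_simps)
      \<comment> \<open>The state equals the normalised coefficient of p, so p and t \<xi> have the
        same pairings with all translates of \<xi>.\<close>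
      have "p \<ominus>\<^bsub>H\<^esub> of_real t \<odot>\<^bsub>H\<^esub> \<xi> = \<zero>\<^bsub>H\<^esub>"
      proof (rule total)
        fix g assume g: "g \<in> carrier G"
        define h where "h = inv\<^bsub>G\<^esub> g"
        have h: "h \<in> carrier G"
          using g by (simp add: h_def)
        have "cinner H (\<pi> h p) \<xi> = cinner H (\<pi> h p) p"
          unfolding xi_eq using pc qc h orth2[OF inv'[OF h p]] by (simp add: cinner_simps)
        also have "\<dots> = of_real t * \<phi> h"
          using h t unfolding phi1 by (simp add: \<phi>1_def)
        also have "\<dots> = cinner H (\<pi> h (of_real t \<odot>\<^bsub>H\<^esub> \<xi>)) \<xi>"
          using h xi(1) by (simp add: coeff rep_smult cinner_simps)
        finally have "cinner H p (\<pi> g \<xi>) = cinner H (of_real t \<odot>\<^bsub>H\<^esub> \<xi>) (\<pi> g \<xi>)"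
          using g xi(1) pc by (simp add: h_def cinner_rep_left)
        then show "cinner H (p \<ominus>\<^bsub>H\<^esub> of_real t \<odot>\<^bsub>H\<^esub> \<xi>) (\<pi> g \<xi>) = 0"
          using g xi(1) pc by (simp add: cinner_diff_left)
      qed (use xi pc in simp)
      then have "p = of_real t \<odot>\<^bsub>H\<^esub> \<xi>"
        using xi pc by (subst (asm) diff_eq_zero_iff) auto
      then have "cinner H q (of_real t \<odot>\<^bsub>H\<^esub> \<xi>) = 0"
        using orth1[OF p] by simp
      then have "cinner H q \<xi> = 0"
        using t(2) qc xi(1) by (simp add: cinner_simps)
      moreover have "cinner H q \<xi> = cinner H q q"
        unfolding xi_eq using orth1[OF p] pc qc by (simp add: cinner_simps)
      ultimately show False
        using cinner_pos[OF qc q0] by simp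
    qed
    then have "\<xi> = p"
      using xi_eq pc by simp
    have "carrier H \<subseteq> W"
    proof
      fix x assume x: "x \<in> carrier H"
      obtain y where y: "y \<in> W" "\<And>w. w \<in> W \<Longrightarrow> cinner H (x \<ominus>\<^bsub>H\<^esub> y) w = 0"
        using orthogonal_projection[OF W cl x] by blast
      have "x \<ominus>\<^bsub>H\<^esub> y = \<zero>\<^bsub>H\<^esub>"
        by (rule total) (use x y Wc inv' p in \<open>auto simp: \<open>\<xi> = p\<close>\<close>)
      then have "x = y"
        using x Wc[OF y(1)] by (simp add: diff_eq_zero_iff)
      with y show "x \<in> W" by simp
    qed
    then show ?thesis
      using W.subset by auto
  qed
qed

end

context group_state
begin

definition GNS_vector :: "(complex \<times> 'a) list \<Rightarrow> complex" where
  "GNS_vector = kernel_form G \<phi> [(1, \<one>)]"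

lemma GNS_vector_carrier: "GNS_vector \<in> carrier GNS_space"
  by (simp add: GNS_vector_def GNS.embed_carrier)

lemma GNS_rep_vector:
  assumes "g \<in> carrier G"
  shows "GNS_rep g GNS_vector = kernel_form G \<phi> [(1, g)]"
proof -
  have "GNS_rep g GNS_vector = (\<lambda>xs. kernel_form G \<phi> [(1, \<one>)] (translate G (inv g) xs))"
    using GNS_vector_carrier by (simp add: GNS_rep_def GNS_vector_def)
  also have "\<dots> = kernel_form G \<phi> (translate G g [(1, \<one>)])"
    using kernel_form_translate[OF assms] by auto
  finally show ?thesis
    using assms by (simp add: translate_def)
qed

lemma cinner_GNS_rep_vector:
  assumes "g \<in> carrier G" "f \<in> carrier GNS_space"
  shows "cinner GNS_space f (GNS_rep g GNS_vector) = f [(1, g)]"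
  using assms by (simp add: GNS_rep_vector GNS.completion_reproducing)

lemma GNS_coefficient:
  assumes "g \<in> carrier G"
  shows "cinner GNS_space (GNS_rep g GNS_vector) GNS_vector = \<phi> g"
proof -
  have "cinner GNS_space (GNS_rep g GNS_vector) (kernel_form G \<phi> [(1, \<one>)]) =
      GNS_rep g GNS_vector [(1, \<one>)]"
    using GNS_rep_carrier[OF assms GNS_vector_carrier] by (simp add: GNS.completion_reproducing)
  then show ?thesis
    using assms by (simp add: GNS_rep_vector kernel_form_single flip: GNS_vector_def)
qed

text \<open>Pairing with translates of the vector evaluates \<open>f\<close> at one-element lists
  with coefficient 1, and \<open>f\<close> is conjugate linear with respect to concatenation and
  scaling.\<close>

lemma GNS_total:
  assumes f: "f \<in> carrier GNS_space"
    and 0: "\<And>g. g \<in> carrier G \<Longrightarrow> cinner GNS_space f (GNS_rep g GNS_vector) = 0"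
  shows "f = \<zero>\<^bsub>GNS_space\<^esub>"
proof -
  obtain s where s: "GNS.represents s f"
    using f by (auto elim: GNS.completion_carrierE)
  have lim: "(\<lambda>n. kernel_form G \<phi> (s n) xs) \<longlonglongrightarrow> f xs" for xs
    using s by (simp add: GNS.represents_def)
  have single: "f [(1, g)] = 0" for g
  proof (cases "g \<in> carrier G")
    case True
    then show ?thesis
      using 0[OF True] cinner_GNS_rep_vector[OF True f] by simp
  next
    case False
    then have "kernel_form G \<phi> xs [(1, g)] = 0" for xs
      by (simp add: kernel_form_def)
    then show ?thesis
      using lim[of "[(1, g)]"] by (simp add: LIMSEQ_const_iff)
  qed
  have "f xs = 0" for xs
  proof (induction xs)
    case Nil
    then show ?case
      using lim[of "[]"] by (simp add: LIMSEQ_const_iff)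
  next
    case (Cons x xs)
    have "x # xs = scale_list (fst x) [(1, snd x)] @ xs"
      by simp
    then have "f (x # xs) = cnj (fst x) * f [(1, snd x)] + f xs"
      by (metis GNS.represents_linear(1,2)[OF s])
    then show ?case
      using Cons single by simp
  qed
  then show ?thesis by auto
qed

theorem GNS_irreducible:
  assumes "extreme_state G \<phi>"
  shows "irreducible_unitary_representation G GNS_space GNS_rep"
proof (rule GNS.irreducible_if_extreme[OF GNS_vector_carrier _ _ assms])
  show "cinner GNS_space GNS_vector GNS_vector = 1"
    using GNS_coefficient[OF one_closed] GNS_rep_one[OF GNS_vector_carrier] state
    by (simp add: states_def del: GNS.completion_simps)
qed (use GNS_total GNS_coefficient in \<open>auto simp del: GNS.completion_simps\<close>)

end

section \<open>Existence of extreme states\<close>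

lemma continuous_on_sum_list:
  fixes f :: "'i \<Rightarrow> 'a::topological_space \<Rightarrow> 'b::real_normed_vector"
  shows "(\<And>x. continuous_on A (f x)) \<Longrightarrow> continuous_on A (\<lambda>a. \<Sum>x\<leftarrow>xs. f x a)"
  by (induction xs) (auto intro: continuous_intros)

lemma continuous_on_apply [continuous_intros]:
  "continuous_on A (\<lambda>\<phi>. \<phi> g)"
  by (rule continuous_on_subset[OF continuous_on_product_coordinates]) simp

lemma continuous_on_kernel_form: "continuous_on A (\<lambda>\<phi>. kernel_form G \<phi> xs ys)"
proof -
  have "continuous_on A (\<lambda>\<phi>. if P then \<phi> g else 0)" for P and g :: 'a
    by (cases P) (simp_all add: continuous_on_apply)
  then show ?thesis
    unfolding kernel_form_def by (intro continuous_on_sum_list continuous_on_mult continuous_on_const)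
qed

text \<open>Tychonoff: each condition involves finitely many coordinates, so it is closed in the
  product of discs.\<close>

lemma compact_states: "compact (states G)"
proof -
  have "compactin (product_topology (\<lambda>_::'a. euclidean :: complex topology) UNIV)
      (PiE UNIV (\<lambda>_. cball 0 1))"
    by (simp add: compactin_PiE)
  then have "compact (PiE UNIV (\<lambda>_::'a. cball (0::complex) 1))"
    by (simp add: euclidean_product_topology)
  moreover have "states G = PiE UNIV (\<lambda>_. cball 0 1) \<inter>
    ((\<Inter>g\<in>- carrier G. {\<phi>. \<phi> g = 0}) \<inter> ({\<phi>. \<phi> \<one>\<^bsub>G\<^esub> = 1} \<inter>
      ((\<Inter>g\<in>carrier G. {\<phi>. \<phi> (inv\<^bsub>G\<^esub> g) = cnj (\<phi> g)}) \<inter>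
      (\<Inter>xs. {\<phi>. 0 \<le> Re (kernel_form G \<phi> xs xs)}))))"
    by (auto simp: states_def)
  moreover have "closed ((\<Inter>g\<in>- carrier G. {\<phi>. \<phi> g = 0}) \<inter> ({\<phi>. \<phi> \<one>\<^bsub>G\<^esub> = 1} \<inter>
      ((\<Inter>g\<in>carrier G. {\<phi>. \<phi> (inv\<^bsub>G\<^esub> g) = cnj (\<phi> g)}) \<inter>
      (\<Inter>xs. {\<phi>. 0 \<le> Re (kernel_form G \<phi> xs xs)}))))"
    by (intro closed_Int closed_INT ballI closed_Collect_eq closed_Collect_le continuous_intros
        continuous_on_kernel_form)
  ultimately show ?thesis
    by (simp only: compact_Int_closed)
qed

text \<open>
  The functional \<open>s - \<Lambda> * h\<close> below is strictly convex, so its maximum over the compact convex set of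
  states is attained at an extreme state; a large \<open>\<Lambda>\<close> forces \<open>h\<close> to be small there.
\<close>

lemma exists_extreme_state:
  fixes G :: "('g, 'm) monoid_scheme" and h :: "('g \<Rightarrow> complex) \<Rightarrow> real"
  assumes count: "countable (carrier G)" and phi0: "\<phi>0 \<in> states G"
    and cont: "continuous_on (states G) h"
    and affine: "\<And>\<phi>1 \<phi>2 t. h (\<lambda>g. of_real t * \<phi>1 g + of_real (1 - t) * \<phi>2 g) =
      t * h \<phi>1 + (1 - t) * h \<phi>2"
    and less: "h \<phi>0 < c"
  obtains \<phi> where "extreme_state G \<phi>" "h \<phi> < c"
proof -
  have "carrier G \<noteq> {}"
    using phi0 by (auto simp: states_def)
  then obtain e :: "nat \<Rightarrow> 'g" where e: "range e = carrier G"
    using range_from_nat_into[OF _ count] by blast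
  \<comment> \<open>A weighted square norm over an enumeration of the group. The weights give
    uniform convergence on the states, hence continuity, and a function with \<open>s\<close> equal
    to 0 vanishes on the whole carrier.\<close>
  define s where "s \<phi> = (\<Sum>i. (1 / 2) ^ i * (cmod (\<phi> (e i)))\<^sup>2)" for \<phi>
  have term_le: "(1 / 2) ^ i * (cmod (\<phi> (e i)))\<^sup>2 \<le> K * (1 / 2) ^ i"
    if "\<And>g. (cmod (\<phi> g))\<^sup>2 \<le> K" for \<phi> i and K :: real
    using that[of "e i"] by (simp add: mult.commute)
  have geo: "summable (\<lambda>i. K * (1 / 2) ^ i)" for K :: real
    by (intro summable_mult summable_geometric) simp
  have summable: "summable (\<lambda>i. (1 / 2) ^ i * (cmod (\<phi> (e i)))\<^sup>2)"
    if "\<And>g. (cmod (\<phi> g))\<^sup>2 \<le> K" for \<phi> and K :: real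
    by (rule summable_comparison_test'[OF geo[of K], of 0]) (use term_le[OF that] in auto)
  have bound: "(cmod (\<phi> g))\<^sup>2 \<le> 1" if "\<phi> \<in> states G" for \<phi> g
    using that by (simp add: states_def power_le_one)
  have s_nonneg: "0 \<le> s \<phi>" if "\<phi> \<in> states G" for \<phi>
    unfolding s_def by (intro suminf_nonneg summable[OF bound[OF that]]) auto
  have s_le: "s \<phi> \<le> 2" if "\<phi> \<in> states G" for \<phi>
  proof -
    have "s \<phi> \<le> (\<Sum>i. 1 * (1 / 2) ^ i)"
      unfolding s_def by (intro suminf_le summable[OF bound[OF that]] geo term_le bound[OF that])
    also have "\<dots> = 2"
      using suminf_geometric[of "1 / 2 :: real"] by simp
    finally show ?thesis .
  qed
  have "uniform_limit (states G) (\<lambda>n \<phi>. \<Sum>i<n. (1 / 2) ^ i * (cmod (\<phi> (e i)))\<^sup>2) s sequentially"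
    unfolding s_def
    by (rule Weierstrass_m_test[OF _ geo[of 1]]) (use term_le[OF bound] in auto)
  then have s_cont: "continuous_on (states G) s"
    by (rule uniform_limit_theorem[rotated])
      (auto intro!: always_eventually continuous_intros)
  \<comment> \<open>On states \<open>s\<close> takes values between 0 and 2, so with the numerator 3
    a maximiser exceeds \<open>h \<phi>0\<close> by at most two thirds of the gap to
    \<open>c\<close>.\<close>
  define \<Lambda> where "\<Lambda> = 3 / (c - h \<phi>0)"
  have \<Lambda>: "\<Lambda> > 0"
    using less by (simp add: \<Lambda>_def)
  obtain \<phi> where phi: "\<phi> \<in> states G"
    and max: "\<And>\<psi>. \<psi> \<in> states G \<Longrightarrow> s \<psi> - \<Lambda> * h \<psi> \<le> s \<phi> - \<Lambda> * h \<phi>"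
    using continuous_attains_sup[OF compact_states[of G], of "\<lambda>\<phi>. s \<phi> - \<Lambda> * h \<phi>"] phi0
    by (force intro!: continuous_intros s_cont cont)
  have "h \<phi> < c"
  proof -
    have "\<Lambda> * (h \<phi> - h \<phi>0) \<le> 2"
      using max[OF phi0] s_nonneg[OF phi0] s_le[OF phi] by (simp add: algebra_simps)
    then have "h \<phi> - h \<phi>0 \<le> 2 * (c - h \<phi>0) / 3"
      using less by (simp add: \<Lambda>_def field_simps)
    then show ?thesis
      using less by (simp add: field_simps)
  qed
  moreover have "extreme_state G \<phi>"
    unfolding extreme_state_def
  proof (intro conjI ballI allI impI phi, elim conjE)
    fix \<phi>1 \<phi>2 and t :: real
    assume st: "\<phi>1 \<in> states G" "\<phi>2 \<in> states G" and t: "0 < t" "t < 1"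
      and comb: "\<phi> = (\<lambda>g. of_real t * \<phi>1 g + of_real (1 - t) * \<phi>2 g)"
    define \<delta> where "\<delta> = (\<lambda>g. \<phi>1 g - \<phi>2 g)"
    have "cmod (\<delta> g) \<le> 2" for g
      using norm_triangle_ineq4[of "\<phi>1 g" "\<phi>2 g"] st by (simp add: \<delta>_def states_def) (smt (verit))
    then have "(cmod (\<delta> g))\<^sup>2 \<le> 4" for g
      using power_mono[of "cmod (\<delta> g)" 2 2] by simp
    then have sum: "summable (\<lambda>i. (1 / 2) ^ i * (cmod (\<psi> (e i)))\<^sup>2)" if "\<psi> \<in> {\<phi>1, \<phi>2, \<delta>}" for \<psi>
      using that summable[of \<phi>1 1] summable[of \<phi>2 1] summable[of \<delta> 4] bound[OF st(1)] bound[OF st(2)]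
      by auto
    \<comment> \<open>The defect t (1 - t) |\<delta>|^2 is the strict convexity: at a maximum its
      weighted sum cannot be positive.\<close>
    have pointwise: "(cmod (\<phi> g))\<^sup>2 = t * (cmod (\<phi>1 g))\<^sup>2 + (1 - t) * (cmod (\<phi>2 g))\<^sup>2
        - t * (1 - t) * (cmod (\<delta> g))\<^sup>2" for g
      unfolding comb \<delta>_def cmod_power2 by (simp add: power2_eq_square algebra_simps)
    have "s \<phi> = (\<Sum>i. t * ((1 / 2) ^ i * (cmod (\<phi>1 (e i)))\<^sup>2)
        + (1 - t) * ((1 / 2) ^ i * (cmod (\<phi>2 (e i)))\<^sup>2)
        - t * (1 - t) * ((1 / 2) ^ i * (cmod (\<delta> (e i)))\<^sup>2))"
      unfolding s_def pointwise by (simp add: algebra_simps)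
    also have "\<dots> = t * s \<phi>1 + (1 - t) * s \<phi>2 - t * (1 - t) * s \<delta>"
      unfolding s_def
      by (intro sums_unique[symmetric] sums_diff sums_add sums_mult summable_sums sum) simp_all
    finally have s_eq: "s \<phi> = t * s \<phi>1 + (1 - t) * s \<phi>2 - t * (1 - t) * s \<delta>" .
    have h_eq: "h \<phi> = t * h \<phi>1 + (1 - t) * h \<phi>2"
      unfolding comb by (rule affine)
    have "t * (s \<phi>1 - \<Lambda> * h \<phi>1) + (1 - t) * (s \<phi>2 - \<Lambda> * h \<phi>2) \<le> s \<phi> - \<Lambda> * h \<phi>"
    proof -
      have "t * (s \<phi>1 - \<Lambda> * h \<phi>1) + (1 - t) * (s \<phi>2 - \<Lambda> * h \<phi>2) \<le>
          t * (s \<phi> - \<Lambda> * h \<phi>) + (1 - t) * (s \<phi> - \<Lambda> * h \<phi>)"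
        using t by (intro add_mono mult_left_mono max st) auto
      then show ?thesis by (simp add: algebra_simps)
    qed
    then have "t * (1 - t) * s \<delta> \<le> 0"
      unfolding s_eq h_eq by (simp add: algebra_simps)
    then have "s \<delta> \<le> 0"
      using t by (simp add: mult_le_0_iff)
    have delta: "\<delta> (e i) = 0" for i
    proof -
      have "(1 / 2) ^ i * (cmod (\<delta> (e i)))\<^sup>2 = sum (\<lambda>i. (1 / 2) ^ i * (cmod (\<delta> (e i)))\<^sup>2) {i}"
        by simp
      also have "\<dots> \<le> s \<delta>"
        unfolding s_def by (intro sum_le_suminf sum) auto
      finally have "(1 / 2) ^ i * (cmod (\<delta> (e i)))\<^sup>2 \<le> 0"
        using \<open>s \<delta> \<le> 0\<close> by linarith
      then have "(1 / 2) ^ i * (cmod (\<delta> (e i)))\<^sup>2 \<le> (1 / 2) ^ i * 0"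
        by simp
      then have "(cmod (\<delta> (e i)))\<^sup>2 \<le> 0"
        by (subst (asm) mult_le_cancel_left_pos) simp_all
      then show ?thesis
        by simp
    qed
    show "\<phi>1 = \<phi>2"
    proof
      fix g
      show "\<phi>1 g = \<phi>2 g"
      proof (cases "g \<in> carrier G")
        case True
        then obtain i where "g = e i"
          using e by auto
        then show ?thesis
          using delta[of i] by (simp add: \<delta>_def)
      qed (use st in \<open>simp add: states_def\<close>)
    qed
  qed
  ultimately show thesis
    by (rule that[rotated])
qed

section \<open>Characters of finite subgroups\<close>

definition character :: "('g, 'm) monoid_scheme \<Rightarrow> 'g set \<Rightarrow> ('g \<Rightarrow> complex) \<Rightarrow> bool" where
  "character G A \<theta> \<longleftrightarrow> (\<forall>a\<in>A. cmod (\<theta> a) = 1) \<and> (\<forall>a\<in>A. \<forall>b\<in>A. \<theta> (a \<otimes>\<^bsub>G\<^esub> b) = \<theta> a * \<theta> b)"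

text \<open>One irreducible representation is nontrivial on every member of the family at once;
  \<open>F\<close> collects the elements that witness it.\<close>

definition separates :: "('g, 'm) monoid_scheme \<Rightarrow> 'g set set \<Rightarrow> bool" where
  "separates G \<N> \<longleftrightarrow> (\<exists>F\<subseteq>carrier G. irreducibly_faithful G F \<and> (\<forall>N\<in>\<N>. \<exists>y\<in>F \<inter> N. y \<noteq> \<one>\<^bsub>G\<^esub>))"

lemma kernel_form_add:
  "kernel_form G (\<lambda>g. \<phi> g + \<psi> g) xs ys = kernel_form G \<phi> xs ys + kernel_form G \<psi> xs ys"
proof -
  have "(if P then z + w else 0) = (if P then z else 0) + (if P then w else 0)"
    for P and z w :: complex
    by simp
  then show ?thesis
    unfolding kernel_form_def by (simp only: distrib_left sum_list_addf)
qed

lemma sum_list_sum_swap: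
  fixes f :: "'a \<Rightarrow> 'b \<Rightarrow> 'c::comm_monoid_add"
  shows "(\<Sum>x\<leftarrow>xs. \<Sum>u\<in>U. f x u) = (\<Sum>u\<in>U. \<Sum>x\<leftarrow>xs. f x u)"
  by (induction xs) (simp_all add: sum.distrib)

lemma sum_list_cnj: "(\<Sum>x\<leftarrow>xs. cnj (f x)) = cnj (\<Sum>x\<leftarrow>xs. f x)"
  by (induction xs) simp_all

context group
begin

lemma character_simps:
  assumes "subgroup A G" "character G A \<theta>"
  shows "\<theta> \<one> = 1" "\<And>a. a \<in> A \<Longrightarrow> \<theta> (inv a) = cnj (\<theta> a)"
    "\<And>a b. a \<in> A \<Longrightarrow> b \<in> A \<Longrightarrow> \<theta> (a \<otimes> b) = \<theta> a * \<theta> b" "\<And>a. a \<in> A \<Longrightarrow> cmod (\<theta> a) = 1"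
proof -
  interpret A: subgroup A G by (rule assms(1))
  show mult: "\<theta> (a \<otimes> b) = \<theta> a * \<theta> b" if "a \<in> A" "b \<in> A" for a b
    using assms(2) that by (simp add: character_def)
  show norm: "cmod (\<theta> a) = 1" if "a \<in> A" for a
    using assms(2) that by (simp add: character_def)
  have nz: "\<theta> a \<noteq> 0" if "a \<in> A" for a
    using norm[OF that] by auto
  show one: "\<theta> \<one> = 1"
    using mult[of \<one> \<one>] nz[of \<one>] by simp
  show "\<theta> (inv a) = cnj (\<theta> a)" if a: "a \<in> A" for a
  proof -
    have "\<theta> a * \<theta> (inv a) = \<theta> a * cnj (\<theta> a)"
      using mult[of a "inv a"] a one norm[OF a] complex_norm_square[of "\<theta> a"] by simp
    then show ?thesis
      using nz[OF a] by simp
  qed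
qed

text \<open>Translation by \<open>a\<close> permutes \<open>B\<close> and multiplies the sum by
  \<theta>(a), which is not 1.\<close>

lemma sum_character_eq_0:
  assumes A: "subgroup A G" "character G A \<theta>" and B: "subgroup B G" "B \<subseteq> A" "finite B"
    and a: "a \<in> B" "\<theta> a \<noteq> 1"
  shows "(\<Sum>b\<in>B. \<theta> b) = 0"
proof -
  interpret B: subgroup B G by (rule B)
  have aG: "a \<in> carrier G" "inv a \<in> B"
    using a by simp_all
  have cancel: "inv a \<otimes> (a \<otimes> b) = b" "a \<otimes> (inv a \<otimes> b) = b" if "b \<in> B" for b
    using aG(1) B.mem_carrier[OF that] by (simp_all add: m_assoc[symmetric])
  have "(\<Sum>b\<in>B. \<theta> b) = (\<Sum>b\<in>B. \<theta> (a \<otimes> b))"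
    by (rule sum.reindex_bij_witness[of _ "\<lambda>b. a \<otimes> b" "\<lambda>b. inv a \<otimes> b"])
      (simp_all only: cancel B.m_closed a(1) aG(2))
  also have "\<dots> = (\<Sum>b\<in>B. \<theta> a * \<theta> b)"
    by (intro sum.cong refl character_simps(3)[OF A] subsetD[OF B(2)] a(1))
  also have "\<dots> = \<theta> a * (\<Sum>b\<in>B. \<theta> b)"
    by (simp add: sum_distrib_left)
  finally show ?thesis
    using a(2) by (metis mult_cancel_right2)
qed

text \<open>
  Positivity holds because the kernel is, up to the factor \<open>card A\<close>, the Gram matrix of the
  translates of \<open>\<phi>\<close>.
\<close>

lemma character_state:
  assumes A: "subgroup A G" "finite A" "character G A \<theta>"
  defines "\<phi> \<equiv> \<lambda>g. if g \<in> A then \<theta> g else 0"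
  shows "\<phi> \<in> states G"
proof -
  interpret A: subgroup A G by (rule A)
  note chi = character_simps[OF A(1,3)]
  have inv_A: "inv g \<in> A \<longleftrightarrow> g \<in> A" if "g \<in> carrier G" for g
    using that A.m_inv_closed[of g] A.m_inv_closed[of "inv g"] by auto
  have phi_inv: "\<phi> (inv g) = cnj (\<phi> g)" if "g \<in> carrier G" for g
    using inv_A[OF that] by (simp add: \<phi>_def chi)
  have phi_mult: "\<phi> (a \<otimes> g) = \<theta> a * \<phi> g" if "a \<in> A" "g \<in> carrier G" for a g
  proof -
    have "g \<in> A" if "a \<otimes> g \<in> A"
    proof -
      have "inv a \<otimes> (a \<otimes> g) \<in> A"
        using \<open>a \<in> A\<close> that by simp
      then show ?thesis
        using \<open>a \<in> A\<close> \<open>g \<in> carrier G\<close> by (simp flip: m_assoc)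
    qed
    then show ?thesis
      using that by (auto simp: \<phi>_def chi)
  qed
  \<comment> \<open>The first factor vanishes unless u lies in the coset gA, so any finite
    \<open>U\<close> containing that coset gives the full sum.\<close>
  have gram: "(\<Sum>u\<in>U. \<phi> (inv u \<otimes> g) * cnj (\<phi> (inv u \<otimes> h))) = of_nat (card A) * \<phi> (inv h \<otimes> g)"
    if U: "finite U" "U \<subseteq> carrier G" "(\<lambda>a. g \<otimes> a) ` A \<subseteq> U"
      and gh: "g \<in> carrier G" "h \<in> carrier G" for U g h
  proof -
    have "(\<Sum>u\<in>U. \<phi> (inv u \<otimes> g) * cnj (\<phi> (inv u \<otimes> h))) =
        (\<Sum>u\<in>(\<lambda>a. g \<otimes> a) ` A. \<phi> (inv u \<otimes> g) * cnj (\<phi> (inv u \<otimes> h)))"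
    proof (rule sum.mono_neutral_right[OF U(1,3)], rule ballI)
      fix u assume u: "u \<in> U - (\<lambda>a. g \<otimes> a) ` A"
      have "inv u \<otimes> g \<notin> A"
      proof
        assume *: "inv u \<otimes> g \<in> A"
        have "u = g \<otimes> inv (inv u \<otimes> g)"
          using u U gh by (auto simp: inv_mult_group simp flip: m_assoc)
        then have "u \<in> (\<lambda>a. g \<otimes> a) ` A"
          using A.m_inv_closed[OF *] by (rule image_eqI)
        with u show False by simp
      qed
      then show "\<phi> (inv u \<otimes> g) * cnj (\<phi> (inv u \<otimes> h)) = 0"
        by (simp add: \<phi>_def)
    qed
    also have "\<dots> = (\<Sum>a\<in>A. \<phi> (inv (g \<otimes> a) \<otimes> g) * cnj (\<phi> (inv (g \<otimes> a) \<otimes> h)))"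
      by (subst sum.reindex) (use gh in \<open>auto simp: inj_on_def\<close>)
    also have "\<dots> = (\<Sum>a\<in>A. \<phi> (inv h \<otimes> g))"
    proof (rule sum.cong[OF refl])
      fix a assume a: "a \<in> A"
      have "inv (g \<otimes> a) \<otimes> g = inv a"
        using gh a by (simp add: inv_mult_group m_assoc)
      moreover have "inv (g \<otimes> a) \<otimes> h = inv a \<otimes> (inv g \<otimes> h)"
        using gh a by (simp add: inv_mult_group m_assoc)
      moreover have "\<phi> (inv h \<otimes> g) = cnj (\<phi> (inv g \<otimes> h))"
        using phi_inv[of "inv g \<otimes> h"] gh by (simp add: inv_mult_group)
      moreover have "\<theta> a * cnj (\<theta> a) = 1"
        using complex_norm_square[of "\<theta> a"] a by (simp add: chi)
      moreover have "\<phi> (inv a) = cnj (\<theta> a)"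
        using a by (simp add: \<phi>_def chi)
      ultimately show "\<phi> (inv (g \<otimes> a) \<otimes> g) * cnj (\<phi> (inv (g \<otimes> a) \<otimes> h)) = \<phi> (inv h \<otimes> g)"
        using gh a by (simp add: phi_mult chi) (simp add: mult.assoc[symmetric] mult.commute)
    qed
    finally show ?thesis by simp
  qed
  have "0 \<le> Re (kernel_form G \<phi> xs xs)" for xs
  proof -
    \<comment> \<open>One finite index set that contains the left cosets of all group elements
      occurring in \<open>xs\<close>.\<close>
    define U where "U = (\<Union>x\<in>{x\<in>set xs. snd x \<in> carrier G}. (\<lambda>a. snd x \<otimes> a) ` A)"
    have U: "finite U" "U \<subseteq> carrier G"
      using A(2) by (auto simp: U_def)
    define k where "k u x = (if snd x \<in> carrier G then fst x * \<phi> (inv u \<otimes> snd x) else 0)" for u and x :: "complex \<times> 'a"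
    have "of_nat (card A) * kernel_form G \<phi> xs xs = (\<Sum>x\<leftarrow>xs. \<Sum>y\<leftarrow>xs. \<Sum>u\<in>U. k u x * cnj (k u y))"
      unfolding kernel_form_def sum_list_const_mult[symmetric]
    proof (intro arg_cong[of _ _ sum_list] map_cong refl)
      fix x y assume xy: "x \<in> set xs" "y \<in> set xs"
      show "of_nat (card A) * (fst x * cnj (fst y) * (if snd x \<in> carrier G \<and> snd y \<in> carrier G
          then \<phi> (inv snd y \<otimes> snd x) else 0)) = (\<Sum>u\<in>U. k u x * cnj (k u y))"
      proof (cases "snd x \<in> carrier G \<and> snd y \<in> carrier G")
        case True
        then have "(\<lambda>a. snd x \<otimes> a) ` A \<subseteq> U"
          using xy by (auto simp: U_def)
        from gram[OF U this, of "snd y"] True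
        have *: "of_nat (card A) * \<phi> (inv snd y \<otimes> snd x) =
            (\<Sum>u\<in>U. \<phi> (inv u \<otimes> snd x) * cnj (\<phi> (inv u \<otimes> snd y)))"
          by simp
        have "of_nat (card A) * (fst x * cnj (fst y) * \<phi> (inv snd y \<otimes> snd x)) =
            fst x * cnj (fst y) * (of_nat (card A) * \<phi> (inv snd y \<otimes> snd x))"
          by simp
        also have "\<dots> = (\<Sum>u\<in>U. k u x * cnj (k u y))"
          unfolding * sum_distrib_left using True by (intro sum.cong) (simp_all add: k_def)
        finally show ?thesis
          using True by simp
      qed (auto simp: k_def)
    qed
    also have "\<dots> = (\<Sum>u\<in>U. (\<Sum>x\<leftarrow>xs. k u x) * cnj (\<Sum>x\<leftarrow>xs. k u x))"
      by (simp add: sum_list_sum_swap sum_list_const_mult sum_list_mult_const sum_list_cnj)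
    finally have eq: "of_nat (card A) * kernel_form G \<phi> xs xs =
        of_real (\<Sum>u\<in>U. (cmod (\<Sum>x\<leftarrow>xs. k u x))\<^sup>2)"
      by (simp only: of_real_sum complex_norm_square)
    have Re_of_nat_mult: "Re (of_nat n * z) = real n * Re z" for n z
      by simp
    have "real (card A) * Re (kernel_form G \<phi> xs xs) = (\<Sum>u\<in>U. (cmod (\<Sum>x\<leftarrow>xs. k u x))\<^sup>2)"
      using arg_cong[OF eq, of Re] Re_of_nat_mult by (simp only: Re_complex_of_real)
    moreover have "0 \<le> (\<Sum>u\<in>U. (cmod (\<Sum>x\<leftarrow>xs. k u x))\<^sup>2)"
      by (intro sum_nonneg) simp
    ultimately have "0 \<le> real (card A) * Re (kernel_form G \<phi> xs xs)"
      by (simp only:)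
    moreover have "A \<noteq> {}"
      using A.one_closed by blast
    then have "card A > 0"
      using A(2) by (simp add: card_gt_0_iff)
    ultimately show ?thesis
      by (simp add: zero_le_mult_iff)
  qed
  moreover have "cmod (\<phi> g) \<le> 1" for g
    by (simp add: \<phi>_def chi)
  ultimately show ?thesis
    using phi_inv by (auto simp: states_def) (auto simp: \<phi>_def chi)
qed

text \<open>
  An average of the translates of the state over enough elements of \<open>N\<close> that are inequivalent
  modulo \<open>A\<close> has small norm if \<open>N\<close> is infinite, and the average over \<open>A \<inter> N\<close> vanishes if \<open>\<theta>\<close> is
  nontrivial on it.
\<close>

lemma kernel_form_infinite:
  assumes A: "subgroup A G" "finite A" "character G A \<theta>" and N: "subgroup N G" "infinite N"
  shows "\<exists>ls. length ls = k \<and> set ls \<subseteq> N \<and>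
    kernel_form G (\<lambda>g. if g \<in> A then \<theta> g else 0) (map (Pair 1) ls) (map (Pair 1) ls) = of_nat k"
proof (induction k)
  case (Suc k)
  define \<phi> where "\<phi> = (\<lambda>g. if g \<in> A then \<theta> g else 0)"
  interpret A: subgroup A G by (rule A)
  interpret N: subgroup N G by (rule N)
  obtain ls where ls: "length ls = k" "set ls \<subseteq> N"
    "kernel_form G \<phi> (map (Pair 1) ls) (map (Pair 1) ls) = of_nat k"
    using Suc.IH unfolding \<phi>_def by blast
  have "finite (\<Union>s\<in>set ls. (\<lambda>a. s \<otimes> a) ` A)"
    using A(2) by simp
  \<comment> \<open>Finitely many cosets of the finite \<open>A\<close> cannot exhaust
    \<open>N\<close>. Outside them all mixed terms vanish, so only the diagonal grows.\<close>
  then obtain t where t: "t \<in> N" "t \<notin> (\<Union>s\<in>set ls. (\<lambda>a. s \<otimes> a) ` A)"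
    using N(2) by (meson finite_subset subsetI)
  have notin: "inv s \<otimes> t \<notin> A" "inv t \<otimes> s \<notin> A" if s: "s \<in> set ls" for s
  proof -
    have c: "s \<in> carrier G" "t \<in> carrier G"
      using s ls t by auto
    show 1: "inv s \<otimes> t \<notin> A"
    proof
      assume "inv s \<otimes> t \<in> A"
      then have "s \<otimes> (inv s \<otimes> t) \<in> (\<lambda>a. s \<otimes> a) ` A"
        by blast
      moreover have "s \<otimes> (inv s \<otimes> t) = t"
        using c by (simp add: m_assoc[symmetric])
      ultimately show False
        using t(2) s by auto
    qed
    show "inv t \<otimes> s \<notin> A"
    proof
      assume "inv t \<otimes> s \<in> A"
      then have "inv (inv t \<otimes> s) \<in> A"
        by (rule A.m_inv_closed)
      then show False
        using 1 c by (simp add: inv_mult_group)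
    qed
  qed
  have "kernel_form G \<phi> [(1, t)] (map (Pair 1) rs) = 0" "kernel_form G \<phi> (map (Pair 1) rs) [(1, t)] = 0"
    if "set rs \<subseteq> set ls" for rs
    using that notin by (induction rs) (auto simp: kernel_form_def \<phi>_def)
  moreover have "kernel_form G \<phi> [(1, t)] [(1, t)] = 1"
    using t(1) character_simps(1)[OF A(1,3)] by (simp add: kernel_form_single \<phi>_def)
  ultimately have "kernel_form G \<phi> (map (Pair 1) (t # ls)) (map (Pair 1) (t # ls)) = of_nat (Suc k)"
    using ls(3) unfolding list.map kernel_form_Cons_left[of _ _ _ "map (Pair 1) ls"]
      kernel_form_Cons_right[of _ _ _ "(1, t)" "map (Pair 1) ls"]
    by simp
  then show ?case
    unfolding \<phi>_def using ls t by (intro exI[of _ "t # ls"]) simp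
qed (auto simp: kernel_form_def)

lemma kernel_form_nontrivial:
  assumes A: "subgroup A G" "finite A" "character G A \<theta>" and N: "subgroup N G"
    and a: "a \<in> A \<inter> N" "\<theta> a \<noteq> 1"
  obtains ls where "ls \<noteq> []" "set ls \<subseteq> N"
    "kernel_form G (\<lambda>g. if g \<in> A then \<theta> g else 0) (map (Pair 1) ls) (map (Pair 1) ls) = 0"
proof -
  define \<phi> where "\<phi> = (\<lambda>g. if g \<in> A then \<theta> g else 0)"
  define B where "B = A \<inter> N"
  have B: "subgroup B G" "B \<subseteq> A" "finite B"
    unfolding B_def using A N by (auto intro: subgroups_Inter_pair)
  interpret B: subgroup B G by (rule B)
  obtain ls where ls: "set ls = B" "distinct ls"
    using finite_distinct_list[OF B(3)] by blast
  have "(\<Sum>t\<in>B. \<phi> (inv t \<otimes> s)) = 0" if s: "s \<in> B" for s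
  proof -
    have "(\<Sum>t\<in>B. \<phi> (inv t \<otimes> s)) = (\<Sum>b\<in>B. \<phi> b)"
    proof (rule sum.reindex_bij_witness[of _ "\<lambda>b. s \<otimes> inv b" "\<lambda>t. inv t \<otimes> s"])
      fix t assume "t \<in> B"
      then show "s \<otimes> inv (inv t \<otimes> s) = t" "inv (s \<otimes> inv t) \<otimes> s = t"
        using s B.mem_carrier[of s] B.mem_carrier[of t]
        by (simp_all add: inv_mult_group m_assoc) (simp add: m_assoc[symmetric])
    qed (use s in auto)
    also have "\<dots> = (\<Sum>b\<in>B. \<theta> b)"
      using B(2) by (intro sum.cong) (auto simp: \<phi>_def)
    also have "\<dots> = 0"
      using sum_character_eq_0[OF A(1,3) B] a by (simp add: B_def)
    finally show ?thesis .
  qed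
  then have "kernel_form G \<phi> (map (Pair 1) ls) (map (Pair 1) ls) = 0"
    unfolding kernel_form_def
    using ls by (simp add: o_def sum_list_distinct_conv_sum_set)
  moreover have "ls \<noteq> []"
    using ls(1) B.one_closed by fastforce
  ultimately show thesis
    using that[of ls] ls(1) by (simp add: \<phi>_def B_def)
qed

text \<open>For each member the square norm of a suitable average of translates is at most 1/k, with
  k larger than the number of members, so the total \<open>h\<close> is below 1 at the extended
  character. An extreme state with \<open>h\<close> still below 1 cannot be constantly 1 on a
  member, since that member alone would contribute 1; so its cyclic vector is moved by each of
  them.\<close>

theorem separates_if_character:
  assumes count: "countable (carrier G)" and A: "subgroup A G" "finite A" "character G A \<theta>"
    and fin: "finite \<N>" and normal: "\<And>N. N \<in> \<N> \<Longrightarrow> N \<lhd> G"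
    and cases: "\<And>N. N \<in> \<N> \<Longrightarrow> infinite N \<or> (\<exists>a\<in>A \<inter> N. \<theta> a \<noteq> 1)"
  shows "separates G \<N>"
proof -
  define \<phi>0 where "\<phi>0 = (\<lambda>g. if g \<in> A then \<theta> g else 0)"
  have phi0: "\<phi>0 \<in> states G"
    unfolding \<phi>0_def by (rule character_state[OF A])
  \<comment> \<open>At a state: the square norm of the average of the translates of the GNS vector
    by the elements of \<open>ls\<close>.\<close>
  define avg where "avg \<phi> ls = Re (kernel_form G \<phi> (map (Pair 1) ls) (map (Pair 1) ls)) / (real (length ls))\<^sup>2"
    for \<phi> and ls :: "'a list"
  define k where "k = Suc (card \<N>)"
  have "\<exists>ls. ls \<noteq> [] \<and> set ls \<subseteq> N \<and> avg \<phi>0 ls \<le> 1 / real k" if N: "N \<in> \<N>" for N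
  proof (cases "infinite N")
    case True
    obtain ls where ls: "length ls = k" "set ls \<subseteq> N"
      "kernel_form G \<phi>0 (map (Pair 1) ls) (map (Pair 1) ls) = of_nat k"
      using kernel_form_infinite[OF A normal_imp_subgroup[OF normal[OF N]] True, of k]
      unfolding \<phi>0_def by blast
    then have "avg \<phi>0 ls = 1 / real k"
      by (simp add: avg_def power2_eq_square)
    then show ?thesis
      using ls by (intro exI[of _ ls]) (auto simp: k_def)
  next
    case False
    then obtain a where "a \<in> A \<inter> N" "\<theta> a \<noteq> 1"
      using cases[OF N] by blast
    from kernel_form_nontrivial[OF A normal_imp_subgroup[OF normal[OF N]] this]
    obtain ls where "ls \<noteq> []" "set ls \<subseteq> N" "kernel_form G \<phi>0 (map (Pair 1) ls) (map (Pair 1) ls) = 0"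
      unfolding \<phi>0_def by blast
    then show ?thesis
      by (intro exI[of _ ls]) (simp add: avg_def)
  qed
  then obtain L where L: "\<And>N. N \<in> \<N> \<Longrightarrow> L N \<noteq> [] \<and> set (L N) \<subseteq> N \<and> avg \<phi>0 (L N) \<le> 1 / real k"
    by metis
  define h where "h \<phi> = (\<Sum>N\<in>\<N>. avg \<phi> (L N))" for \<phi>
  have "h \<phi>0 \<le> (\<Sum>N\<in>\<N>. 1 / real k)"
    unfolding h_def using L by (intro sum_mono) auto
  also have "\<dots> < 1"
    by (simp add: k_def)
  finally have less: "h \<phi>0 < 1" .
  have cont: "continuous_on (states G) h"
  proof -
    have "continuous_on (states G) (\<lambda>\<phi>. \<Sum>N\<in>\<N>. avg \<phi> (L N))"
      unfolding avg_def using L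
      by (intro continuous_on_sum continuous_on_divide continuous_on_const continuous_on_Re
          continuous_on_kernel_form) auto
    then show ?thesis
      by (simp add: h_def[abs_def])
  qed
  have affine: "h (\<lambda>g. of_real t * \<phi>1 g + of_real (1 - t) * \<phi>2 g) = t * h \<phi>1 + (1 - t) * h \<phi>2"
    for \<phi>1 \<phi>2 t
    unfolding h_def sum_distrib_left sum.distrib[symmetric]
    by (intro sum.cong refl)
      (simp add: avg_def kernel_form_add kernel_form_mult add_divide_distrib del: of_real_diff)
  obtain \<phi> where ext: "extreme_state G \<phi>" and h: "h \<phi> < 1"
    by (rule exists_extreme_state[OF count phi0 cont, of 1]) (simp_all only: affine less)
  have state: "\<phi> \<in> states G"
    using ext by (simp add: extreme_state_def)
  interpret group_state G \<phi>
    by unfold_locales (rule state)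
  have avg_nonneg: "0 \<le> avg \<phi> ls" for ls
    using state by (simp add: avg_def states_def)
  have "\<exists>y\<in>N. \<phi> y \<noteq> 1" if N: "N \<in> \<N>" for N
  proof (rule ccontr)
    interpret N: normal N G by (rule normal[OF N])
    assume "\<not> (\<exists>y\<in>N. \<phi> y \<noteq> 1)"
    then have 1: "\<phi> (inv t \<otimes> s) = 1" "t \<in> carrier G" "s \<in> carrier G"
      if "t \<in> set (L N)" "s \<in> set (L N)" for t s
      using that L[OF N] by (auto simp: subset_iff)
    have row: "(\<Sum>t\<leftarrow>L N. \<phi> (inv t \<otimes> s)) = of_nat (length (L N))" if "s \<in> set (L N)" for s
    proof -
      have "(\<Sum>t\<leftarrow>L N. \<phi> (inv t \<otimes> s)) = (\<Sum>t\<leftarrow>L N. 1)"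
        using 1 that by (intro arg_cong[of _ _ sum_list] map_cong) auto
      then show ?thesis
        by (simp add: sum_list_triv)
    qed
    have "kernel_form G \<phi> (map (Pair 1) (L N)) (map (Pair 1) (L N)) =
        (\<Sum>s\<leftarrow>L N. \<Sum>t\<leftarrow>L N. \<phi> (inv t \<otimes> s))"
      unfolding kernel_form_def map_map o_def fst_conv snd_conv
      using 1(2,3) by (intro arg_cong[of _ _ sum_list] map_cong) auto
    also have "\<dots> = (\<Sum>s\<leftarrow>L N. of_nat (length (L N)))"
      using row by (intro arg_cong[of _ _ sum_list] map_cong) auto
    also have "\<dots> = of_nat (length (L N)) * of_nat (length (L N))"
      by (simp add: sum_list_triv)
    finally have "avg \<phi> (L N) = 1"
      using L[OF N] by (simp add: avg_def power2_eq_square)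
    moreover have "avg \<phi> (L N) \<le> h \<phi>"
      unfolding h_def by (rule member_le_sum[OF N _ fin]) (use avg_nonneg in auto)
    ultimately show False
      using h by simp
  qed
  then obtain y where y: "\<And>N. N \<in> \<N> \<Longrightarrow> y N \<in> N \<and> \<phi> (y N) \<noteq> 1"
    by metis
  have yG: "y N \<in> carrier G" if "N \<in> \<N>" for N
    using y[OF that] normal_imp_subgroup[OF normal[OF that]] subgroup.mem_carrier by metis
  have "irreducibly_faithful G (y ` \<N>)"
  proof (rule irreducibly_faithfulI[OF GNS_irreducible[OF ext]])
    fix x assume "x \<in> y ` \<N>"
    then have x: "x \<in> carrier G" "\<phi> x \<noteq> 1"
      using y yG by auto
    show "GNS_rep x \<noteq> (\<lambda>v\<in>carrier GNS_space. v)"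
    proof
      assume "GNS_rep x = (\<lambda>v\<in>carrier GNS_space. v)"
      then have "GNS_rep x GNS_vector = GNS_vector"
        using GNS_vector_carrier by simp
      moreover have "GNS_rep \<one> GNS_vector = GNS_vector"
        by (rule GNS_rep_one[OF GNS_vector_carrier])
      ultimately show False
        using GNS_coefficient[OF x(1)] GNS_coefficient[OF one_closed] x(2) state
        by (simp add: states_def)
    qed
  qed (use yG in auto)
  moreover have "y N \<noteq> \<one>" if "N \<in> \<N>" for N
    using y[OF that] state by (auto simp: states_def)
  ultimately show ?thesis
    unfolding separates_def using y yG by (intro exI[of _ "y ` \<N>"]) blast
qed

end

section \<open>Eigenvectors of finite abelian subgroups\<close>

lemma (in group) subgroup_pow_card_eq_1:
  assumes S: "subgroup S G" and x: "x \<in> S"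
  shows "x [^] card S = \<one>"
proof -
  interpret SG: group "G\<lparr>carrier := S\<rparr>"
    by (rule subgroup.subgroup_is_group[OF S is_group])
  have "x [^]\<^bsub>G\<lparr>carrier := S\<rparr>\<^esub> order (G\<lparr>carrier := S\<rparr>) = \<one>\<^bsub>G\<lparr>carrier := S\<rparr>\<^esub>"
    using x by (intro SG.pow_order_eq_1) simp
  then show ?thesis
    by (simp add: order_def nat_pow_consistent[symmetric])
qed

context irreducible_unitary_representation
begin

lemma rep_zero [simp]: "g \<in> carrier G \<Longrightarrow> \<pi> g \<zero>\<^bsub>H\<^esub> = \<zero>\<^bsub>H\<^esub>"
  using rep_smult[of g "\<zero>\<^bsub>H\<^esub>" 0] by (simp add: smult_l_null[simplified])

lemma rep_minus: "g \<in> carrier G \<Longrightarrow> x \<in> carrier H \<Longrightarrow> \<pi> g (\<ominus>\<^bsub>H\<^esub> x) = \<ominus>\<^bsub>H\<^esub> \<pi> g x"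
  using rep_smult[of g x "- 1"] by (simp add: smult_minus1)

text \<open>The vectors fixed by a normal subgroup form a closed invariant subspace, which
  irreducibility makes zero as soon as one element of the subgroup acts nontrivially.\<close>

lemma normal_subgroup_moves_vectors:
  assumes N: "N \<lhd> G" and y: "y \<in> N" "\<pi> y \<noteq> (\<lambda>v\<in>carrier H. v)"
    and v: "v \<in> carrier H" "v \<noteq> \<zero>\<^bsub>H\<^esub>"
  obtains a where "a \<in> N" "\<pi> a v \<noteq> v"
proof -
  interpret N: normal N G by (rule N)
  interpret met: Metric_space "carrier H" "hdist H" by (rule metric_hdist)
  define W where "W = {x \<in> carrier H. \<forall>a\<in>N. \<pi> a x = x}"
  have "submodule W complex_ring H"
    by (rule submoduleI) (auto simp: W_def rep_minus rep_add rep_smult)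
  moreover have "closedin met.mtopology W"
    unfolding met.closedin_metric
  proof (intro conjI allI impI)
    fix x assume "x \<in> carrier H - W"
    then obtain a where x: "x \<in> carrier H" and a: "a \<in> N" "\<pi> a x \<noteq> x"
      by (auto simp: W_def)
    have aG: "a \<in> carrier G"
      using a(1) by simp
    define z where "z = \<pi> a x \<ominus>\<^bsub>H\<^esub> x"
    have z: "z \<in> carrier H" "z \<noteq> \<zero>\<^bsub>H\<^esub>"
      using x a aG by (auto simp: z_def diff_eq_zero_iff)
    \<comment> \<open>Pairing w with \<open>u\<close> is pairing \<pi>(a) w - w with
      \<open>z\<close>. It vanishes for fixed vectors w, and at \<open>x\<close> it is the square
      norm of \<open>z\<close>.\<close>
    define u where "u = \<pi> (inv\<^bsub>G\<^esub> a) z \<ominus>\<^bsub>H\<^esub> z"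
    have u: "u \<in> carrier H"
      unfolding u_def using z aG by simp
    have cinner_u: "cinner H w u = cinner H (\<pi> a w \<ominus>\<^bsub>H\<^esub> w) z" if "w \<in> carrier H" for w
      unfolding u_def using that z(1) aG by (simp add: cinner_simps cinner_rep_left)
    have "cinner H x u \<noteq> 0"
      using cinner_u[OF x] z by (simp add: cinner_self_eq_0_iff flip: z_def)
    from continuous_cinner_left[OF x u this] obtain r where r: "r > 0"
      "\<And>w. w \<in> carrier H \<Longrightarrow> hdist H x w < r \<Longrightarrow> cinner H w u \<noteq> 0"
      by metis
    have "cinner H w u = 0" if "w \<in> W" for w
    proof -
      have "w \<in> carrier H" "\<pi> a w = w"
        using that a(1) by (auto simp: W_def)
      then show ?thesis
        using cinner_u[of w] z(1) diff_eq_zero_iff[of w w] by (simp add: cinner_zero_left)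
    qed
    then show "\<exists>r>0. disjnt W (met.mball x r)"
      using r by (intro exI[of _ r]) (auto simp: disjnt_iff)
  qed (auto simp: W_def)
  moreover have "\<pi> g ` W \<subseteq> W" if g: "g \<in> carrier G" for g
  proof -
    have "\<pi> a (\<pi> g x) = \<pi> g x" if x: "x \<in> W" and a: "a \<in> N" for x a
    proof -
      have c: "x \<in> carrier H" "a \<in> carrier G"
        using x a by (auto simp: W_def)
      define b where "b = inv\<^bsub>G\<^esub> g \<otimes>\<^bsub>G\<^esub> a \<otimes>\<^bsub>G\<^esub> g"
      have b: "b \<in> N" "b \<in> carrier G"
        unfolding b_def using N.inv_op_closed1[OF g a] g c by auto
      have "a \<otimes>\<^bsub>G\<^esub> g = g \<otimes>\<^bsub>G\<^esub> b"
        unfolding b_def using g c by (simp add: G.m_assoc[symmetric])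
      then have "\<pi> a (\<pi> g x) = \<pi> g (\<pi> b x)"
        using composition_rule[OF c(1) c(2) g] composition_rule[OF c(1) g b(2)] by simp
      then show ?thesis
        using x b by (simp add: W_def)
    qed
    then show ?thesis
      using g by (auto simp: W_def)
  qed
  ultimately have "W = {\<zero>\<^bsub>H\<^esub>} \<or> W = carrier H"
    by (rule irreducible)
  moreover have "W \<noteq> carrier H"
  proof
    assume "W = carrier H"
    then have "\<pi> y x = x" if "x \<in> carrier H" for x
      using y(1) that by (auto simp: W_def)
    moreover have "y \<in> carrier G"
      using y(1) by simp
    ultimately have "\<pi> y = (\<lambda>v\<in>carrier H. v)"
      using bij_prop0[of y] by (intro extensionalityI[of _ "carrier H"]) (auto simp: Bij_def)
    with y(2) show False by simp
  qed
  ultimately have "v \<notin> W"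
    using v by auto
  then show thesis
    using that v by (auto simp: W_def)
qed

text \<open>The space may have infinite dimension, so v is chosen nonzero with as many elements of
  \<open>V\<close> as possible acting on it by scalars. For any b in \<open>V\<close>, projecting v
  to a suitable eigenspace of b keeps those elements and adds b, so maximality gives all of
  \<open>V\<close>.\<close>

lemma exists_eigenvector:
  assumes V: "subgroup V G" "finite V" and comm: "\<And>a b. a \<in> V \<Longrightarrow> b \<in> V \<Longrightarrow> a \<otimes>\<^bsub>G\<^esub> b = b \<otimes>\<^bsub>G\<^esub> a"
  obtains v where "v \<in> carrier H" "v \<noteq> \<zero>\<^bsub>H\<^esub>" "\<And>g. g \<in> V \<Longrightarrow> \<exists>l. \<pi> g v = l \<odot>\<^bsub>H\<^esub> v"
proof -
  interpret V: subgroup V G by (rule V)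
  define E where "E v = {g \<in> V. \<exists>l. \<pi> g v = l \<odot>\<^bsub>H\<^esub> v}" for v
  define S where "S = {v \<in> carrier H. v \<noteq> \<zero>\<^bsub>H\<^esub>}"
  obtain v0 where "v0 \<in> S"
    using nonzero M.zero_closed by (auto simp: S_def)
  moreover have "card (E v) \<le> card V" for v
    by (intro card_mono V(2)) (auto simp: E_def)
  ultimately have "\<exists>v. v \<in> S \<and> (\<forall>u. u \<in> S \<longrightarrow> card (E u) \<le> card (E v))"
    by (intro ex_has_greatest_nat[of _ v0 _ "Suc (card V)"]) (simp_all add: less_Suc_eq_le)
  then obtain v where v: "v \<in> S" and max: "\<And>u. u \<in> S \<Longrightarrow> card (E u) \<le> card (E v)"
    by blast
  have vH: "v \<in> carrier H" "v \<noteq> \<zero>\<^bsub>H\<^esub>"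
    using v by (auto simp: S_def)
  have "b \<in> E v" if b: "b \<in> V" for b
  proof -
    have bG: "b \<in> carrier G"
      using b by simp
    define r where "r = card V"
    have r: "r > 0"
      unfolding r_def using b V(2) by (auto simp: card_gt_0_iff)
    have "b [^]\<^bsub>G\<^esub> r = \<one>\<^bsub>G\<^esub>"
      unfolding r_def by (rule G.subgroup_pow_card_eq_1[OF V(1) b])
    define s where "s z = rec_nat \<zero>\<^bsub>H\<^esub> (\<lambda>n x. x \<oplus>\<^bsub>H\<^esub> (1 / z) ^ n \<odot>\<^bsub>H\<^esub> \<pi> (b [^]\<^bsub>G\<^esub> n) v)" for z :: complex
    have s_simps: "s z 0 = \<zero>\<^bsub>H\<^esub>" "s z (Suc n) = s z n \<oplus>\<^bsub>H\<^esub> (1 / z) ^ n \<odot>\<^bsub>H\<^esub> \<pi> (b [^]\<^bsub>G\<^esub> n) v" for z n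
      by (simp_all add: s_def)
    have s_carrier [simp]: "s z n \<in> carrier H" for z n
      by (induction n) (use bG vH in \<open>simp_all add: s_simps\<close>)
    have s_cinner: "cinner H (s z n) v = (\<Sum>i<n. cinner H (\<pi> (b [^]\<^bsub>G\<^esub> i) v) v * (1 / z) ^ i)" for z n
      by (induction n) (use bG vH in \<open>simp_all add: s_simps cinner_zero_left cinner_simps mult.commute\<close>)
    obtain m where m: "r = Suc m"
      using r by (cases r) auto
    \<comment> \<open>The pairings of v with its projections are values of a polynomial of degree
      below r with constant term <v, v>. It is not zero and cannot vanish at all r roots of
      unity.\<close>
    have "\<exists>w. w ^ r = 1 \<and> (\<Sum>i<r. cinner H (\<pi> (b [^]\<^bsub>G\<^esub> i) v) v * w ^ i) \<noteq> 0"
    proof (rule ccontr)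
      assume "\<not> ?thesis"
      then have sub: "{w::complex. w ^ r = 1} \<subseteq> {w. (\<Sum>i\<le>m. cinner H (\<pi> (b [^]\<^bsub>G\<^esub> i) v) v * w ^ i) = 0}"
        by (auto simp: m lessThan_Suc_atMost)
      have "cinner H (\<pi> (b [^]\<^bsub>G\<^esub> (0::nat)) v) v \<noteq> 0"
        using vH by (simp add: cinner_self_eq_0_iff)
      then have "\<exists>k\<le>m. cinner H (\<pi> (b [^]\<^bsub>G\<^esub> k) v) v \<noteq> 0"
        by blast
      from polyfun_rootbound[OF this] have "card {w::complex. w ^ r = 1} \<le> m"
        using card_mono[OF _ sub] by simp
      then show False
        using card_roots_unity_eq[of r] r by (simp add: m)
    qed
    then obtain w where w: "w ^ r = 1" "(\<Sum>i<r. cinner H (\<pi> (b [^]\<^bsub>G\<^esub> i) v) v * w ^ i) \<noteq> 0"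
      by blast
    define z where "z = 1 / w"
    have "w \<noteq> 0"
      using w(1) r by (auto simp: power_0_left)
    then have z: "z \<noteq> 0" "1 / z = w"
      by (auto simp: z_def)
    define u where "u = s z r"
    have "cinner H u v \<noteq> 0"
      unfolding u_def s_cinner z(2) by (rule w(2))
    then have uS: "u \<in> S"
      using vH by (auto simp: S_def u_def cinner_zero_left)
    \<comment> \<open>Applying b shifts the index of the partial sum. At n = r the new last term is
      v itself, because b and w both have r-th power 1, and so u is an eigenvector.\<close>
    have shift: "\<pi> b (s z n) \<oplus>\<^bsub>H\<^esub> z \<odot>\<^bsub>H\<^esub> v = z \<odot>\<^bsub>H\<^esub> s z (Suc n)" for n :: nat
    proof (induction n)
      case 0
      show ?case
        using bG vH smult_one[of v] by (simp add: s_simps)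
    next
      case (Suc n)
      have pow: "\<pi> b (\<pi> (b [^]\<^bsub>G\<^esub> n) v) = \<pi> (b [^]\<^bsub>G\<^esub> Suc n) v"
        using bG vH composition_rule[of v b "b [^]\<^bsub>G\<^esub> n"] by (metis G.nat_pow_Suc2 G.nat_pow_closed)
      have "\<pi> b (s z (Suc n)) \<oplus>\<^bsub>H\<^esub> z \<odot>\<^bsub>H\<^esub> v =
          (\<pi> b (s z n) \<oplus>\<^bsub>H\<^esub> z \<odot>\<^bsub>H\<^esub> v) \<oplus>\<^bsub>H\<^esub> (1 / z) ^ n \<odot>\<^bsub>H\<^esub> \<pi> (b [^]\<^bsub>G\<^esub> Suc n) v"
        using bG vH by (simp add: s_simps(2)[of z n] rep_add rep_smult pow M.a_ac del: G.nat_pow_Suc)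
      also have "(1 / z) ^ n \<odot>\<^bsub>H\<^esub> \<pi> (b [^]\<^bsub>G\<^esub> Suc n) v = z \<odot>\<^bsub>H\<^esub> ((1 / z) ^ Suc n \<odot>\<^bsub>H\<^esub> \<pi> (b [^]\<^bsub>G\<^esub> Suc n) v)"
        using bG vH z(1) smult_assoc1[of z "(1 / z) ^ Suc n" "\<pi> (b [^]\<^bsub>G\<^esub> Suc n) v"] by simp
      also have "(\<pi> b (s z n) \<oplus>\<^bsub>H\<^esub> z \<odot>\<^bsub>H\<^esub> v) \<oplus>\<^bsub>H\<^esub> \<dots> = z \<odot>\<^bsub>H\<^esub> s z (Suc (Suc n))"
        unfolding Suc s_simps(2)[of z "Suc n"]
        using bG vH by (intro smult_r_distr[symmetric]) simp_all
      finally show ?case .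
    qed
    have "s z (Suc r) = u \<oplus>\<^bsub>H\<^esub> v"
      using w(1) z(2) \<open>b [^]\<^bsub>G\<^esub> r = \<one>\<^bsub>G\<^esub>\<close> vH smult_one[of v] by (simp add: s_simps u_def)
    then have "\<pi> b u \<oplus>\<^bsub>H\<^esub> z \<odot>\<^bsub>H\<^esub> v = z \<odot>\<^bsub>H\<^esub> u \<oplus>\<^bsub>H\<^esub> z \<odot>\<^bsub>H\<^esub> v"
      using shift[of r] vH smult_r_distr[of z u v] by (simp add: u_def)
    then have "\<pi> b u = z \<odot>\<^bsub>H\<^esub> u"
      using bG vH by (simp add: u_def)
    then have bu: "b \<in> E u"
      using b by (auto simp: E_def)
    \<comment> \<open>Since \<open>V\<close> is abelian, g acts by the same scalar on v and on its
      images under powers of b, hence on u.\<close>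
    have "E v \<subseteq> E u"
    proof
      fix g assume "g \<in> E v"
      then obtain l where g: "g \<in> V" "\<pi> g v = l \<odot>\<^bsub>H\<^esub> v"
        by (auto simp: E_def)
      have gG: "g \<in> carrier G"
        using g by simp
      have "\<pi> g (\<pi> (b [^]\<^bsub>G\<^esub> n) v) = l \<odot>\<^bsub>H\<^esub> \<pi> (b [^]\<^bsub>G\<^esub> n) v" for n :: nat
      proof -
        have "b [^]\<^bsub>G\<^esub> n \<in> V"
          by (induction n) (use b in simp_all)
        then have "g \<otimes>\<^bsub>G\<^esub> b [^]\<^bsub>G\<^esub> n = b [^]\<^bsub>G\<^esub> n \<otimes>\<^bsub>G\<^esub> g"
          by (rule comm[OF g(1)])
        then have "\<pi> g (\<pi> (b [^]\<^bsub>G\<^esub> n) v) = \<pi> (b [^]\<^bsub>G\<^esub> n) (\<pi> g v)"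
          using bG gG vH composition_rule[of v g "b [^]\<^bsub>G\<^esub> n"] composition_rule[of v "b [^]\<^bsub>G\<^esub> n" g] by simp
        then show ?thesis
          using g bG vH by (simp add: rep_smult)
      qed
      then have "\<pi> g (s z n) = l \<odot>\<^bsub>H\<^esub> s z n" for n :: nat
      proof (induction n)
        case (Suc n)
        have "l \<odot>\<^bsub>H\<^esub> ((1 / z) ^ n \<odot>\<^bsub>H\<^esub> x) = (1 / z) ^ n \<odot>\<^bsub>H\<^esub> (l \<odot>\<^bsub>H\<^esub> x)" if "x \<in> carrier H" for x
          using that smult_assoc1[of l "(1 / z) ^ n" x] smult_assoc1[of "(1 / z) ^ n" l x]
          by (simp add: mult.commute)
        then show ?case
          using Suc gG bG vH smult_r_distr[of l "s z n" "(1 / z) ^ n \<odot>\<^bsub>H\<^esub> \<pi> (b [^]\<^bsub>G\<^esub> n) v"]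
          by (simp add: s_simps rep_add rep_smult)
      qed (use gG smult_r_null in \<open>simp add: s_simps\<close>)
      then show "g \<in> E u"
        using g(1) by (auto simp: E_def u_def)
    qed
    moreover have "finite (E u)"
      using V(2) by (simp add: E_def)
    ultimately have "E v = E u"
      using max[OF uS] by (intro card_seteq) auto
    then show ?thesis
      using bu by simp
  qed
  then show thesis
    using that vH by (auto simp: E_def)
qed

end

text \<open>The eigenvalues on a common eigenvector form a character. Each member of the family
  moves every nonzero vector, in particular the eigenvector.\<close>

lemma (in group) character_if_separates:
  assumes sep: "separates G \<N>" and V: "subgroup V G" "finite V"
    and comm: "\<And>a b. a \<in> V \<Longrightarrow> b \<in> V \<Longrightarrow> a \<otimes> b = b \<otimes> a"
    and \<N>: "\<And>N. N \<in> \<N> \<Longrightarrow> N \<lhd> G \<and> N \<subseteq> V"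
  obtains \<theta> where "character G V \<theta>" "\<And>N. N \<in> \<N> \<Longrightarrow> \<exists>a\<in>N. \<theta> a \<noteq> 1"
proof -
  obtain F where F: "irreducibly_faithful G F" "\<And>N. N \<in> \<N> \<Longrightarrow> \<exists>y\<in>F \<inter> N. y \<noteq> \<one>"
    using sep by (auto simp: separates_def)
  then obtain H :: "('a \<Rightarrow> complex) inner_module" and \<pi>
    where irr: "irreducible_unitary_representation G H \<pi>"
      and faithful: "\<And>x. x \<in> F \<Longrightarrow> x \<noteq> \<one> \<Longrightarrow> \<pi> x \<noteq> (\<lambda>v\<in>carrier H. v)"
    unfolding irreducibly_faithful_def by blast
  interpret irreducible_unitary_representation G H \<pi> by (rule irr)
  interpret V: subgroup V G by (rule V)
  obtain v where v: "v \<in> carrier H" "v \<noteq> \<zero>\<^bsub>H\<^esub>" "\<And>g. g \<in> V \<Longrightarrow> \<exists>l. \<pi> g v = l \<odot>\<^bsub>H\<^esub> v"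
    using exists_eigenvector[OF V comm] by metis
  then obtain \<theta> where \<theta>: "\<And>g. g \<in> V \<Longrightarrow> \<pi> g v = \<theta> g \<odot>\<^bsub>H\<^esub> v"
    by metis
  have vv: "cinner H v v \<noteq> 0"
    using v by (simp add: cinner_self_eq_0_iff)
  have "character G V \<theta>"
    unfolding character_def
  proof (intro conjI ballI)
    fix a assume a: "a \<in> V"
    have "\<theta> a * cnj (\<theta> a) * cinner H v v = cinner H v v"
      using rep_cinner[of a v v] a v(1) by (simp add: \<theta> cinner_simps mult.commute[of "cnj (\<theta> a)"])
    then have "of_real ((cmod (\<theta> a))\<^sup>2) = (1::complex)"
      using vv by (simp add: complex_norm_square del: of_real_power)
    then have "(cmod (\<theta> a))\<^sup>2 = 1"
      by (simp only: of_real_eq_1_iff)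
    then show "cmod (\<theta> a) = 1"
      by (simp add: power2_eq_1_iff) (metis norm_ge_zero not_one_le_zero neg_0_le_iff_le)
    fix b assume b: "b \<in> V"
    have "\<theta> (a \<otimes> b) \<odot>\<^bsub>H\<^esub> v = \<pi> a (\<pi> b v)"
      using a b v(1) composition_rule[of v a b] by (simp flip: \<theta>)
    also have "\<dots> = (\<theta> b * \<theta> a) \<odot>\<^bsub>H\<^esub> v"
      using a b v(1) smult_assoc1[of "\<theta> b" "\<theta> a" v] by (simp add: \<theta> rep_smult)
    finally have "cinner H (\<theta> (a \<otimes> b) \<odot>\<^bsub>H\<^esub> v) v = cinner H ((\<theta> b * \<theta> a) \<odot>\<^bsub>H\<^esub> v) v"
      by simp
    then show "\<theta> (a \<otimes> b) = \<theta> a * \<theta> b"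
      using v(1) vv by (simp add: cinner_simps)
  qed
  moreover have "\<exists>a\<in>N. \<theta> a \<noteq> 1" if N: "N \<in> \<N>" for N
  proof -
    obtain y where y: "y \<in> F" "y \<in> N" "y \<noteq> \<one>"
      using F(2)[OF N] by blast
    obtain a where a: "a \<in> N" "\<pi> a v \<noteq> v"
      using normal_subgroup_moves_vectors[of N y v] \<N>[OF N] y faithful v by metis
    then have "\<theta> a \<noteq> 1"
      using \<N>[OF N] \<theta>[of a] v(1) smult_one[of v] by auto
    with a show ?thesis by blast
  qed
  ultimately show thesis
    by (rule that)
qed

section \<open>Minimal normal subgroups\<close>

context group
begin

definition minimal_normal :: "'a set \<Rightarrow> bool" where
  "minimal_normal N \<longleftrightarrow> N \<lhd> G \<and> N \<noteq> {\<one>} \<and> (\<forall>K. K \<lhd> G \<and> K \<subseteq> N \<longrightarrow> K = {\<one>} \<or> K = N)"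

definition commuting :: "'a set \<Rightarrow> bool" where
  "commuting N \<longleftrightarrow> (\<forall>a\<in>N. \<forall>b\<in>N. a \<otimes> b = b \<otimes> a)"

lemma minimal_normalD:
  assumes "minimal_normal N"
  shows "N \<lhd> G" "N \<noteq> {\<one>}" "\<And>K. K \<lhd> G \<Longrightarrow> K \<subseteq> N \<Longrightarrow> K = {\<one>} \<or> K = N"
  using assms by (auto simp: minimal_normal_def)

lemma normal_conj:
  assumes "N \<lhd> G" "a \<in> N" "g \<in> carrier G"
  shows "g \<otimes> a \<otimes> inv g \<in> N"
  by (rule normal.inv_op_closed2[OF assms(1,3,2)])

lemma conj_mult:
  assumes "g \<in> carrier G" "a \<in> carrier G" "b \<in> carrier G"
  shows "(g \<otimes> a \<otimes> inv g) \<otimes> (g \<otimes> b \<otimes> inv g) = g \<otimes> (a \<otimes> b) \<otimes> inv g"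
proof -
  have "(g \<otimes> a \<otimes> inv g) \<otimes> (g \<otimes> b \<otimes> inv g) = g \<otimes> a \<otimes> (inv g \<otimes> g) \<otimes> b \<otimes> inv g"
    using assms by (simp only: m_assoc m_closed inv_closed)
  then show ?thesis
    using assms by (simp add: m_assoc)
qed

lemma normal_carrier: "N \<lhd> G \<Longrightarrow> a \<in> N \<Longrightarrow> a \<in> carrier G"
  by (meson normal_imp_subgroup subgroup.mem_carrier)

lemma normal_one: "N \<lhd> G \<Longrightarrow> \<one> \<in> N"
  by (meson normal_imp_subgroup subgroup.one_closed)

lemma normal_mult: "N \<lhd> G \<Longrightarrow> a \<in> N \<Longrightarrow> b \<in> N \<Longrightarrow> a \<otimes> b \<in> N"
  by (meson normal_imp_subgroup subgroup.m_closed)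

lemma normal_inv: "N \<lhd> G \<Longrightarrow> a \<in> N \<Longrightarrow> inv a \<in> N"
  by (meson normal_imp_subgroup subgroup.m_inv_closed)

lemma normal_Int: "N \<lhd> G \<Longrightarrow> K \<lhd> G \<Longrightarrow> N \<inter> K \<lhd> G"
  by (rule normal_subgroup_intersect)

lemma set_multI: "a \<in> A \<Longrightarrow> b \<in> B \<Longrightarrow> a \<otimes> b \<in> A <#> B"
  by (auto simp: set_mult_def)

lemma set_mult_normal:
  assumes "N \<lhd> G" "K \<lhd> G"
  shows "N <#> K \<lhd> G" "N \<subseteq> N <#> K" "K \<subseteq> N <#> K"
proof -
  show "N <#> K \<lhd> G"
    using assms by (rule normal_subgroup_set_mult_closed)
  show "N \<subseteq> N <#> K"
    using set_multI[of _ N \<one> K] normal_one[OF assms(2)] normal_carrier[OF assms(1)] by force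
  show "K \<subseteq> N <#> K"
    using set_multI[of \<one> N _ K] normal_one[OF assms(1)] normal_carrier[OF assms(2)] by force
qed

lemma finite_set_mult: "finite A \<Longrightarrow> finite B \<Longrightarrow> finite (A <#> B)"
  by (simp add: set_mult_def)

lemma set_mult_least:
  assumes "L \<lhd> G" "N \<subseteq> L" "K \<subseteq> L"
  shows "N <#> K \<subseteq> L"
  using assms normal_mult[OF assms(1)] by (auto simp: set_mult_def)

lemma normal_commute:
  assumes N: "N \<lhd> G" and K: "K \<lhd> G" and triv: "N \<inter> K = {\<one>}" and a: "a \<in> N" and b: "b \<in> K"
  shows "a \<otimes> b = b \<otimes> a"
proof -
  have c: "a \<in> carrier G" "b \<in> carrier G"
    using normal_carrier N K a b by blast+
  have "a \<otimes> b \<otimes> inv a \<otimes> inv b \<in> K"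
    using normal_mult[OF K normal_conj[OF K b c(1)] normal_inv[OF K b]] .
  moreover have "a \<otimes> (b \<otimes> inv a \<otimes> inv b) \<in> N"
    using normal_mult[OF N a normal_conj[OF N normal_inv[OF N a] c(2)]] .
  then have "a \<otimes> b \<otimes> inv a \<otimes> inv b \<in> N"
    using c by (simp add: m_assoc)
  ultimately have "a \<otimes> b \<otimes> inv a \<otimes> inv b = \<one>"
    using triv by blast
  then have "a \<otimes> b \<otimes> inv (b \<otimes> a) = \<one>"
    using c by (simp add: m_assoc inv_mult_group)
  then show ?thesis
    using c by (metis inv_closed inv_equality inv_inv m_closed)
qed

lemma exists_minimal_normal:
  assumes "N \<lhd> G" "finite N" "N \<noteq> {\<one>}"
  obtains M where "minimal_normal M" "M \<subseteq> N"
proof -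
  have "\<exists>M. minimal_normal M \<and> M \<subseteq> N"
    using assms
  proof (induction "card N" arbitrary: N rule: less_induct)
    case less
    show ?case
    proof (cases "minimal_normal N")
      case False
      then obtain K where K: "K \<lhd> G" "K \<subseteq> N" "K \<noteq> {\<one>}" "K \<noteq> N"
        using less.prems unfolding minimal_normal_def by blast
      then have "card K < card N" "finite K"
        using less.prems(2) by (auto intro: psubset_card_mono finite_subset)
      then show ?thesis
        using less.hyps[of K] K by blast
    qed auto
  qed
  then show thesis using that by blast
qed

lemma minimal_normal_Int:
  assumes "minimal_normal M" "K \<lhd> G"
  shows "M \<inter> K = {\<one>} \<or> M \<subseteq> K"
  using minimal_normalD(3)[OF assms(1) normal_Int[OF minimal_normalD(1)[OF assms(1)] assms(2)]] by blast

lemma minimal_normal_disjoint: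
  assumes "minimal_normal M" "minimal_normal N" "M \<noteq> N"
  shows "M \<inter> N = {\<one>}"
  using minimal_normal_Int[OF assms(1) minimal_normalD(1)[OF assms(2)]]
    minimal_normalD(3)[OF assms(2) minimal_normalD(1)[OF assms(1)]]
    minimal_normalD(2)[OF assms(1)] assms(3) by blast

abbreviation join :: "'a set set \<Rightarrow> 'a set" where
  "join \<N> \<equiv> generate G (\<Union>\<N>)"

lemma join_normal:
  assumes "\<And>N. N \<in> \<N> \<Longrightarrow> N \<lhd> G"
  shows "join \<N> \<lhd> G"
proof (rule normal_generateI)
  show "\<Union>\<N> \<subseteq> carrier G"
    using assms normal_carrier by blast
  show "g \<otimes> h \<otimes> inv g \<in> \<Union>\<N>" if "h \<in> \<Union>\<N>" "g \<in> carrier G" for h g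
    using that assms normal_conj by blast
qed

lemma join_upper: "N \<in> \<N> \<Longrightarrow> N \<subseteq> join \<N>"
  by (auto intro: generate.incl)

lemma join_least: "K \<lhd> G \<Longrightarrow> (\<And>N. N \<in> \<N> \<Longrightarrow> N \<subseteq> K) \<Longrightarrow> join \<N> \<subseteq> K"
  by (intro generate_subgroup_incl normal_imp_subgroup) auto

lemma join_insert:
  assumes "N \<lhd> G" "\<And>K. K \<in> \<N> \<Longrightarrow> K \<lhd> G"
  shows "join (insert N \<N>) = N <#> join \<N>"
proof
  have J: "join \<N> \<lhd> G"
    by (rule join_normal) (rule assms(2))
  show "join (insert N \<N>) \<subseteq> N <#> join \<N>"
    using set_mult_normal[OF assms(1) J] join_upper by (intro join_least) blast+
  show "N <#> join \<N> \<subseteq> join (insert N \<N>)"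
  proof (rule set_mult_least)
    show "join (insert N \<N>) \<lhd> G"
      by (rule join_normal) (use assms in auto)
    show "N \<subseteq> join (insert N \<N>)"
      by (rule join_upper) simp
    show "join \<N> \<subseteq> join (insert N \<N>)"
      by (rule mono_generate) auto
  qed
qed

lemma join_finite:
  assumes "finite \<N>" "\<And>N. N \<in> \<N> \<Longrightarrow> N \<lhd> G \<and> finite N"
  shows "finite (join \<N>)"
  using assms
proof (induction \<N> rule: finite_induct)
  case (insert N \<N>)
  then show ?case
    by (subst join_insert) (auto intro: finite_set_mult)
qed (simp add: generate_empty)

lemma commute_generate:
  assumes "S \<subseteq> carrier G" "a \<in> carrier G" "\<And>s. s \<in> S \<Longrightarrow> a \<otimes> s = s \<otimes> a" "b \<in> generate G S"
  shows "a \<otimes> b = b \<otimes> a"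
  using assms(4)
proof (induction rule: generate.induct)
  case (inv h)
  then have h: "h \<in> carrier G" "a \<otimes> h = h \<otimes> a"
    using assms by auto
  have "inv h \<otimes> (h \<otimes> a) \<otimes> inv h = inv h \<otimes> (a \<otimes> h) \<otimes> inv h"
    by (simp add: h)
  moreover have "inv h \<otimes> (h \<otimes> a) \<otimes> inv h = a \<otimes> inv h"
    using h(1) assms(2) by (simp add: m_assoc[symmetric])
  moreover have "inv h \<otimes> (a \<otimes> h) \<otimes> inv h = inv h \<otimes> a"
    using h(1) assms(2) by (simp add: m_assoc)
  ultimately show ?case by simp
next
  case (eng h k)
  then have c: "h \<in> carrier G" "k \<in> carrier G"
    using generate_in_carrier[OF assms(1)] by auto
  have "a \<otimes> (h \<otimes> k) = (a \<otimes> h) \<otimes> k"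
    using c assms(2) by (simp add: m_assoc)
  also have "\<dots> = h \<otimes> (a \<otimes> k)"
    using c assms(2) by (simp add: eng.IH(1) m_assoc)
  also have "\<dots> = (h \<otimes> k) \<otimes> a"
    using c assms(2) by (simp add: eng.IH(2) m_assoc)
  finally show ?case .
qed (use assms in auto)

lemma minimal_normal_commute_join:
  assumes N: "minimal_normal N" and \<K>: "\<And>K. K \<in> \<K> \<Longrightarrow> minimal_normal K \<and> K \<noteq> N"
    and a: "a \<in> N" and b: "b \<in> join \<K>"
  shows "a \<otimes> b = b \<otimes> a"
proof (rule commute_generate[OF _ _ _ b])
  show "\<Union>\<K> \<subseteq> carrier G"
    using \<K> minimal_normalD(1) normal_carrier by blast
  show "a \<in> carrier G"
    using a minimal_normalD(1)[OF N] normal_carrier by blast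
  show "a \<otimes> s = s \<otimes> a" if s: "s \<in> \<Union>\<K>" for s
  proof -
    obtain K where K: "K \<in> \<K>" "s \<in> K"
      using s by blast
    have mn: "minimal_normal K" "N \<noteq> K"
      using \<K>[OF K(1)] by auto
    show ?thesis
      by (rule normal_commute[OF minimal_normalD(1)[OF N] minimal_normalD(1)[OF mn(1)]
            minimal_normal_disjoint[OF N mn] a K(2)])
  qed
qed

lemma commuting_join:
  assumes "\<And>N. N \<in> \<N> \<Longrightarrow> minimal_normal N \<and> commuting N"
  shows "commuting (join \<N>)"
proof -
  have S: "\<Union>\<N> \<subseteq> carrier G"
    using assms minimal_normalD(1) normal_carrier by blast
  have *: "s \<otimes> t = t \<otimes> s" if st: "s \<in> \<Union>\<N>" "t \<in> \<Union>\<N>" for s t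
  proof -
    obtain M N where M: "M \<in> \<N>" "s \<in> M" and N: "N \<in> \<N>" "t \<in> N"
      using st by blast
    show ?thesis
    proof (cases "M = N")
      case True
      then show ?thesis
        using M N assms[OF N(1)] by (simp add: commuting_def)
    next
      case False
      have mn: "minimal_normal M" "minimal_normal N"
        using assms M N by simp_all
      show ?thesis
        by (rule normal_commute[OF minimal_normalD(1)[OF mn(1)] minimal_normalD(1)[OF mn(2)]
              minimal_normal_disjoint[OF mn False] M(2) N(2)])
    qed
  qed
  have 1: "s \<otimes> b = b \<otimes> s" if "s \<in> \<Union>\<N>" "b \<in> join \<N>" for s b
    using that S by (intro commute_generate[OF S _ _ that(2)] *) auto
  show ?thesis
    unfolding commuting_def
  proof (intro ballI)
    fix a b assume a: "a \<in> join \<N>" and b: "b \<in> join \<N>"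
    show "a \<otimes> b = b \<otimes> a"
    proof (rule commute_generate[OF S _ _ b])
      show "a \<in> carrier G"
        by (rule generate_in_carrier[OF S a])
      show "a \<otimes> s = s \<otimes> a" if "s \<in> \<Union>\<N>" for s
        by (rule 1[OF that a, symmetric])
    qed
  qed
qed

text \<open>Distinct minimal normal subgroups commute elementwise, so \<open>N\<close> commutes with
  the join of the others. If it were contained in that join, it would commute with itself.\<close>

lemma minimal_normal_disjoint_join:
  assumes N: "minimal_normal N" and nc: "\<not> commuting N"
    and \<K>: "\<And>K. K \<in> \<K> \<Longrightarrow> minimal_normal K \<and> K \<noteq> N"
  shows "join \<K> \<inter> N = {\<one>}"
proof (rule ccontr)
  assume "join \<K> \<inter> N \<noteq> {\<one>}"
  moreover have "join \<K> \<lhd> G"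
    by (rule join_normal) (use \<K> minimal_normalD(1) in blast)
  ultimately have "N \<subseteq> join \<K>"
    using minimal_normal_Int[OF N] by blast
  then have "commuting N"
    unfolding commuting_def using minimal_normal_commute_join[OF N \<K>] by blast
  with nc show False by simp
qed

section \<open>Characters on products of normal subgroups\<close>

lemma direct_product_unique:
  assumes N: "N \<lhd> G" and K: "K \<lhd> G" and triv: "N \<inter> K = {\<one>}"
    and a: "a \<in> N" "a' \<in> N" and b: "b \<in> K" "b' \<in> K" and eq: "a \<otimes> b = a' \<otimes> b'"
  shows "a = a'" "b = b'"
proof -
  have c: "a \<in> carrier G" "a' \<in> carrier G" "b \<in> carrier G" "b' \<in> carrier G"
    using normal_carrier N K a b by blast+
  have "inv a' \<otimes> (a \<otimes> b) \<otimes> inv b = inv a' \<otimes> (a' \<otimes> b') \<otimes> inv b"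
    using eq by simp
  moreover have "inv a' \<otimes> (a \<otimes> b) \<otimes> inv b = inv a' \<otimes> a"
    using c by (simp add: m_assoc)
  moreover have "inv a' \<otimes> (a' \<otimes> b') \<otimes> inv b = b' \<otimes> inv b"
    using c by (simp add: m_assoc[symmetric])
  ultimately have "inv a' \<otimes> a = b' \<otimes> inv b"
    by simp
  moreover have "inv a' \<otimes> a \<in> N" "b' \<otimes> inv b \<in> K"
    using a b normal_mult normal_inv N K by auto
  ultimately have "inv a' \<otimes> a = \<one>"
    using triv by auto
  then show aa: "a = a'"
    using c by (metis inv_equality inv_inv inv_closed)
  show "b = b'"
    using eq c unfolding aa by (metis l_cancel)
qed

text \<open>Factorisations are unique and the two factors commute, so the product of the two
  characters is well defined and multiplicative. The choice \<open>p\<close> picks the first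
  factor.\<close>

lemma merge_characters:
  assumes M: "M1 \<lhd> G" "M2 \<lhd> G" "M1 \<inter> M2 = {\<one>}"
    and A1: "subgroup A1 G" "A1 \<subseteq> M1" "finite A1" "character G A1 \<theta>1"
    and A2: "subgroup A2 G" "A2 \<subseteq> M2" "finite A2" "character G A2 \<theta>2"
  obtains \<theta> where "subgroup (A1 <#> A2) G" "finite (A1 <#> A2)" "character G (A1 <#> A2) \<theta>"
    "A1 \<subseteq> A1 <#> A2" "A2 \<subseteq> A1 <#> A2" "A1 <#> A2 \<subseteq> M1 <#> M2"
    "\<And>a. a \<in> A1 \<Longrightarrow> \<theta> a = \<theta>1 a" "\<And>a. a \<in> A2 \<Longrightarrow> \<theta> a = \<theta>2 a"
proof -
  interpret A1: subgroup A1 G by (rule A1)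
  interpret A2: subgroup A2 G by (rule A2)
  note th1 = character_simps[OF A1(1,4)] and th2 = character_simps[OF A2(1,4)]
  have comm: "b \<otimes> a = a \<otimes> b" if "a \<in> A1" "b \<in> A2" for a b
    using normal_commute[OF M subsetD[OF A1(2) that(1)] subsetD[OF A2(2) that(2)]] by simp
  have unique: "a = a'" if "a \<in> A1" "a' \<in> A1" "b \<in> A2" "b' \<in> A2" "a \<otimes> b = a' \<otimes> b'" for a a' b b'
    by (rule direct_product_unique(1)[OF M _ _ _ _ that(5)]) (use that A1(2) A2(2) in auto)
  define p where "p x = (SOME a. a \<in> A1 \<and> (\<exists>b\<in>A2. x = a \<otimes> b))" for x
  have p: "p (a \<otimes> b) = a" if "a \<in> A1" "b \<in> A2" for a b
  proof -
    have "p (a \<otimes> b) \<in> A1 \<and> (\<exists>b'\<in>A2. a \<otimes> b = p (a \<otimes> b) \<otimes> b')"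
      unfolding p_def by (rule someI[of _ a]) (use that in blast)
    then show ?thesis
      using unique[of a "p (a \<otimes> b)" b] that by metis
  qed
  define \<theta> where "\<theta> x = \<theta>1 (p x) * \<theta>2 (inv (p x) \<otimes> x)" for x
  have \<theta>: "\<theta> (a \<otimes> b) = \<theta>1 a * \<theta>2 b" if "a \<in> A1" "b \<in> A2" for a b
    using that by (simp add: \<theta>_def p m_assoc[symmetric])
  have mult: "(a \<otimes> b) \<otimes> (a' \<otimes> b') = (a \<otimes> a') \<otimes> (b \<otimes> b')"
    if "a \<in> A1" "a' \<in> A1" "b \<in> A2" "b' \<in> A2" for a a' b b'
  proof -
    have "(a \<otimes> b) \<otimes> (a' \<otimes> b') = a \<otimes> (b \<otimes> a') \<otimes> b'"
      using that by (simp add: m_assoc)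
    then show ?thesis
      using that by (simp add: comm m_assoc)
  qed
  have elim: "\<exists>a\<in>A1. \<exists>b\<in>A2. x = a \<otimes> b" if "x \<in> A1 <#> A2" for x
    using that by (auto simp: set_mult_def)
  have "subgroup (A1 <#> A2) G"
  proof (rule subgroupI)
    show "A1 <#> A2 \<subseteq> carrier G"
      by (auto simp: set_mult_def)
    show "A1 <#> A2 \<noteq> {}"
      using set_multI[OF A1.one_closed A2.one_closed] by blast
    show "inv x \<in> A1 <#> A2" if x: "x \<in> A1 <#> A2" for x
    proof -
      obtain a b where ab: "a \<in> A1" "b \<in> A2" "x = a \<otimes> b"
        using elim[OF x] by blast
      then have "inv x = inv a \<otimes> inv b"
        by (simp add: inv_mult_group comm)
      then show ?thesis
        using set_multI[of "inv a" A1 "inv b" A2] ab by simp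
    qed
    show "x \<otimes> y \<in> A1 <#> A2" if x: "x \<in> A1 <#> A2" and y: "y \<in> A1 <#> A2" for x y
    proof -
      obtain a b a' b' where "a \<in> A1" "b \<in> A2" "x = a \<otimes> b" "a' \<in> A1" "b' \<in> A2" "y = a' \<otimes> b'"
        using elim[OF x] elim[OF y] by blast
      then show ?thesis
        using set_multI[of "a \<otimes> a'" A1 "b \<otimes> b'" A2] by (simp add: mult)
    qed
  qed
  moreover have "character G (A1 <#> A2) \<theta>"
    unfolding character_def
  proof (intro conjI ballI)
    fix x assume "x \<in> A1 <#> A2"
    then obtain a b where ab: "a \<in> A1" "b \<in> A2" "x = a \<otimes> b"
      using elim by blast
    then show "cmod (\<theta> x) = 1"
      by (simp add: \<theta> norm_mult th1 th2)
    fix y assume "y \<in> A1 <#> A2"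
    then obtain a' b' where ab': "a' \<in> A1" "b' \<in> A2" "y = a' \<otimes> b'"
      using elim by blast
    show "\<theta> (x \<otimes> y) = \<theta> x * \<theta> y"
      unfolding ab(3) ab'(3) mult[OF ab(1) ab'(1) ab(2) ab'(2)]
      using ab(1,2) ab'(1,2) by (simp add: \<theta> th1(3) th2(3))
  qed
  moreover have "A1 \<subseteq> A1 <#> A2" "A2 \<subseteq> A1 <#> A2"
    using set_multI[of _ A1 \<one> A2] set_multI[of \<one> A1 _ A2] by force+
  moreover have "\<theta> a = \<theta>1 a" if "a \<in> A1" for a
    using \<theta>[OF that A2.one_closed] that by (simp add: th2)
  moreover have "\<theta> a = \<theta>2 a" if "a \<in> A2" for a
    using \<theta>[OF A1.one_closed that] that by (simp add: th1)
  moreover have "A1 <#> A2 \<subseteq> M1 <#> M2"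
    using A1(2) A2(2) by (rule mono_set_mult)
  ultimately show thesis
    using that[of \<theta>] A1(3) A2(3) finite_set_mult by blast
qed

text \<open>The cyclic subgroup generated by one nontrivial element of order r has the character
  that sends the generator to a primitive r-th root of unity. It need not be normal: states are
  built from arbitrary finite subgroups.\<close>

lemma exists_cyclic_character:
  assumes N: "N \<lhd> G" "finite N" "N \<noteq> {\<one>}"
  obtains C \<theta> where "subgroup C G" "C \<subseteq> N" "finite C" "character G C \<theta>" "\<exists>a\<in>C. \<theta> a \<noteq> 1"
proof -
  obtain c where c: "c \<in> N" "c \<noteq> \<one>"
    using N(3) normal_one[OF N(1)] by blast
  have cG: "c \<in> carrier G"
    using normal_carrier[OF N(1) c(1)] .
  \<comment> \<open>Nonnegative powers already form a group, because the order of \<open>c\<close>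
    is finite.\<close>
  define C where "C = range (\<lambda>i::nat. c [^] i)"
  define r where "r = ord c"
  have "c [^] i \<in> N" for i :: nat
    by (induction i) (use c normal_one[OF N(1)] normal_mult[OF N(1)] in auto)
  then have CN: "C \<subseteq> N"
    by (auto simp: C_def)
  then have finC: "finite C"
    using N(2) finite_subset by blast
  have sub: "c [^] (j - i) = \<one>" if "i \<le> j" "c [^] i = c [^] j" for i j :: nat
  proof -
    have "c [^] i \<otimes> c [^] (j - i) = c [^] j"
      using that(1) cG by (simp add: nat_pow_mult)
    then have "c [^] i \<otimes> c [^] (j - i) = c [^] i \<otimes> \<one>"
      using that(2) cG by simp
    then show ?thesis
      using l_cancel[of "c [^] i" "c [^] (j - i)" \<one>] cG by (metis nat_pow_closed one_closed)
  qed
  have "\<not> inj (\<lambda>i::nat. c [^] i)"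
    using finC unfolding C_def by (metis finite_imageD infinite_UNIV_nat)
  then obtain i j :: nat where "i < j" "c [^] i = c [^] j"
    unfolding inj_def by (metis linorder_neqE_nat)
  then have "c [^] (j - i) = \<one>"
    by (intro sub) simp_all
  then have "r dvd j - i"
    using cG pow_eq_id by (simp add: r_def)
  then have r0: "r > 0"
    using \<open>i < j\<close> by (auto intro!: Nat.gr0I)
  have r1: "r \<noteq> 1"
    using c cG pow_eq_id[of c 1] by (auto simp: r_def)
  define z where "z = cis (2 * pi / real r)"
  have zr: "z ^ r = 1"
    unfolding z_def Complex.DeMoivre using r0 by simp
  have z1: "z \<noteq> 1"
  proof -
    have "inj_on (\<lambda>k. cis (2 * pi * real k / real r)) {..<r}"
      using Complex.bij_betw_roots_unity[OF r0] by (simp add: bij_betw_def)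
    moreover have "1 \<in> {..<r}" "0 \<in> {..<r}"
      using r0 r1 by auto
    ultimately have "cis (2 * pi * real 1 / real r) \<noteq> cis (2 * pi * real 0 / real r)"
      unfolding inj_on_def by (metis zero_neq_one)
    then show ?thesis
      by (simp add: z_def)
  qed
  have z_eq: "z ^ i = z ^ j" if "c [^] i = c [^] j" for i j :: nat
  proof -
    have *: "z ^ i = z ^ j" if "i \<le> j" "c [^] i = c [^] j" for i j :: nat
    proof -
      have "c [^] (j - i) = \<one>"
        using that by (rule sub)
      then have "r dvd j - i"
        using cG pow_eq_id by (simp add: r_def)
      then obtain k where "j - i = r * k"
        by (rule dvdE)
      then have "j = i + r * k"
        using that by simp
      then show ?thesis
        using zr by (simp add: power_add power_mult)
    qed
    show ?thesis
      using *[of i j] *[of j i] that by (metis nat_le_linear)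
  qed
  define \<theta> where "\<theta> x = z ^ (SOME i. c [^] (i::nat) = x)" for x
  have \<theta>: "\<theta> (c [^] i) = z ^ i" for i :: nat
    unfolding \<theta>_def by (rule z_eq, rule someI) (rule refl)
  have "subgroup C G"
  proof (rule subgroupI)
    show "inv x \<in> C" if x: "x \<in> C" for x
    proof -
      obtain i where i: "x = c [^] (i::nat)"
        using x by (auto simp: C_def)
      have "c [^] (r * i) = \<one>"
        using cG pow_eq_id[of c "r * i"] by (simp add: r_def)
      moreover have "i \<le> r * i"
        using r0 by simp
      ultimately have "c [^] (r * i - i) \<otimes> c [^] i = \<one>"
        using cG by (simp add: nat_pow_mult)
      then have "inv x = c [^] (r * i - i)"
        unfolding i using cG by (intro inv_equality) simp_all
      then show ?thesis
        by (simp add: C_def)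
    qed
    show "x \<otimes> y \<in> C" if "x \<in> C" "y \<in> C" for x y
      using that cG by (auto simp: C_def nat_pow_mult)
  qed (use cG in \<open>auto simp: C_def\<close>)
  moreover have "character G C \<theta>"
    unfolding character_def C_def
    by (auto simp: \<theta> nat_pow_mult cG power_add norm_power z_def)
  moreover have "\<exists>a\<in>C. \<theta> a \<noteq> 1"
    unfolding C_def using \<theta>[of 1] z1 by (intro bexI[of _ "c [^] (1::nat)"]) (simp_all only: power_one_right, blast+)
  ultimately show thesis
    using that[of C \<theta>] CN finC by blast
qed

text \<open>A nonabelian minimal normal subgroup meets the join of all the others trivially, so a
  character of one of its cyclic subgroups can be multiplied on without affecting the earlier
  values.\<close>

lemma extend_character_nonabelian:
  assumes "finite \<R>" and \<R>: "\<And>N. N \<in> \<R> \<Longrightarrow> minimal_normal N \<and> finite N \<and> \<not> commuting N"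
    and \<A>: "\<And>N. N \<in> \<A> \<Longrightarrow> minimal_normal N \<and> commuting N"
    and A: "subgroup A G" "A \<subseteq> join \<A>" "finite A" "character G A \<theta>"
  obtains B \<eta> where "subgroup B G" "finite B" "character G B \<eta>" "A \<subseteq> B" "\<And>a. a \<in> A \<Longrightarrow> \<eta> a = \<theta> a"
    "\<And>N. N \<in> \<R> \<Longrightarrow> \<exists>a\<in>B \<inter> N. \<eta> a \<noteq> 1"
proof -
  have "\<exists>B \<eta>. subgroup B G \<and> B \<subseteq> join (\<A> \<union> \<R>) \<and> finite B \<and> character G B \<eta> \<and> A \<subseteq> B \<and>
    (\<forall>a\<in>A. \<eta> a = \<theta> a) \<and> (\<forall>N\<in>\<R>. \<exists>a\<in>B \<inter> N. \<eta> a \<noteq> 1)"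
    using assms(1) \<R>
  proof (induction \<R> rule: finite_induct)
    case empty
    then show ?case
      using A by (intro exI[of _ A] exI[of _ \<theta>]) auto
  next
    case (insert N \<R>)
    then obtain B \<eta> where B: "subgroup B G" "B \<subseteq> join (\<A> \<union> \<R>)" "finite B" "character G B \<eta>"
      and AB: "A \<subseteq> B" "\<forall>a\<in>A. \<eta> a = \<theta> a" "\<forall>N\<in>\<R>. \<exists>a\<in>B \<inter> N. \<eta> a \<noteq> 1"
      by auto
    have N: "minimal_normal N" "finite N" "\<not> commuting N"
      using insert.prems by auto
    obtain C \<zeta> where C: "subgroup C G" "C \<subseteq> N" "finite C" "character G C \<zeta>" "\<exists>a\<in>C. \<zeta> a \<noteq> 1"
      using exists_cyclic_character[OF minimal_normalD(1)[OF N(1)] N(2) minimal_normalD(2)[OF N(1)]]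
      by metis
    have K: "minimal_normal K \<and> K \<noteq> N" if "K \<in> \<A> \<union> \<R>" for K
      using that \<A> insert N by auto
    have J: "join (\<A> \<union> \<R>) \<lhd> G"
      by (rule join_normal) (use K minimal_normalD(1) in blast)
    obtain \<eta>' where \<eta>': "subgroup (B <#> C) G" "finite (B <#> C)" "character G (B <#> C) \<eta>'"
      "B \<subseteq> B <#> C" "C \<subseteq> B <#> C" "B <#> C \<subseteq> join (\<A> \<union> \<R>) <#> N"
      "\<And>a. a \<in> B \<Longrightarrow> \<eta>' a = \<eta> a" "\<And>a. a \<in> C \<Longrightarrow> \<eta>' a = \<zeta> a"
      using merge_characters[OF J minimal_normalD(1)[OF N(1)]
          minimal_normal_disjoint_join[OF N(1,3) K] B C(1-4)] by metis
    have "join (\<A> \<union> \<R>) <#> N \<subseteq> join (\<A> \<union> insert N \<R>)"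
    proof (rule set_mult_least)
      show "join (\<A> \<union> insert N \<R>) \<lhd> G"
        by (rule join_normal) (use K N minimal_normalD(1) in blast)
      show "join (\<A> \<union> \<R>) \<subseteq> join (\<A> \<union> insert N \<R>)"
        by (rule mono_generate) auto
      show "N \<subseteq> join (\<A> \<union> insert N \<R>)"
        by (rule join_upper) simp
    qed
    with \<eta>'(6) have BC: "B <#> C \<subseteq> join (\<A> \<union> insert N \<R>)"
      by (rule order_trans)
    have "\<exists>a\<in>(B <#> C) \<inter> K. \<eta>' a \<noteq> 1" if K: "K \<in> insert N \<R>" for K
    proof (cases "K = N")
      case True
      obtain a where "a \<in> C" "\<zeta> a \<noteq> 1"
        using C(5) by blast
      then show ?thesis
        using True C(2) \<eta>'(5,8) by (intro bexI[of _ a]) auto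
    next
      case False
      then obtain a where "a \<in> B \<inter> K" "\<eta> a \<noteq> 1"
        using AB(3) K by blast
      then show ?thesis
        using \<eta>'(4,7) by (intro bexI[of _ a]) auto
    qed
    moreover have "\<eta>' a = \<theta> a" if "a \<in> A" for a
      using \<eta>'(7)[of a] AB(1,2) that by auto
    ultimately show ?case
      using \<eta>'(1-4) BC AB(1) by (intro exI[of _ "B <#> C"] exI[of _ \<eta>'] conjI ballI) auto
  qed
  then show thesis
    using that by blast
qed

end

section \<open>Isotypic normal subgroups\<close>

lemma exists_maximal_set:
  assumes "finite V" "U0 \<subseteq> V" "P U0"
  obtains U where "U \<subseteq> V" "P U" "\<And>W. W \<subseteq> V \<Longrightarrow> P W \<Longrightarrow> U \<subseteq> W \<Longrightarrow> W = U"
proof -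
  have "finite {U \<in> Pow V. P U}" "{U \<in> Pow V. P U} \<noteq> {}"
    using assms by auto
  from finite_has_maximal[OF this]
  obtain U where "U \<in> {U \<in> Pow V. P U}" "\<forall>W\<in>{U \<in> Pow V. P U}. U \<le> W \<longrightarrow> U = W"
    by blast
  then show thesis
    using that[of U] by blast
qed

context group
begin

lemma separates_if_good_character:
  assumes "countable (carrier G)" "subgroup A G" "finite A" "character G A \<theta>" "finite \<N>"
    and "\<And>N. N \<in> \<N> \<Longrightarrow> N \<lhd> G" "\<And>N. N \<in> \<N> \<Longrightarrow> \<exists>a\<in>A \<inter> N. \<theta> a \<noteq> 1"
  shows "separates G \<N>"
  by (rule separates_if_character[OF assms(1-6)]) (use assms(7) in auto)

text \<open>
  \<open>U\<close> is a normal subgroup of the join of \<open>\<N>\<close> that is maximal among those containing no member of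
  \<open>\<N>\<close>, and \<open>M\<close> is a complement of \<open>U\<close>. Each minimal normal subgroup of \<open>M\<close> is accounted for by a
  member of \<open>\<N>\<close>.
\<close>

lemma exists_unseparated_socle:
  assumes count: "countable (carrier G)"
    and fin: "finite \<N>" and \<N>: "\<And>N. N \<in> \<N> \<Longrightarrow> minimal_normal N \<and> finite N \<and> commuting N"
    and nsep: "\<not> separates G \<N>"
  obtains M where "M \<lhd> G" "finite M" "commuting M"
    "\<not> separates G {Y. minimal_normal Y \<and> Y \<subseteq> M}" "card {Y. minimal_normal Y \<and> Y \<subseteq> M} \<le> card \<N>"
proof -
  define V where "V = join \<N>"
  have V: "V \<lhd> G" "finite V" "commuting V"
    unfolding V_def
    using \<N> fin by (auto intro!: join_normal join_finite commuting_join dest: minimal_normalD(1))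
  have NV: "N \<subseteq> V" if "N \<in> \<N>" for N
    unfolding V_def using that by (rule join_upper)
  have "\<not> N \<subseteq> {\<one>}" if "N \<in> \<N>" for N
    using \<N>[OF that] minimal_normalD(1,2) normal_one by blast
  then obtain U where U: "U \<subseteq> V" "U \<lhd> G \<and> (\<forall>N\<in>\<N>. \<not> N \<subseteq> U)"
    and U_max: "\<And>W. W \<subseteq> V \<Longrightarrow> W \<lhd> G \<and> (\<forall>N\<in>\<N>. \<not> N \<subseteq> W) \<Longrightarrow> U \<subseteq> W \<Longrightarrow> W = U"
    using exists_maximal_set[OF V(2), of "{\<one>}" "\<lambda>U. U \<lhd> G \<and> (\<forall>N\<in>\<N>. \<not> N \<subseteq> U)"]
      normal_one[OF V(1)] one_is_normal by (metis empty_subsetI insert_subset)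
  have UN: "U \<lhd> G"
    using U(2) by blast
  have "{\<one>} \<inter> U = {\<one>}"
    using normal_one[OF UN] by blast
  then obtain M where M: "M \<subseteq> V" "M \<lhd> G \<and> M \<inter> U = {\<one>}"
    and M_max: "\<And>W. W \<subseteq> V \<Longrightarrow> W \<lhd> G \<and> W \<inter> U = {\<one>} \<Longrightarrow> M \<subseteq> W \<Longrightarrow> W = M"
    using exists_maximal_set[OF V(2), of "{\<one>}" "\<lambda>M. M \<lhd> G \<and> M \<inter> U = {\<one>}"]
      normal_one[OF V(1)] one_is_normal by (metis empty_subsetI insert_subset)
  have MN: "M \<lhd> G" and MU: "M \<inter> U = {\<one>}"
    using M(2) by auto
  note MUN = set_mult_normal[OF MN UN]
  \<comment> \<open>If \<open>N\<close> were not inside MU, it would meet MU trivially, so MN would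
    still meet \<open>U\<close> trivially, against the maximality of \<open>M\<close>.\<close>
  have NMU: "N \<subseteq> M <#> U" if N: "N \<in> \<N>" for N
  proof (rule ccontr)
    assume not: "\<not> N \<subseteq> M <#> U"
    have mN: "minimal_normal N" and NN: "N \<lhd> G"
      using \<N>[OF N] minimal_normalD(1) by auto
    have triv: "N \<inter> (M <#> U) = {\<one>}"
      using minimal_normal_Int[OF mN MUN(1)] not by blast
    note MNN = set_mult_normal[OF MN NN]
    have "x = \<one>" if x: "x \<in> (M <#> N) \<inter> U" for x
    proof -
      obtain m k where mk: "m \<in> M" "k \<in> N" "x = m \<otimes> k"
        using x by (auto simp: set_mult_def)
      have c: "m \<in> carrier G" "k \<in> carrier G"
        using mk normal_carrier MN NN by auto
      have "k = inv m \<otimes> x"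
        unfolding mk(3) using c by (simp add: m_assoc[symmetric])
      then have "k \<in> M <#> U"
        using set_multI[OF normal_inv[OF MN mk(1)], of x U] x by simp
      then have "k = \<one>"
        using triv mk(2) by blast
      then have "x = m"
        using mk c by simp
      then show ?thesis
        using MU mk(1) x by blast
    qed
    then have "(M <#> N) \<inter> U = {\<one>}"
      using normal_one[OF MNN(1)] normal_one[OF UN] by blast
    then have "M <#> N = M"
      using M_max[of "M <#> N"] MNN set_mult_least[OF V(1) M(1) NV[OF N]] by blast
    then have "N \<subseteq> M <#> U"
      using MNN(3) MUN(2) by blast
    with not show False by simp
  qed
  define T where "T = {Y. minimal_normal Y \<and> Y \<subseteq> M}"
  have finM: "finite M"
    using M(1) V(2) finite_subset by blast
  have finT: "finite T"
    by (rule finite_subset[of _ "Pow M"]) (auto simp: T_def finM)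
  \<comment> \<open>\<open>Y\<close> meets \<open>U\<close> trivially, so YU is strictly larger than
    \<open>U\<close>, and by maximality of \<open>U\<close> it contains a member of the
    family.\<close>
  have "\<exists>N\<in>\<N>. N \<subseteq> Y <#> U" if Y: "Y \<in> T" for Y
  proof (rule ccontr)
    assume not: "\<not> (\<exists>N\<in>\<N>. N \<subseteq> Y <#> U)"
    have YN: "Y \<lhd> G" "Y \<noteq> {\<one>}" "Y \<subseteq> M"
      using Y minimal_normalD by (auto simp: T_def)
    note YUN = set_mult_normal[OF YN(1) UN]
    have "Y <#> U = U"
    proof (rule U_max)
      show "Y <#> U \<subseteq> V"
        using set_mult_least[OF V(1)] YN(3) M(1) U(1) by blast
    qed (use YUN not in blast)+
    then have "Y \<subseteq> M \<inter> U"
      using YUN(2) YN(3) by blast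
    then show False
      using MU YN(2) normal_one[OF YN(1)] by blast
  qed
  then obtain f where f: "\<And>Y. Y \<in> T \<Longrightarrow> f Y \<in> \<N> \<and> f Y \<subseteq> Y <#> U"
    by metis
  have "inj_on f T"
  proof (rule inj_onI, rule ccontr)
    fix Y Z assume Y: "Y \<in> T" and Z: "Z \<in> T" and eq: "f Y = f Z" and ne: "Y \<noteq> Z"
    have YZ: "minimal_normal Y" "minimal_normal Z" "Y \<subseteq> M" "Z \<subseteq> M"
      using Y Z by (auto simp: T_def)
    \<comment> \<open>The M-component of an element of \<open>f Y\<close> lies in both
      \<open>Y\<close> and \<open>Z\<close>, hence is trivial. But no member of the family is
      contained in \<open>U\<close>.\<close>
    have "f Y \<subseteq> U"
    proof
      fix x assume x: "x \<in> f Y"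
      then obtain y u z w where yz: "y \<in> Y" "u \<in> U" "x = y \<otimes> u" "z \<in> Z" "w \<in> U" "x = z \<otimes> w"
        using f[OF Y] f[OF Z] eq unfolding set_mult_def by blast
      have "y = z"
        by (rule direct_product_unique(1)[OF MN UN MU _ _ yz(2,5)]) (use yz YZ in auto)
      then have "y = \<one>"
        using minimal_normal_disjoint[OF YZ(1,2) ne] yz by blast
      then show "x \<in> U"
        using yz normal_carrier[OF UN] by simp
    qed
    then show False
      using f[OF Y] U(2) by blast
  qed
  then have card: "card T \<le> card \<N>"
    using f fin by (intro card_inj_on_le) auto
  have "\<not> separates G T"
  proof
    assume sep: "separates G T"
    have comM: "a \<otimes> b = b \<otimes> a" if "a \<in> M" "b \<in> M" for a b
      using V(3) M(1) that by (auto simp: commuting_def)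
    have TM: "Y \<lhd> G \<and> Y \<subseteq> M" if "Y \<in> T" for Y
      using that minimal_normalD(1) by (auto simp: T_def)
    obtain \<theta> where \<theta>: "character G M \<theta>" "\<And>Y. Y \<in> T \<Longrightarrow> \<exists>a\<in>Y. \<theta> a \<noteq> 1"
      using character_if_separates[OF sep normal_imp_subgroup[OF MN] finM comM TM] by metis
    \<comment> \<open>A character of \<open>M\<close> that separates \<open>T\<close> is continued
      by 1 on \<open>U\<close>; the result turns out to be nontrivial on every member of the
      original family.\<close>
    have triv_char: "character G U (\<lambda>_. 1)"
      by (simp add: character_def)
    have finU: "finite U"
      using U(1) V(2) finite_subset by blast
    obtain \<eta> where \<eta>: "subgroup (M <#> U) G" "finite (M <#> U)" "character G (M <#> U) \<eta>"
      "M \<subseteq> M <#> U" "U \<subseteq> M <#> U" "M <#> U \<subseteq> M <#> U"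
      "\<And>a. a \<in> M \<Longrightarrow> \<eta> a = \<theta> a" "\<And>a. a \<in> U \<Longrightarrow> \<eta> a = 1"
      using merge_characters[OF MN UN MU normal_imp_subgroup[OF MN] subset_refl finM \<theta>(1)
            normal_imp_subgroup[OF UN] subset_refl finU triv_char]
      by metis
    note eta = character_simps[OF \<eta>(1,3)]
    have "separates G \<N>"
    proof (rule separates_if_good_character[OF count \<eta>(1-3) fin])
      fix N assume N: "N \<in> \<N>"
      have mN: "minimal_normal N"
        using \<N>[OF N] by simp
      show NN: "N \<lhd> G"
        using minimal_normalD(1)[OF mN] .
      have NU: "N \<inter> U = {\<one>}"
        using minimal_normal_Int[OF mN UN] U(2) N by blast
      note NUN = set_mult_normal[OF NN UN]
      obtain x where x: "x \<in> N" "x \<noteq> \<one>"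
        using minimal_normalD(2)[OF mN] normal_one[OF NN] by blast
      obtain m u where mu: "m \<in> M" "u \<in> U" "x = m \<otimes> u"
        using NMU[OF N] x(1) unfolding set_mult_def by blast
      have c: "m \<in> carrier G" "u \<in> carrier G"
        using mu normal_carrier MN UN by auto
      have "m = x \<otimes> inv u"
        using c by (simp add: mu(3) m_assoc)
      then have "m \<in> (N <#> U) \<inter> M"
        using set_multI[OF x(1) normal_inv[OF UN mu(2)]] mu(1) by simp
      moreover have "m \<noteq> \<one>"
      proof
        assume "m = \<one>"
        then have "x = u"
          using mu c by simp
        then show False
          using NU x mu(2) by blast
      qed
      \<comment> \<open>This intersection is the projection of \<open>N\<close> to \<open>M\<close>
        along \<open>U\<close>. It contains a minimal normal \<open>Y\<close>, and where \<theta> is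
        nontrivial on \<open>Y\<close> its value equals that of \<eta> at the element of
        \<open>N\<close> above it.\<close>
      ultimately have "(N <#> U) \<inter> M \<noteq> {\<one>}"
        by blast
      moreover have "finite ((N <#> U) \<inter> M)"
        using finM by simp
      ultimately obtain Y where Y: "minimal_normal Y" "Y \<subseteq> (N <#> U) \<inter> M"
        using exists_minimal_normal[OF normal_Int[OF NUN(1) MN]] by blast
      then obtain y where y: "y \<in> Y" "\<theta> y \<noteq> 1"
        using \<theta>(2)[of Y] by (auto simp: T_def)
      then obtain k w where kw: "k \<in> N" "w \<in> U" "y = k \<otimes> w"
        using Y(2) unfolding set_mult_def by blast
      have c: "k \<in> carrier G" "w \<in> carrier G"
        using kw normal_carrier NN UN by auto
      have yM: "y \<in> M"
        using y Y(2) by blast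
      have kA: "k \<in> M <#> U"
        using NMU[OF N] kw(1) by blast
      have "\<eta> y = \<eta> k * \<eta> w"
        unfolding kw(3) using kA kw(2) MUN(3) by (intro eta(3)) auto
      then have "\<eta> k = \<theta> y"
        using \<eta>(7)[OF yM] \<eta>(8)[OF kw(2)] by simp
      then show "\<exists>a\<in>(M <#> U) \<inter> N. \<eta> a \<noteq> 1"
        using y(2) kA kw(1) by (intro bexI[of _ k]) auto
    qed
    with nsep show False by simp
  qed
  moreover have "commuting M"
    using V(3) M(1) by (auto simp: commuting_def)
  ultimately show thesis
    using that[of M] MN finM card by (simp add: T_def)
qed

section \<open>Isomorphism types of minimal normal subgroups\<close>

definition equivariant_iso :: "('a \<Rightarrow> 'a) \<Rightarrow> 'a set \<Rightarrow> 'a set \<Rightarrow> bool" where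
  "equivariant_iso f Y Z \<longleftrightarrow> bij_betw f Y Z \<and> (\<forall>a\<in>Y. \<forall>b\<in>Y. f (a \<otimes> b) = f a \<otimes> f b) \<and>
    (\<forall>g\<in>carrier G. \<forall>a\<in>Y. f (g \<otimes> a \<otimes> inv g) = g \<otimes> f a \<otimes> inv g)"

definition G_isomorphic :: "'a set \<Rightarrow> 'a set \<Rightarrow> bool" where
  "G_isomorphic Y Z \<longleftrightarrow> (\<exists>f. equivariant_iso f Y Z)"

lemma G_isomorphic_refl: "G_isomorphic Y Y"
  unfolding G_isomorphic_def equivariant_iso_def by (rule exI[of _ "\<lambda>x. x"]) (simp add: bij_betw_def)

lemma G_isomorphic_sym:
  assumes Y: "Y \<lhd> G" and YZ: "G_isomorphic Y Z"
  shows "G_isomorphic Z Y"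
proof -
  obtain f where f: "bij_betw f Y Z" "\<And>a b. a \<in> Y \<Longrightarrow> b \<in> Y \<Longrightarrow> f (a \<otimes> b) = f a \<otimes> f b"
    "\<And>g a. g \<in> carrier G \<Longrightarrow> a \<in> Y \<Longrightarrow> f (g \<otimes> a \<otimes> inv g) = g \<otimes> f a \<otimes> inv g"
    using YZ by (auto simp: G_isomorphic_def equivariant_iso_def)
  define h where "h = inv_into Y f"
  have h: "h (f a) = a" if "a \<in> Y" for a
    unfolding h_def using f(1) that by (simp add: bij_betw_def)
  have Z: "\<exists>a\<in>Y. z = f a" if "z \<in> Z" for z
    using f(1) that by (auto simp: bij_betw_def)
  have "equivariant_iso h Z Y"
    unfolding equivariant_iso_def
  proof (intro conjI ballI)
    show "bij_betw h Z Y"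
      unfolding h_def using f(1) by (rule bij_betw_inv_into)
    fix z assume "z \<in> Z"
    then obtain a where a: "a \<in> Y" "z = f a"
      using Z by blast
    show "h (g \<otimes> z \<otimes> inv g) = g \<otimes> h z \<otimes> inv g" if g: "g \<in> carrier G" for g
      unfolding a(2) f(3)[OF g a(1), symmetric] using h a(1) normal_conj[OF Y a(1) g] by simp
    fix z' assume "z' \<in> Z"
    then obtain a' where a': "a' \<in> Y" "z' = f a'"
      using Z by blast
    show "h (z \<otimes> z') = h z \<otimes> h z'"
      unfolding a(2) a'(2) f(2)[OF a(1) a'(1), symmetric] using h a(1) a'(1) normal_mult[OF Y] by simp
  qed
  then show ?thesis
    by (auto simp: G_isomorphic_def)
qed

lemma G_isomorphic_trans:
  assumes "G_isomorphic W Y" "G_isomorphic Y Z"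
  shows "G_isomorphic W Z"
proof -
  obtain f h where f: "equivariant_iso f W Y" and h: "equivariant_iso h Y Z"
    using assms by (auto simp: G_isomorphic_def)
  have fX: "f a \<in> Y" if "a \<in> W" for a
    using f that by (auto simp: equivariant_iso_def bij_betw_def)
  have "bij_betw (h \<circ> f) W Z"
    using f h by (auto simp: equivariant_iso_def intro: bij_betw_trans)
  then have "equivariant_iso (h \<circ> f) W Z"
    using f h fX by (simp add: equivariant_iso_def)
  then show ?thesis
    by (auto simp: G_isomorphic_def)
qed

lemma normal_hom_image:
  assumes Y: "Y \<lhd> G" and Z: "Z \<lhd> G" and fZ: "f ` Y \<subseteq> Z"
    and mult: "\<And>a b. a \<in> Y \<Longrightarrow> b \<in> Y \<Longrightarrow> f (a \<otimes> b) = f a \<otimes> f b"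
    and conj: "\<And>g a. g \<in> carrier G \<Longrightarrow> a \<in> Y \<Longrightarrow> f (g \<otimes> a \<otimes> inv g) = g \<otimes> f a \<otimes> inv g"
  shows "f ` Y \<lhd> G" "f \<one> = \<one>" "\<And>a. a \<in> Y \<Longrightarrow> f (inv a) = inv (f a)"
proof -
  have fc: "f a \<in> carrier G" if "a \<in> Y" for a
    using fZ normal_carrier[OF Z] that by blast
  show one: "f \<one> = \<one>"
    using mult[of \<one> \<one>] normal_one[OF Y] fc[of \<one>] by simp
  show inv: "f (inv a) = inv (f a)" if a: "a \<in> Y" for a
  proof -
    have "f (inv a) \<otimes> f a = \<one>"
      using mult[OF normal_inv[OF Y a] a] one normal_carrier[OF Y a] by simp
    then show ?thesis
      using fc a normal_inv[OF Y a] by (metis inv_equality)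
  qed
  have "subgroup (f ` Y) G"
  proof (rule subgroupI)
    show "f ` Y \<noteq> {}"
      using normal_one[OF Y] by blast
    show "inv x \<in> f ` Y" if "x \<in> f ` Y" for x
      using that inv normal_inv[OF Y] by force
    show "x \<otimes> y \<in> f ` Y" if "x \<in> f ` Y" "y \<in> f ` Y" for x y
      using that mult normal_mult[OF Y] by force
  qed (use fc in auto)
  then show "f ` Y \<lhd> G"
  proof (rule normal_invI)
    show "g \<otimes> x \<otimes> inv g \<in> f ` Y" if "g \<in> carrier G" "x \<in> f ` Y" for g x
      using that conj normal_conj[OF Y] by force
  qed
qed

text \<open>If \<open>Y\<close> is not contained in the join of the earlier members, the new join is
  the direct product of \<open>Z\<close> with the earlier one. Projection to \<open>Z\<close> is
  injective on \<open>Y\<close>, as \<open>Y\<close> meets the earlier join trivially, and onto by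
  minimality of \<open>Z\<close>.\<close>

lemma G_isomorphic_if_subset_join:
  assumes "finite \<T>" "\<And>Z. Z \<in> \<T> \<Longrightarrow> minimal_normal Z" "minimal_normal Y" "Y \<subseteq> join \<T>"
  shows "\<exists>Z\<in>\<T>. G_isomorphic Y Z"
  using assms
proof (induction \<T> rule: finite_induct)
  case empty
  have "join {} = {\<one>}"
    by (simp add: generate_empty)
  then show ?case
    using empty(2,3) minimal_normalD(1,2) normal_one by blast
next
  case (insert Z \<T>)
  have Z: "minimal_normal Z" "Z \<lhd> G" and Y: "Y \<lhd> G"
    using insert.prems minimal_normalD(1) by auto
  have J: "join \<T> \<lhd> G"
    using insert.prems minimal_normalD(1) by (intro join_normal) auto
  have YZJ: "Y \<subseteq> Z <#> join \<T>"
  proof -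
    have "join (insert Z \<T>) = Z <#> join \<T>"
      by (rule join_insert) (use insert.prems minimal_normalD(1) in auto)
    then show ?thesis
      using insert.prems(3) by simp
  qed
  show ?case
  proof (cases "Y \<subseteq> join \<T>")
    case True
    then show ?thesis
      using insert.IH insert.prems by auto
  next
    case False
    have "\<not> Z \<subseteq> join \<T>"
      using set_mult_least[OF J, of Z "join \<T>"] YZJ False by blast
    then have ZJ: "Z \<inter> join \<T> = {\<one>}"
      using minimal_normal_Int[OF Z(1) J] by blast
    have YJ: "Y \<inter> join \<T> = {\<one>}"
      using minimal_normal_Int[OF insert.prems(2) J] False by blast
    have "\<exists>z. z \<in> Z \<and> (\<exists>j\<in>join \<T>. y = z \<otimes> j)" if "y \<in> Y" for y
      using YZJ that unfolding set_mult_def by blast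
    \<comment> \<open>The projection to \<open>Z\<close> along the earlier join; uniqueness of the
      factors makes it an equivariant homomorphism.\<close>
    then obtain f where f: "\<And>y. y \<in> Y \<Longrightarrow> f y \<in> Z \<and> (\<exists>j\<in>join \<T>. y = f y \<otimes> j)"
      by metis
    have f_eq: "f y = z" if "y \<in> Y" "z \<in> Z" "j \<in> join \<T>" "y = z \<otimes> j" for y z j
    proof -
      obtain j' where "j' \<in> join \<T>" "y = f y \<otimes> j'"
        using f[OF \<open>y \<in> Y\<close>] by blast
      then show ?thesis
        using direct_product_unique(1)[OF Z(2) J ZJ, of "f y" z j' j] f that by simp
    qed
    have mult: "f (a \<otimes> b) = f a \<otimes> f b" if a: "a \<in> Y" and b: "b \<in> Y" for a b
    proof -
      obtain i j where ij: "i \<in> join \<T>" "a = f a \<otimes> i" "j \<in> join \<T>" "b = f b \<otimes> j"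
        using f[OF a] f[OF b] by blast
      have c: "f a \<in> carrier G" "f b \<in> carrier G" "i \<in> carrier G" "j \<in> carrier G"
        using f a b ij normal_carrier Z J by blast+
      have "a \<otimes> b = (f a \<otimes> i) \<otimes> (f b \<otimes> j)"
        using ij by simp
      also have "\<dots> = f a \<otimes> (i \<otimes> f b) \<otimes> j"
        using c by (simp add: m_assoc)
      also have "i \<otimes> f b = f b \<otimes> i"
        using normal_commute[OF Z(2) J ZJ, of "f b" i] f[OF b] ij by simp
      also have "f a \<otimes> (f b \<otimes> i) \<otimes> j = (f a \<otimes> f b) \<otimes> (i \<otimes> j)"
        using c by (simp add: m_assoc)
      finally have eq: "a \<otimes> b = (f a \<otimes> f b) \<otimes> (i \<otimes> j)" .
      have "f a \<in> Z" "f b \<in> Z"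
        using f a b by blast+
      then show ?thesis
        by (intro f_eq[OF normal_mult[OF Y a b] normal_mult[OF Z(2)] normal_mult[OF J ij(1,3)] eq])
    qed
    have conj: "f (g \<otimes> a \<otimes> inv g) = g \<otimes> f a \<otimes> inv g" if g: "g \<in> carrier G" and a: "a \<in> Y" for g a
    proof -
      obtain i where i: "i \<in> join \<T>" "a = f a \<otimes> i"
        using f[OF a] by blast
      have c: "f a \<in> carrier G" "i \<in> carrier G"
        using f a i normal_carrier Z J by blast+
      have "g \<otimes> a \<otimes> inv g = g \<otimes> (f a \<otimes> i) \<otimes> inv g"
        using i(2) by simp
      also have "\<dots> = (g \<otimes> f a \<otimes> inv g) \<otimes> (g \<otimes> i \<otimes> inv g)"
        by (rule conj_mult[OF g c, symmetric])
      finally have eq: "g \<otimes> a \<otimes> inv g = (g \<otimes> f a \<otimes> inv g) \<otimes> (g \<otimes> i \<otimes> inv g)" .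
      have "f a \<in> Z"
        using f a by blast
      then show ?thesis
        by (intro f_eq[OF normal_conj[OF Y a g] normal_conj[OF Z(2) _ g] normal_conj[OF J i(1) g] eq])
    qed
    have fZ: "f ` Y \<subseteq> Z"
      using f by auto
    have img: "f ` Y \<lhd> G"
      by (rule normal_hom_image(1)[OF Y Z(2) fZ]) (rule mult conj; assumption)+
    have inv: "f (inv a) = inv (f a)" if "a \<in> Y" for a
      by (rule normal_hom_image(3)[OF Y Z(2) fZ _ _ that]) (rule mult conj; assumption)+
    have ker: "y = \<one>" if "y \<in> Y" "f y = \<one>" for y
    proof -
      obtain j where "j \<in> join \<T>" "y = f y \<otimes> j"
        using f[OF \<open>y \<in> Y\<close>] by blast
      then have "y \<in> join \<T>"
        using that(2) normal_carrier[OF J] by simp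
      then show ?thesis
        using YJ that(1) by blast
    qed
    have "inj_on f Y"
    proof (rule inj_onI)
      fix a b assume ab: "a \<in> Y" "b \<in> Y" "f a = f b"
      have c: "a \<in> carrier G" "b \<in> carrier G" "f b \<in> carrier G"
        using ab Y f Z normal_carrier by blast+
      have "f (a \<otimes> inv b) = \<one>"
        using mult[OF ab(1) normal_inv[OF Y ab(2)]] inv[OF ab(2)] ab(3) c by simp
      then have "a \<otimes> inv b = \<one>"
        using ker normal_mult[OF Y ab(1) normal_inv[OF Y ab(2)]] by simp
      then show "a = b"
        using c by (metis inv_equality inv_inv inv_closed)
    qed
    moreover have "f ` Y = Z"
    proof -
      obtain y where "y \<in> Y" "y \<noteq> \<one>"
        using minimal_normalD(2)[OF insert.prems(2)] normal_one[OF Y] by blast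
      then have "f ` Y \<noteq> {\<one>}"
        using ker by blast
      then show ?thesis
        using minimal_normalD(3)[OF Z(1) img fZ] by blast
    qed
    ultimately have "equivariant_iso f Y Z"
      unfolding equivariant_iso_def bij_betw_def using mult conj by blast
    then show ?thesis
      by (auto simp: G_isomorphic_def)
  qed
qed

text \<open>With a second isomorphism type, the members isomorphic to \<open>Y0\<close> and the
  remaining ones are two proper subfamilies, each with a separating character on its join.
  Multiplying these characters would separate \<open>T\<close>.\<close>

lemma unseparated_socle_isotypic:
  assumes count: "countable (carrier G)" and M: "M \<lhd> G" "finite M" "commuting M"
  defines "T \<equiv> {Y. minimal_normal Y \<and> Y \<subseteq> M}"
  assumes nsep: "\<not> separates G T" and small: "\<And>\<T>. \<T> \<subset> T \<Longrightarrow> separates G \<T>"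
    and Y0: "Y0 \<in> T" and Z: "Z \<in> T"
  shows "G_isomorphic Y0 Z"
proof (rule ccontr)
  assume "\<not> G_isomorphic Y0 Z"
  define T1 where "T1 = {Y\<in>T. G_isomorphic Y0 Y}"
  define T2 where "T2 = {Y\<in>T. \<not> G_isomorphic Y0 Y}"
  have T: "T = T1 \<union> T2" "T1 \<subset> T" "T2 \<subset> T"
    using Y0 Z \<open>\<not> G_isomorphic Y0 Z\<close> G_isomorphic_refl by (auto simp: T1_def T2_def)
  have mn: "minimal_normal Y" "Y \<lhd> G" "Y \<subseteq> M" if "Y \<in> T" for Y
    using that minimal_normalD(1) by (auto simp: T_def)
  have fin: "finite T"
    by (rule finite_subset[of _ "Pow M"]) (auto simp: T_def M(2))
  have J: "join \<T> \<lhd> G" "join \<T> \<subseteq> M" "finite (join \<T>)"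
    "\<And>a b. a \<in> join \<T> \<Longrightarrow> b \<in> join \<T> \<Longrightarrow> a \<otimes> b = b \<otimes> a" if "\<T> \<subseteq> T" for \<T>
  proof -
    show "join \<T> \<lhd> G"
      by (rule join_normal) (use that mn in blast)
    show sub: "join \<T> \<subseteq> M"
      by (rule join_least[OF M(1)]) (use that mn in blast)
    then show "finite (join \<T>)"
      using M(2) finite_subset by blast
    show "a \<otimes> b = b \<otimes> a" if "a \<in> join \<T>" "b \<in> join \<T>" for a b
      using M(3) sub that unfolding commuting_def by blast
  qed
  have char: "\<exists>\<theta>. character G (join \<T>) \<theta> \<and> (\<forall>N\<in>\<T>. \<exists>a\<in>N. \<theta> a \<noteq> 1)" if sub: "\<T> \<subset> T" for \<T>
  proof -
    have sub': "\<T> \<subseteq> T"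
      using sub by blast
    have "N \<lhd> G \<and> N \<subseteq> join \<T>" if "N \<in> \<T>" for N
      using mn(2)[OF subsetD[OF sub' that]] join_upper[OF that] by (rule conjI)
    from character_if_separates[OF small[OF sub] normal_imp_subgroup[OF J(1)[OF sub']]
        J(3)[OF sub'] J(4)[OF sub'] this]
    show ?thesis by metis
  qed
  have T1': "T1 \<subseteq> T" and T2': "T2 \<subseteq> T"
    using T by auto
  obtain \<theta>1 where \<theta>1: "character G (join T1) \<theta>1" "\<forall>N\<in>T1. \<exists>a\<in>N. \<theta>1 a \<noteq> 1"
    using char[OF T(2)] by blast
  obtain \<theta>2 where \<theta>2: "character G (join T2) \<theta>2" "\<forall>N\<in>T2. \<exists>a\<in>N. \<theta>2 a \<noteq> 1"
    using char[OF T(3)] by blast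
  \<comment> \<open>A minimal normal subgroup in both joins would be isomorphic to a member of
    \<open>T1\<close> and to a member of \<open>T2\<close>, linking \<open>Y0\<close> with the wrong
    class.\<close>
  have triv: "join T1 \<inter> join T2 = {\<one>}"
  proof (rule ccontr)
    assume "join T1 \<inter> join T2 \<noteq> {\<one>}"
    moreover have "finite (join T1 \<inter> join T2)"
      using J(3)[OF T1'] by simp
    ultimately obtain Y where Y: "minimal_normal Y" "Y \<subseteq> join T1 \<inter> join T2"
      using exists_minimal_normal[OF normal_Int[OF J(1)[OF T1'] J(1)[OF T2']]] by blast
    have "\<exists>Z\<in>T1. G_isomorphic Y Z"
      by (rule G_isomorphic_if_subset_join[OF finite_subset[OF T1' fin] mn(1)[OF subsetD[OF T1']] Y(1)])
        (use Y(2) in auto)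
    then obtain Z1 where Z1: "Z1 \<in> T1" "G_isomorphic Y Z1"
      by blast
    have "\<exists>Z\<in>T2. G_isomorphic Y Z"
      by (rule G_isomorphic_if_subset_join[OF finite_subset[OF T2' fin] mn(1)[OF subsetD[OF T2']] Y(1)])
        (use Y(2) in auto)
    then obtain Z2 where Z2: "Z2 \<in> T2" "G_isomorphic Y Z2"
      by blast
    have "G_isomorphic Y0 Z1"
      using Z1(1) by (simp add: T1_def)
    then have "G_isomorphic Y0 Z2"
      by (rule G_isomorphic_trans[OF G_isomorphic_trans[OF _ G_isomorphic_sym[OF minimal_normalD(1)[OF Y(1)] Z1(2)]] Z2(2)])
    then show False
      using Z2(1) by (simp add: T2_def)
  qed
  obtain \<eta> where \<eta>: "subgroup (join T1 <#> join T2) G" "finite (join T1 <#> join T2)"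
    "character G (join T1 <#> join T2) \<eta>" "join T1 \<subseteq> join T1 <#> join T2"
    "join T2 \<subseteq> join T1 <#> join T2" "join T1 <#> join T2 \<subseteq> join T1 <#> join T2"
    "\<And>a. a \<in> join T1 \<Longrightarrow> \<eta> a = \<theta>1 a"
    "\<And>a. a \<in> join T2 \<Longrightarrow> \<eta> a = \<theta>2 a"
    using merge_characters[OF J(1)[OF T1'] J(1)[OF T2'] triv
          normal_imp_subgroup[OF J(1)[OF T1']] subset_refl J(3)[OF T1'] \<theta>1(1)
          normal_imp_subgroup[OF J(1)[OF T2']] subset_refl J(3)[OF T2'] \<theta>2(1)]
    by metis
  have "separates G T"
  proof (rule separates_if_good_character[OF count \<eta>(1-3) fin])
    fix N assume N: "N \<in> T"
    show "N \<lhd> G"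
      using mn[OF N] by simp
    show "\<exists>a\<in>(join T1 <#> join T2) \<inter> N. \<eta> a \<noteq> 1"
    proof (cases "N \<in> T1")
      case True
      then obtain a where a: "a \<in> N" "\<theta>1 a \<noteq> 1"
        using \<theta>1(2) by blast
      moreover have "a \<in> join T1"
        using join_upper[OF True] a(1) by blast
      ultimately show ?thesis
        using \<eta>(4,7) by (intro bexI[of _ a]) auto
    next
      case False
      then have N2: "N \<in> T2"
        using N T(1) by blast
      then obtain a where a: "a \<in> N" "\<theta>2 a \<noteq> 1"
        using \<theta>2(2) by blast
      moreover have "a \<in> join T2"
        using join_upper[OF N2] a(1) by blast
      ultimately show ?thesis
        using \<eta>(5,8) by (intro bexI[of _ a]) auto
    qed
  qed
  with nsep show False by simp
qed

end

section \<open>Counting minimal normal subgroups\<close>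

text \<open>A second prime divisor r of the order would give, by Sylow with exponent 1, a subgroup
  of order r, whose elements satisfy x^r = x^p = 1.\<close>

lemma (in group) order_prime_power_if_exponent:
  assumes fin: "finite (carrier G)" and p: "Factorial_Ring.prime p" and exp: "\<And>x. x \<in> carrier G \<Longrightarrow> x [^] p = \<one>"
  shows "\<exists>k. order G = p ^ k"
proof -
  have ord0: "order G \<noteq> 0"
    using fin by (auto simp: order_def)
  then obtain m where m: "order G = p ^ multiplicity p (order G) * m" "\<not> p dvd m"
    using multiplicity_decompose'[of "order G" p] p by (metis not_prime_unit)
  have "m = 1"
  proof (rule ccontr)
    assume "m \<noteq> 1"
    then obtain r where r: "Factorial_Ring.prime r" "r dvd m"
      using prime_factor_nat by blast
    then have rp: "r \<noteq> p"
      using m(2) by auto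
    have "r dvd order G"
      using r(2) m(1) by (metis dvd_mult)
    then obtain c where c: "order G = r ^ 1 * c"
      by (auto elim: dvdE)
    obtain S where S: "subgroup S G" "card S = r ^ 1"
      using sylow_thm[OF r(1) is_group c fin] by blast
    interpret S: subgroup S G by (rule S)
    have "card S > 1"
      using S(2) prime_gt_1_nat[OF r(1)] by simp
    then obtain x where x: "x \<in> S" "x \<noteq> \<one>"
      by (metis card_le_Suc0_iff_eq card.infinite S.one_closed not_le One_nat_def zero_less_one less_imp_le)
    have xG: "x \<in> carrier G"
      using x(1) by simp
    have "x [^] r = \<one>"
      using subgroup_pow_card_eq_1[OF S(1) x(1)] S(2) by simp
    then have "ord x dvd r" "ord x dvd p"
      using exp[OF xG] xG pow_eq_id by auto
    then have "ord x = 1"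
      using primes_coprime[OF r(1) p rp] by (metis coprime_common_divisor_nat)
    then show False
      using x(2) xG ord_eq_1 by simp
  qed
  then show ?thesis
    using m(1) by auto
qed

text \<open>With q = p^a and r = b mod a, the powers p^b and p^r agree modulo q - 1. So q - 1
  divides p^r - 1, and p^r < q forces p^r = 1: p^b is a power of q, and the quotient is a geometric
  sum.\<close>

lemma prime_power_minus_one_dvd:
  fixes p a b t :: nat
  assumes p: "1 < p" and a: "1 \<le> a" and eq: "t * (p ^ a - 1) = p ^ b - 1"
  shows "\<exists>s. t = (\<Sum>i<s. (p ^ a) ^ i)"
proof -
  define q where "q = p ^ a"
  have q: "q > 1"
    unfolding q_def using p a by (intro one_less_power) auto
  define r where "r = b mod a"
  define s where "s = b div a"
  have geo: "(int q - 1) * (\<Sum>i<k. int q ^ i) = int q ^ k - 1" for k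
    by (rule power_diff_1_eq[symmetric])
  have b: "p ^ b = p ^ r * q ^ s"
    unfolding q_def r_def s_def by (simp add: power_mult[symmetric] power_add[symmetric])
  have eq': "int t * (int q - 1) = int p ^ b - 1"
  proof -
    have "int (t * (q - 1)) = int (p ^ b - 1)"
      using eq by (simp add: q_def)
    then show ?thesis
      using q p by (simp add: of_nat_diff)
  qed
  have "(int q - 1) dvd int p ^ r - 1"
  proof -
    have "int p ^ b = int p ^ r * int q ^ s"
      using arg_cong[OF b, of int] by simp
    then have "int p ^ r - 1 = int t * (int q - 1) - int p ^ r * (int q ^ s - 1)"
      using eq' by (simp add: algebra_simps)
    also have "\<dots> = (int q - 1) * (int t - int p ^ r * (\<Sum>i<s. int q ^ i))"
      unfolding geo[symmetric] by (simp add: algebra_simps)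
    finally show ?thesis
      by (metis dvd_triv_left)
  qed
  moreover have "p ^ r < q"
    unfolding q_def r_def using p a by (intro power_strict_increasing) auto
  then have "int p ^ r < int q"
    by (metis of_nat_less_iff of_nat_power)
  moreover have "int p ^ r \<ge> 1"
    using p by simp
  ultimately have "int p ^ r - 1 = 0"
    using zdvd_imp_le[of "int q - 1" "int p ^ r - 1"] by linarith
  then have "int p ^ r = 1"
    by simp
  then have "int p ^ b = int q ^ s"
    using arg_cong[OF b, of int] by simp
  then have "(int q - 1) * int t = (int q - 1) * (\<Sum>i<s. int q ^ i)"
    using eq' geo[of s] by (simp add: mult.commute)
  then have "int t = int (\<Sum>i<s. q ^ i)"
    using q by simp
  then show ?thesis
    unfolding q_def by (metis of_nat_eq_iff)
qed

section \<open>Equivariant homomorphisms\<close>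

context group
begin

text \<open>Extensional functions, so that cardinalities count homomorphisms by their values on
  \<open>Y\<close>.\<close>

definition equivariant_homs :: "'a set \<Rightarrow> 'a set \<Rightarrow> ('a \<Rightarrow> 'a) set" where
  "equivariant_homs Y Z = {f \<in> Y \<rightarrow>\<^sub>E Z. (\<forall>a\<in>Y. \<forall>b\<in>Y. f (a \<otimes> b) = f a \<otimes> f b) \<and>
    (\<forall>g\<in>carrier G. \<forall>a\<in>Y. f (g \<otimes> a \<otimes> inv g) = g \<otimes> f a \<otimes> inv g)}"

definition trivial_hom :: "'a set \<Rightarrow> 'a \<Rightarrow> 'a" where
  "trivial_hom Y = (\<lambda>a\<in>Y. \<one>)"

lemma equivariant_homsD:
  assumes "f \<in> equivariant_homs Y Z"
  shows "f ` Y \<subseteq> Z" "\<And>a. a \<in> Y \<Longrightarrow> f a \<in> Z" "f \<in> extensional Y"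
    "\<And>a b. a \<in> Y \<Longrightarrow> b \<in> Y \<Longrightarrow> f (a \<otimes> b) = f a \<otimes> f b"
    "\<And>g a. g \<in> carrier G \<Longrightarrow> a \<in> Y \<Longrightarrow> f (g \<otimes> a \<otimes> inv g) = g \<otimes> f a \<otimes> inv g"
  using assms by (auto simp: equivariant_homs_def PiE_iff)

lemma finite_equivariant_homs: "finite Y \<Longrightarrow> finite Z \<Longrightarrow> finite (equivariant_homs Y Z)"
  unfolding equivariant_homs_def by (rule finite_subset[OF _ finite_PiE[of Y "\<lambda>_. Z"]]) auto

lemma trivial_hom_in: "Y \<lhd> G \<Longrightarrow> Z \<lhd> G \<Longrightarrow> trivial_hom Y \<in> equivariant_homs Y Z"
  using normal_one[of Z] normal_mult[of Y] normal_conj[of Y]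
  by (auto simp: equivariant_homs_def trivial_hom_def)

text \<open>Since \<open>Z\<close> is commutative, homomorphisms multiply pointwise and form a
  group. Its exponent divides p because f(a)^p = f(a^p) = 1; the exponent of \<open>Z\<close> does
  not enter.\<close>

lemma card_equivariant_homs_prime_power:
  assumes Y: "Y \<lhd> G" "finite Y" and Z: "Z \<lhd> G" "finite Z" "commuting Z"
    and p: "Factorial_Ring.prime (p::nat)" and exp: "\<And>y. y \<in> Y \<Longrightarrow> y [^] p = \<one>"
  shows "\<exists>k. card (equivariant_homs Y Z) = p ^ k"
proof -
  define E where "E = \<lparr>carrier = equivariant_homs Y Z,
    monoid.mult = (\<lambda>f h. \<lambda>a\<in>Y. f a \<otimes> h a), one = trivial_hom Y\<rparr>"
  note YD = normal_one[OF Y(1)] normal_mult[OF Y(1)] normal_conj[OF Y(1)]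
  note ZD = normal_one[OF Z(1)] normal_mult[OF Z(1)] normal_inv[OF Z(1)] normal_conj[OF Z(1)]
    normal_carrier[OF Z(1)]
  have comm: "a \<otimes> b = b \<otimes> a" if "a \<in> Z" "b \<in> Z" for a b
    using Z(3) that by (simp add: commuting_def)
  have mult_in: "(\<lambda>a\<in>Y. f a \<otimes> h a) \<in> equivariant_homs Y Z"
    if f: "f \<in> equivariant_homs Y Z" and h: "h \<in> equivariant_homs Y Z" for f h
  proof -
    note fD = equivariant_homsD[OF f] and hD = equivariant_homsD[OF h]
    have "(f a \<otimes> f b) \<otimes> (h a \<otimes> h b) = (f a \<otimes> h a) \<otimes> (f b \<otimes> h b)" if "a \<in> Y" "b \<in> Y" for a b
    proof -
      have c: "f a \<in> Z" "f b \<in> Z" "h a \<in> Z" "h b \<in> Z"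
        using fD(2) hD(2) that by auto
      then have "(f a \<otimes> f b) \<otimes> (h a \<otimes> h b) = f a \<otimes> (f b \<otimes> h a) \<otimes> h b"
        by (simp add: m_assoc ZD(5))
      also have "f b \<otimes> h a = h a \<otimes> f b"
        using c comm by simp
      also have "f a \<otimes> (h a \<otimes> f b) \<otimes> h b = (f a \<otimes> h a) \<otimes> (f b \<otimes> h b)"
        using c by (simp add: m_assoc ZD(5))
      finally show ?thesis .
    qed
    moreover have "(g \<otimes> f a \<otimes> inv g) \<otimes> (g \<otimes> h a \<otimes> inv g) = g \<otimes> (f a \<otimes> h a) \<otimes> inv g"
      if g: "g \<in> carrier G" and a: "a \<in> Y" for g a
    proof -
      have c: "f a \<in> carrier G" "h a \<in> carrier G"
        using fD(2)[OF a] hD(2)[OF a] ZD(5) by auto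
      show ?thesis
        by (rule conj_mult[OF g c])
    qed
    ultimately show ?thesis
      using fD hD YD ZD(2) by (simp add: equivariant_homs_def PiE_iff)
  qed
  have "group E"
  proof (rule groupI)
    fix f assume f: "f \<in> carrier E"
    then have fE: "f \<in> equivariant_homs Y Z"
      by (simp add: E_def)
    note fD = equivariant_homsD[OF fE]
    have inv_in: "(\<lambda>a\<in>Y. inv (f a)) \<in> equivariant_homs Y Z"
    proof -
      have "inv (f a \<otimes> f b) = inv (f a) \<otimes> inv (f b)" if "a \<in> Y" "b \<in> Y" for a b
        using comm[of "f a" "f b"] fD(2)[OF that(1)] fD(2)[OF that(2)] ZD(5) by (simp add: inv_mult_group)
      moreover have "inv (g \<otimes> f a \<otimes> inv g) = g \<otimes> inv (f a) \<otimes> inv g"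
        if "g \<in> carrier G" "a \<in> Y" for g a
        using fD(2)[OF that(2)] that(1) ZD(5) by (simp add: inv_mult_group m_assoc)
      ultimately show ?thesis
        using fD YD ZD(3) by (simp add: equivariant_homs_def PiE_iff)
    qed
    show "\<exists>h\<in>carrier E. h \<otimes>\<^bsub>E\<^esub> f = \<one>\<^bsub>E\<^esub>"
    proof (rule bexI)
      show "(\<lambda>a\<in>Y. inv (f a)) \<otimes>\<^bsub>E\<^esub> f = \<one>\<^bsub>E\<^esub>"
        using fD(2) ZD(5) by (auto simp: E_def trivial_hom_def restrict_def)
    qed (use inv_in in \<open>simp add: E_def\<close>)
    show "\<one>\<^bsub>E\<^esub> \<otimes>\<^bsub>E\<^esub> f = f"
      by (rule extensionalityI[of _ Y]) (use fD(2,3) ZD(5) in \<open>auto simp: E_def trivial_hom_def\<close>)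
    fix h assume h: "h \<in> carrier E"
    show "f \<otimes>\<^bsub>E\<^esub> h \<in> carrier E"
      using f h mult_in by (simp add: E_def)
    fix k assume k: "k \<in> carrier E"
    show "f \<otimes>\<^bsub>E\<^esub> h \<otimes>\<^bsub>E\<^esub> k = f \<otimes>\<^bsub>E\<^esub> (h \<otimes>\<^bsub>E\<^esub> k)"
      using fD(2) h k ZD(5) by (auto simp: E_def m_assoc restrict_def equivariant_homs_def PiE_iff)
  qed (use trivial_hom_in[OF Y(1) Z(1)] in \<open>simp add: E_def\<close>)
  then interpret E: group E .
  have "f [^]\<^bsub>E\<^esub> p = \<one>\<^bsub>E\<^esub>" if f: "f \<in> carrier E" for f
  proof -
    have fE: "f \<in> equivariant_homs Y Z"
      using f by (simp add: E_def)
    note fD = equivariant_homsD[OF fE]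
    have f1: "f \<one> = \<one>"
      by (rule normal_hom_image(2)[OF Y(1) Z(1) fD(1)]) (rule fD(4,5); assumption)+
    have "f [^]\<^bsub>E\<^esub> k = (\<lambda>a\<in>Y. f a [^] k)" for k :: nat
      by (induction k) (auto simp: E_def trivial_hom_def)
    moreover have "f a [^] k = f (a [^] k) \<and> a [^] k \<in> Y" if "a \<in> Y" for a and k :: nat
      by (induction k) (use that f1 YD fD(4) in auto)
    ultimately show ?thesis
      using exp f1 by (auto simp: E_def trivial_hom_def restrict_def)
  qed
  then show ?thesis
    using E.order_prime_power_if_exponent[OF _ p] finite_equivariant_homs[OF Y(2) Z(2)]
    by (simp add: E_def order_def)
qed

text \<open>The preimage in \<open>Y\<close> of a normal subgroup of \<open>G\<close> inside the
  image is again normal in \<open>G\<close>, hence trivial or all of \<open>Y\<close>.\<close>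

lemma minimal_normal_image:
  assumes Y: "minimal_normal Y" and Z: "Z \<lhd> G" and f: "f \<in> equivariant_homs Y Z" "f \<noteq> trivial_hom Y"
  shows "minimal_normal (f ` Y)"
proof -
  note fD = equivariant_homsD[OF f(1)]
  have YN: "Y \<lhd> G"
    by (rule minimal_normalD(1)[OF Y])
  have img: "f ` Y \<lhd> G"
    by (rule normal_hom_image(1)[OF YN Z fD(1)]) (rule fD(4,5); assumption)+
  have one: "f \<one> = \<one>"
    by (rule normal_hom_image(2)[OF YN Z fD(1)]) (rule fD(4,5); assumption)+
  have inv: "f (inv a) = inv (f a)" if "a \<in> Y" for a
    by (rule normal_hom_image(3)[OF YN Z fD(1) _ _ that]) (rule fD(4,5); assumption)+
  have "\<exists>a\<in>Y. f a \<noteq> \<one>"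
  proof (rule ccontr)
    assume "\<not> (\<exists>a\<in>Y. f a \<noteq> \<one>)"
    then have "f = trivial_hom Y"
      by (intro extensionalityI[of _ Y]) (auto simp: trivial_hom_def fD(3))
    with f(2) show False by simp
  qed
  then have nontrivial: "f ` Y \<noteq> {\<one>}"
    by blast
  have "K = {\<one>} \<or> K = f ` Y" if K: "K \<lhd> G" "K \<subseteq> f ` Y" for K
  proof -
    define L where "L = {a\<in>Y. f a \<in> K}"
    have "L \<lhd> G"
    proof (rule normal_invI)
      show "subgroup L G"
      proof (rule subgroupI)
        show "L \<subseteq> carrier G"
          using normal_carrier[OF YN] by (auto simp: L_def)
        show "L \<noteq> {}"
          using normal_one[OF YN] normal_one[OF K(1)] one by (auto simp: L_def)
      qed (use normal_inv[OF YN] normal_inv[OF K(1)] normal_mult[OF YN] normal_mult[OF K(1)] inv fD(4)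
          in \<open>auto simp: L_def\<close>)
      show "g \<otimes> a \<otimes> inv g \<in> L" if "g \<in> carrier G" "a \<in> L" for g a
        using that normal_conj[OF YN] normal_conj[OF K(1)] fD(5) by (auto simp: L_def)
    qed
    then have "L = {\<one>} \<or> L = Y"
      using minimal_normalD(3)[OF Y] by (auto simp: L_def)
    moreover have "K = f ` L"
      using K(2) by (auto simp: L_def)
    ultimately show ?thesis
      using one by auto
  qed
  with img nontrivial show ?thesis
    by (simp add: minimal_normal_def)
qed

text \<open>Composition with an isomorphism and with its inverse gives injections in both
  directions.\<close>

lemma card_equivariant_homs_isomorphic:
  assumes Y: "Y \<lhd> G" "finite Y" and Z: "finite Z" and lk: "G_isomorphic Y Z"
  shows "card (equivariant_homs Y Z) = card (equivariant_homs Y Y)"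
proof -
  obtain f where f: "bij_betw f Y Z" "\<And>a b. a \<in> Y \<Longrightarrow> b \<in> Y \<Longrightarrow> f (a \<otimes> b) = f a \<otimes> f b"
    "\<And>g a. g \<in> carrier G \<Longrightarrow> a \<in> Y \<Longrightarrow> f (g \<otimes> a \<otimes> inv g) = g \<otimes> f a \<otimes> inv g"
    using lk by (auto simp: G_isomorphic_def equivariant_iso_def)
  obtain h where h: "bij_betw h Z Y" "\<And>a b. a \<in> Z \<Longrightarrow> b \<in> Z \<Longrightarrow> h (a \<otimes> b) = h a \<otimes> h b"
    "\<And>g a. g \<in> carrier G \<Longrightarrow> a \<in> Z \<Longrightarrow> h (g \<otimes> a \<otimes> inv g) = g \<otimes> h a \<otimes> inv g"
    using G_isomorphic_sym[OF Y(1) lk] by (auto simp: G_isomorphic_def equivariant_iso_def)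
  have le: "card (equivariant_homs Y A) \<le> card (equivariant_homs Y B)"
    if k: "bij_betw k A B" "\<And>a b. a \<in> A \<Longrightarrow> b \<in> A \<Longrightarrow> k (a \<otimes> b) = k a \<otimes> k b"
      "\<And>g a. g \<in> carrier G \<Longrightarrow> a \<in> A \<Longrightarrow> k (g \<otimes> a \<otimes> inv g) = g \<otimes> k a \<otimes> inv g"
      and B: "finite B" for k A B
  proof (rule card_inj_on_le[of "\<lambda>e. \<lambda>a\<in>Y. k (e a)"])
    have kA: "k a \<in> B" if "a \<in> A" for a
      using k(1) that by (auto simp: bij_betw_def)
    show "(\<lambda>e. \<lambda>a\<in>Y. k (e a)) ` equivariant_homs Y A \<subseteq> equivariant_homs Y B"
    proof (rule image_subsetI)
      fix e assume e: "e \<in> equivariant_homs Y A"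
      show "(\<lambda>a\<in>Y. k (e a)) \<in> equivariant_homs Y B"
        using equivariant_homsD[OF e] k(2,3) kA normal_mult[OF Y(1)] normal_conj[OF Y(1)]
        by (simp add: equivariant_homs_def PiE_iff)
    qed
    show "inj_on (\<lambda>e. \<lambda>a\<in>Y. k (e a)) (equivariant_homs Y A)"
    proof (rule inj_onI)
      fix d e assume d: "d \<in> equivariant_homs Y A" and e: "e \<in> equivariant_homs Y A"
        and eq: "(\<lambda>a\<in>Y. k (d a)) = (\<lambda>a\<in>Y. k (e a))"
      show "d = e"
      proof (rule extensionalityI[of _ Y])
        fix a assume a: "a \<in> Y"
        then have "k (d a) = k (e a)"
          using fun_cong[OF eq, of a] by simp
        then show "d a = e a"
          using k(1) equivariant_homsD(2)[OF d a] equivariant_homsD(2)[OF e a]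
          by (auto simp: bij_betw_def dest: inj_onD)
      qed (use equivariant_homsD(3) d e in auto)
    qed
    show "finite (equivariant_homs Y B)"
      using Y(2) B by (rule finite_equivariant_homs)
  qed
  show ?thesis
    using le[OF f Z] le[OF h Y(2)] by simp
qed

text \<open>For a prime p dividing the order of some element, the elements of \<open>Y\<close> with
  p-th power 1 form a normal subgroup of \<open>G\<close>. It is nontrivial, so minimality makes it
  equal to \<open>Y\<close>.\<close>

lemma minimal_normal_exponent:
  assumes Y: "minimal_normal Y" "finite Y" "commuting Y"
  obtains p where "Factorial_Ring.prime (p::nat)" "\<And>y. y \<in> Y \<Longrightarrow> y [^] p = \<one>"
proof -
  have YN: "Y \<lhd> G"
    by (rule minimal_normalD(1)[OF Y(1)])
  note YD = normal_one[OF YN] normal_mult[OF YN] normal_inv[OF YN] normal_conj[OF YN] normal_carrier[OF YN]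
  have pow_in: "y [^] k \<in> Y" if "y \<in> Y" for y and k :: nat
    by (induction k) (use that YD in auto)
  obtain y where y: "y \<in> Y" "y \<noteq> \<one>"
    using minimal_normalD(2)[OF Y(1)] YD(1) by blast
  have yG: "y \<in> carrier G"
    using YD(5) y(1) .
  have "ord y \<noteq> 1"
    using y(2) yG ord_eq_1 by simp
  then obtain p where p: "Factorial_Ring.prime (p::nat)" "p dvd ord y"
    using prime_factor_nat by blast
  have "ord y \<noteq> 0"
  proof
    assume "ord y = 0"
    moreover have "y [^] card Y = \<one>"
      by (rule subgroup_pow_card_eq_1[OF normal_imp_subgroup[OF YN] y(1)])
    ultimately have "card Y = 0"
      using pow_eq_id[OF yG, of "card Y"] by simp
    then show False
      using Y(2) y(1) by auto
  qed
  define z where "z = y [^] (ord y div p)"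
  have z: "z \<in> Y" "z [^] p = \<one>" "z \<noteq> \<one>"
  proof -
    show "z \<in> Y"
      unfolding z_def by (rule pow_in[OF y(1)])
    show "z [^] p = \<one>"
      unfolding z_def using p yG by (simp add: nat_pow_pow pow_ord_eq_1)
    have "\<not> ord y dvd ord y div p"
    proof
      assume "ord y dvd ord y div p"
      moreover have "0 < ord y div p"
        using p \<open>ord y \<noteq> 0\<close> by (simp add: dvd_imp_le div_greater_zero_iff prime_gt_0_nat)
      ultimately have "ord y \<le> ord y div p"
        by (rule dvd_imp_le)
      moreover have "ord y div p < ord y"
        using prime_gt_1_nat[OF p(1)] \<open>ord y \<noteq> 0\<close> by (intro div_less_dividend) auto
      ultimately show False
        by simp
    qed
    then show "z \<noteq> \<one>"
      unfolding z_def using pow_eq_id[OF yG] by simp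
  qed
  define K where "K = {u\<in>Y. u [^] p = \<one>}"
  have "K \<lhd> G"
  proof (rule normal_invI)
    show "subgroup K G"
    proof (rule subgroupI)
      show "u \<otimes> v \<in> K" if u: "u \<in> K" and v: "v \<in> K" for u v
      proof -
        have c: "u \<in> Y" "v \<in> Y" "u [^] p = \<one>" "v [^] p = \<one>"
          using u v by (auto simp: K_def)
        have "u \<otimes> v = v \<otimes> u"
          using Y(3) c by (simp add: commuting_def)
        then have "(u \<otimes> v) [^] p = u [^] p \<otimes> v [^] p"
          by (rule pow_mult_distrib) (use c YD(5) in auto)
        then show ?thesis
          using c YD by (simp add: K_def)
      qed
    qed (use YD in \<open>auto simp: K_def nat_pow_inv\<close>)
    show "g \<otimes> u \<otimes> inv g \<in> K" if g: "g \<in> carrier G" and u: "u \<in> K" for g u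
    proof -
      have uc: "u \<in> Y" "u \<in> carrier G" "u [^] p = \<one>"
        using u YD(5) by (auto simp: K_def)
      have "(g \<otimes> u \<otimes> inv g) [^] k = g \<otimes> u [^] k \<otimes> inv g" for k :: nat
      proof (induction k)
        case (Suc k)
        show ?case
          using Suc uc(2) g by (simp add: conj_mult)
      qed (use g in simp)
      then show ?thesis
        using uc g YD(4) by (simp add: K_def)
    qed
  qed
  then have "K = Y"
    using minimal_normalD(3)[OF Y(1), of K] z by (auto simp: K_def)
  then show thesis
    using that[OF p(1)] by (auto simp: K_def)
qed

text \<open>
  The nontrivial equivariant homomorphisms \<open>Y0 \<rightarrow> M\<close> are partitioned by their images, which are the
  minimal normal subgroups of \<open>M\<close>.
\<close>

lemma card_minimal_normal_isotypic:
  assumes M: "M \<lhd> G" "finite M" "commuting M"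
  defines "T \<equiv> {Y. minimal_normal Y \<and> Y \<subseteq> M}"
  assumes Y0: "Y0 \<in> T" and lk: "\<And>Y. Y \<in> T \<Longrightarrow> G_isomorphic Y0 Y"
  shows "\<exists>q s. primepow q \<and> card T = (\<Sum>i<s. q ^ i)"
proof -
  have mn: "minimal_normal Y" "Y \<lhd> G" "Y \<subseteq> M" "finite Y" "commuting Y" if "Y \<in> T" for Y
    using that minimal_normalD(1) M(2,3) finite_subset[of Y M]
    by (auto simp: T_def commuting_def)
  note Y0D = mn[OF Y0]
  obtain p where p: "Factorial_Ring.prime (p::nat)" "\<And>y. y \<in> Y0 \<Longrightarrow> y [^] p = \<one>"
    using minimal_normal_exponent[OF Y0D(1,4,5)] by metis
  have finT: "finite T"
    by (rule finite_subset[of _ "Pow M"]) (auto simp: T_def M(2))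
  define z where "z = trivial_hom Y0"
  define q where "q = card (equivariant_homs Y0 Y0)"
  have finH: "finite (equivariant_homs Y0 M)"
    using finite_equivariant_homs[OF Y0D(4) M(2)] .
  have sub: "equivariant_homs Y0 Y \<subseteq> equivariant_homs Y0 M" if "Y \<in> T" for Y
    using mn(3)[OF that] unfolding equivariant_homs_def by (auto simp: PiE_iff)
  \<comment> \<open>A nontrivial homomorphism into a minimal \<open>Y\<close> is onto. Its target is
    thus determined by its image, which makes the sets in the union disjoint.\<close>
  have image: "f ` Y0 = Y" if Y: "Y \<in> T" and f: "f \<in> equivariant_homs Y0 Y - {z}" for f Y
  proof -
    have "minimal_normal (f ` Y0)"
      by (rule minimal_normal_image[OF Y0D(1) mn(2)[OF Y]]) (use f in \<open>auto simp: z_def\<close>)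
    then show ?thesis
      using minimal_normalD(3)[OF mn(1)[OF Y], of "f ` Y0"] minimal_normalD(1,2)[of "f ` Y0"]
        equivariant_homsD(1)[of f Y0 Y] f by blast
  qed
  have union: "equivariant_homs Y0 M - {z} = (\<Union>Y\<in>T. equivariant_homs Y0 Y - {z})"
  proof
    show "(\<Union>Y\<in>T. equivariant_homs Y0 Y - {z}) \<subseteq> equivariant_homs Y0 M - {z}"
      using sub by blast
    show "equivariant_homs Y0 M - {z} \<subseteq> (\<Union>Y\<in>T. equivariant_homs Y0 Y - {z})"
    proof
      fix f assume f: "f \<in> equivariant_homs Y0 M - {z}"
      then have "minimal_normal (f ` Y0)"
        by (intro minimal_normal_image[OF Y0D(1) M(1)]) (auto simp: z_def)
      then have "f ` Y0 \<in> T"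
        using equivariant_homsD(1)[of f Y0 M] f by (simp add: T_def)
      moreover have "f \<in> equivariant_homs Y0 (f ` Y0)"
        using f by (auto simp: equivariant_homs_def PiE_iff)
      ultimately show "f \<in> (\<Union>Y\<in>T. equivariant_homs Y0 Y - {z})"
        using f by blast
    qed
  qed
  have z_in: "z \<in> equivariant_homs Y0 Z" if "Z \<lhd> G" for Z
    unfolding z_def by (rule trivial_hom_in[OF Y0D(2) that])
  have "card (equivariant_homs Y0 M) - 1 = card (\<Union>Y\<in>T. equivariant_homs Y0 Y - {z})"
    unfolding union[symmetric] using z_in[OF M(1)] by simp
  also have "\<dots> = (\<Sum>Y\<in>T. card (equivariant_homs Y0 Y - {z}))"
  proof (rule card_UN_disjoint[OF finT])
    show "\<forall>Y\<in>T. finite (equivariant_homs Y0 Y - {z})"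
      using sub finH finite_subset by blast
    show "\<forall>Y\<in>T. \<forall>Z\<in>T. Y \<noteq> Z \<longrightarrow>
        (equivariant_homs Y0 Y - {z}) \<inter> (equivariant_homs Y0 Z - {z}) = {}"
      using image by blast
  qed
  also have "\<dots> = (\<Sum>Y\<in>T. q - 1)"
  proof (rule sum.cong[OF refl])
    fix Y assume Y: "Y \<in> T"
    have "card (equivariant_homs Y0 Y) = q"
      unfolding q_def by (rule card_equivariant_homs_isomorphic[OF Y0D(2,4) mn(4)[OF Y] lk[OF Y]])
    then show "card (equivariant_homs Y0 Y - {z}) = q - 1"
      using z_in[OF mn(2)[OF Y]] finite_subset[OF sub[OF Y] finH] by simp
  qed
  finally have count: "card T * (q - 1) = card (equivariant_homs Y0 M) - 1"
    by simp
  obtain b where b: "card (equivariant_homs Y0 M) = p ^ b"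
    using card_equivariant_homs_prime_power[OF Y0D(2,4) M p] by blast
  obtain a where a: "q = p ^ a"
    unfolding q_def using card_equivariant_homs_prime_power[OF Y0D(2,4) Y0D(2,4,5) p] by blast
  \<comment> \<open>The identity and the trivial map are different endomorphisms, so q > 1.\<close>
  have "a \<noteq> 0"
  proof
    assume "a = 0"
    then have "card (equivariant_homs Y0 Y0) = 1"
      using a by (simp add: q_def)
    moreover have "(\<lambda>y\<in>Y0. y) \<in> equivariant_homs Y0 Y0"
      using normal_mult[OF Y0D(2)] normal_conj[OF Y0D(2)] by (simp add: equivariant_homs_def)
    ultimately have "(\<lambda>y\<in>Y0. y) = z"
      using z_in[OF Y0D(2)] by (metis card_1_singletonE singletonD)
    then have "y = \<one>" if "y \<in> Y0" for y
      using fun_cong[of _ _ y] that by (metis trivial_hom_def z_def restrict_apply')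
    then show False
      using minimal_normalD(2)[OF Y0D(1)] normal_one[OF Y0D(2)] by blast
  qed
  then have "\<exists>s. card T = (\<Sum>i<s. (p ^ a) ^ i)"
    using count unfolding a b by (intro prime_power_minus_one_dvd[OF prime_gt_1_nat[OF p(1)]]) auto
  moreover have "primepow (p ^ a)"
    using p(1) \<open>a \<noteq> 0\<close> by (auto simp: primepow_def)
  ultimately show ?thesis by blast
qed

section \<open>The main theorem\<close>

definition normal_hull :: "'a \<Rightarrow> 'a set" where
  "normal_hull x = generate G {g \<otimes> x \<otimes> inv g |g. g \<in> carrier G}"

lemma normal_hull:
  assumes x: "x \<in> carrier G"
  shows "normal_hull x \<lhd> G" "x \<in> normal_hull x" "\<And>K. K \<lhd> G \<Longrightarrow> x \<in> K \<Longrightarrow> normal_hull x \<subseteq> K"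
proof -
  show "normal_hull x \<lhd> G"
    unfolding normal_hull_def
  proof (rule normal_generateI)
    fix h g assume "h \<in> {g \<otimes> x \<otimes> inv g |g. g \<in> carrier G}" and g: "g \<in> carrier G"
    then obtain k where k: "k \<in> carrier G" "h = k \<otimes> x \<otimes> inv k"
      by blast
    have "g \<otimes> h \<otimes> inv g = (g \<otimes> k) \<otimes> x \<otimes> inv (g \<otimes> k)"
      unfolding k(2) using g k(1) x by (simp add: m_assoc inv_mult_group)
    then show "g \<otimes> h \<otimes> inv g \<in> {g \<otimes> x \<otimes> inv g |g. g \<in> carrier G}"
      using g k(1) by blast
  qed (use x in auto)
  show "x \<in> normal_hull x"
    unfolding normal_hull_def using x by (intro generate.incl CollectI exI[of _ \<one>]) simp
  show "normal_hull x \<subseteq> K" if K: "K \<lhd> G" "x \<in> K" for K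
    unfolding normal_hull_def
    using K normal_conj by (intro generate_subgroup_incl normal_imp_subgroup) auto
qed

text \<open>The kernel is normal. If x acted trivially, so would its normal hull and with it a
  member of the family.\<close>

lemma irreducibly_faithful_if_separates:
  assumes F: "F \<subseteq> carrier G" and sep: "separates G \<N>"
    and hull: "\<And>x. x \<in> F \<Longrightarrow> x \<noteq> \<one> \<Longrightarrow> \<exists>N\<in>\<N>. N \<subseteq> normal_hull x"
  shows "irreducibly_faithful G F"
proof -
  obtain E where E: "E \<subseteq> carrier G" "irreducibly_faithful G E" "\<And>N. N \<in> \<N> \<Longrightarrow> \<exists>y\<in>E \<inter> N. y \<noteq> \<one>"
    using sep by (auto simp: separates_def)
  then obtain H :: "('a \<Rightarrow> complex) inner_module" and \<pi>
    where irr: "irreducible_unitary_representation G H \<pi>"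
      and faithful: "\<And>x. x \<in> E \<Longrightarrow> x \<noteq> \<one> \<Longrightarrow> \<pi> x \<noteq> (\<lambda>v\<in>carrier H. v)"
    unfolding irreducibly_faithful_def by blast
  interpret irreducible_unitary_representation G H \<pi> by (rule irr)
  interpret hom: group_hom G "BijGroup (carrier H)" \<pi> by (rule group_hom)
  have one: "\<one>\<^bsub>BijGroup (carrier H)\<^esub> = (\<lambda>v\<in>carrier H. v)"
    by (simp add: BijGroup_def)
  have "\<pi> x \<noteq> (\<lambda>v\<in>carrier H. v)" if x: "x \<in> F" "x \<noteq> \<one>" for x
  proof
    assume id: "\<pi> x = (\<lambda>v\<in>carrier H. v)"
    have xG: "x \<in> carrier G"
      using x(1) F by auto
    obtain N where N: "N \<in> \<N>" "N \<subseteq> normal_hull x"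
      using hull[OF x] by blast
    obtain y where y: "y \<in> E" "y \<in> N" "y \<noteq> \<one>"
      using E(3)[OF N(1)] by blast
    have "x \<in> kernel G (BijGroup (carrier H)) \<pi>"
      using xG id one by (simp add: kernel_def)
    then have "y \<in> kernel G (BijGroup (carrier H)) \<pi>"
      using normal_hull(3)[OF xG hom.normal_kernel] N(2) y(2) by blast
    then show False
      using faithful[OF y(1,3)] one by (simp add: kernel_def)
  qed
  then show ?thesis
    unfolding irreducibly_faithful_def using irr by blast
qed

text \<open>One nontrivial element from each member gives a set of at most \<open>k\<close> elements
  to which the property applies.\<close>

lemma separates_if_property_P:
  assumes P: "property_P k G" and fin: "finite \<N>" "card \<N> \<le> k"
    and \<N>: "\<And>N. N \<in> \<N> \<Longrightarrow> minimal_normal N"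
  shows "separates G \<N>"
proof -
  have "\<exists>y\<in>N. y \<noteq> \<one>" if "N \<in> \<N>" for N
    using minimal_normalD(1,2)[OF \<N>[OF that]] normal_one by blast
  then obtain y where y: "\<And>N. N \<in> \<N> \<Longrightarrow> y N \<in> N \<and> y N \<noteq> \<one>"
    by metis
  have yG: "y ` \<N> \<subseteq> carrier G"
    using y minimal_normalD(1)[OF \<N>] normal_carrier by blast
  have "irreducibly_faithful G (y ` \<N>)"
    using P yG fin card_image_le[OF fin(1), of y] by (auto simp: property_P_def)
  then show ?thesis
    unfolding separates_def using yG y by (intro exI[of _ "y ` \<N>"]) blast
qed

text \<open>Each nontrivial element of a set violating the property is replaced by its normal hull,
  if that is infinite, or else by a minimal normal subgroup inside it. The resulting unseparated
  family must consist of finite abelian members only.\<close>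

lemma unseparated_abelian_minimal_normals:
  assumes count: "countable (carrier G)" and P: "property_P (n - 1) G" and nP: "\<not> property_P n G"
    and n: "n \<ge> 1"
  obtains \<N> where "finite \<N>" "card \<N> \<le> n" "\<not> separates G \<N>"
    "\<And>N. N \<in> \<N> \<Longrightarrow> minimal_normal N \<and> finite N \<and> commuting N"
proof -
  obtain F where F: "F \<subseteq> carrier G" "finite F" "card F \<le> n" "\<not> irreducibly_faithful G F"
    using nP by (auto simp: property_P_def)
  have "\<exists>N. N \<lhd> G \<and> N \<subseteq> normal_hull x \<and> (infinite N \<or> minimal_normal N)"
    if x: "x \<in> F - {\<one>}" for x
  proof (cases "finite (normal_hull x)")
    case True
    have xG: "x \<in> carrier G"
      using x F(1) by blast
    have "normal_hull x \<noteq> {\<one>}"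
      using normal_hull(2)[OF xG] x by blast
    then obtain M where "minimal_normal M" "M \<subseteq> normal_hull x"
      using exists_minimal_normal[OF normal_hull(1)[OF xG] True] by blast
    then show ?thesis
      using minimal_normalD(1) by blast
  next
    case False
    then show ?thesis
      using normal_hull(1)[of x] x F(1) by blast
  qed
  then obtain N where N: "\<And>x. x \<in> F - {\<one>} \<Longrightarrow>
      N x \<lhd> G \<and> N x \<subseteq> normal_hull x \<and> (infinite (N x) \<or> minimal_normal (N x))"
    by metis
  define \<N> where "\<N> = N ` (F - {\<one>})"
  have fin: "finite \<N>"
    unfolding \<N>_def using F(2) by simp
  have "card \<N> \<le> card (F - {\<one>})"
    unfolding \<N>_def using F(2) by (intro card_image_le) simp
  also have "\<dots> \<le> card F"
    by (rule card_Diff1_le)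
  finally have card: "card \<N> \<le> n"
    using F(3) by simp
  have \<N>: "K \<lhd> G" "infinite K \<or> minimal_normal K" if "K \<in> \<N>" for K
    using that N by (auto simp: \<N>_def)
  have nsep: "\<not> separates G \<N>"
  proof
    assume "separates G \<N>"
    then have "irreducibly_faithful G F"
      by (rule irreducibly_faithful_if_separates[OF F(1)]) (use N in \<open>auto simp: \<N>_def\<close>)
    with F(4) show False by simp
  qed
  define \<A> where "\<A> = {K\<in>\<N>. finite K \<and> commuting K}"
  define \<R> where "\<R> = {K\<in>\<N>. finite K \<and> \<not> commuting K}"
  have \<A>: "minimal_normal K \<and> finite K \<and> commuting K" if "K \<in> \<A>" for K
    using that \<N>(2)[of K] by (auto simp: \<A>_def)
  have \<R>: "minimal_normal K \<and> finite K \<and> \<not> commuting K" if "K \<in> \<R>" for K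
    using that \<N>(2)[of K] by (auto simp: \<R>_def)
  have finA: "finite \<A>" and finR: "finite \<R>"
    using fin by (auto simp: \<A>_def \<R>_def)
  \<comment> \<open>With at most n - 1 finite abelian members, \<open>P\<close> would supply a
    character of their join. It extends over the finite nonabelian members, and infinite members ask
    nothing of a character, so the whole family would be separated.\<close>
  have "\<not> card \<A> \<le> n - 1"
  proof
    assume "card \<A> \<le> n - 1"
    then have sepA: "separates G \<A>"
      by (intro separates_if_property_P[OF P finA]) (use \<A> in auto)
    have J: "join \<A> \<lhd> G" "finite (join \<A>)"
      using \<A> minimal_normalD(1) finA by (auto intro!: join_normal join_finite)
    have comm: "a \<otimes> b = b \<otimes> a" if "a \<in> join \<A>" "b \<in> join \<A>" for a b
      using commuting_join[of \<A>] \<A> that by (auto simp: commuting_def)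
    have AJ: "K \<lhd> G \<and> K \<subseteq> join \<A>" if "K \<in> \<A>" for K
      using \<A>[OF that] minimal_normalD(1) join_upper[OF that] by blast
    obtain \<theta> where \<theta>: "character G (join \<A>) \<theta>" "\<And>K. K \<in> \<A> \<Longrightarrow> \<exists>a\<in>K. \<theta> a \<noteq> 1"
      using character_if_separates[OF sepA normal_imp_subgroup[OF J(1)] J(2) comm AJ] by metis
    have \<A>': "minimal_normal K \<and> commuting K" if "K \<in> \<A>" for K
      using \<A>[OF that] by blast
    obtain B \<eta> where B: "subgroup B G" "finite B" "character G B \<eta>" "join \<A> \<subseteq> B"
      "\<And>a. a \<in> join \<A> \<Longrightarrow> \<eta> a = \<theta> a" "\<And>K. K \<in> \<R> \<Longrightarrow> \<exists>a\<in>B \<inter> K. \<eta> a \<noteq> 1"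
      using extend_character_nonabelian[OF finR \<R> \<A>' normal_imp_subgroup[OF J(1)] subset_refl J(2) \<theta>(1)]
      by metis
    have "separates G \<N>"
    proof (rule separates_if_character[OF count B(1-3) fin \<N>(1)])
      fix K assume K: "K \<in> \<N>"
      consider "infinite K" | "K \<in> \<R>" | "K \<in> \<A>"
        using K by (auto simp: \<A>_def \<R>_def)
      then show "infinite K \<or> (\<exists>a\<in>B \<inter> K. \<eta> a \<noteq> 1)"
      proof cases
        case 3
        then obtain a where a: "a \<in> K" "\<theta> a \<noteq> 1"
          using \<theta>(2) by blast
        moreover have "a \<in> join \<A>"
          using AJ[OF 3] a(1) by blast
        ultimately show ?thesis
          using B(4,5) by (intro disjI2 bexI[of _ a]) auto
      qed (use B(6) in auto)
    qed
    with nsep show False by simp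
  qed
  then have "card \<N> \<le> card \<A>"
    using card n by simp
  then have "\<A> = \<N>"
    using fin by (intro card_seteq) (auto simp: \<A>_def)
  with \<A> nsep fin card show thesis
    using that[of \<N>] by simp
qed

end

theorem corollary1p5:
  fixes n :: nat and G :: "('g, 'm) monoid_scheme"
  assumes "n \<ge> 2"
    and "\<nexists>q m :: nat. primepow q \<and> m \<ge> 1 \<and> n = (\<Sum>i\<le>m. q ^ i)"
    and "group G" and "countable (carrier G)"
    and "property_P (n - 1) G"
  shows "property_P n G"
proof (rule ccontr)
  assume nP: "\<not> property_P n G"
  interpret group G by (rule assms(3))
  have "n \<ge> 1"
    using assms(1) by simp
  then obtain \<N> where \<N>: "finite \<N>" "card \<N> \<le> n" "\<not> separates G \<N>"
    "\<And>N. N \<in> \<N> \<Longrightarrow> minimal_normal N \<and> finite N \<and> commuting N"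
    using unseparated_abelian_minimal_normals[OF assms(4,5) nP] by metis
  obtain M where M: "M \<lhd> G" "finite M" "commuting M"
    and nsep: "\<not> separates G {Y. minimal_normal Y \<and> Y \<subseteq> M}"
    and card: "card {Y. minimal_normal Y \<and> Y \<subseteq> M} \<le> card \<N>"
    using exists_unseparated_socle[OF assms(4) \<N>(1,4,3)] by metis
  define T where "T = {Y. minimal_normal Y \<and> Y \<subseteq> M}"
  have finT: "finite T"
    by (rule finite_subset[of _ "Pow M"]) (auto simp: T_def M(2))
  have small: "separates G \<T>" if "\<T> \<subseteq> T" "card \<T> \<le> n - 1" for \<T>
    using separates_if_property_P[OF assms(5) finite_subset[OF that(1) finT] that(2)] that(1)
    by (auto simp: T_def)
  have "\<not> card T \<le> n - 1"
    using small[of T] nsep by (auto simp: T_def)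
  \<comment> \<open>More than n - 1 because smaller families are separated, and at most n by the
    bound on the socle. Consequently every proper subfamily is separated.\<close>
  then have cardT: "card T = n"
    using card \<N>(2) by (simp add: T_def)
  have proper: "separates G \<T>" if "\<T> \<subset> T" for \<T>
    using small[of \<T>] psubset_card_mono[OF finT that] that by (auto simp: cardT)
  obtain Y0 where Y0: "Y0 \<in> T"
    using cardT assms(1) by fastforce
  have "G_isomorphic Y0 Y" if "Y \<in> T" for Y
    by (rule unseparated_socle_isotypic[OF assms(4) M nsep proper[unfolded T_def] Y0[unfolded T_def]
          that[unfolded T_def]])
  then obtain q s where qs: "primepow q" "n = (\<Sum>i<s. q ^ i)"
    using card_minimal_normal_isotypic[OF M Y0[unfolded T_def]] cardT by (auto simp: T_def)
  \<comment> \<open>For s < 2 the sum is 0 or 1. Otherwise m = s - 1 is at least 1 and contradicts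
    the assumption on n.\<close>
  have "s \<ge> 2"
  proof (rule ccontr)
    assume "\<not> 2 \<le> s"
    then have "s = 0 \<or> s = 1"
      by auto
    then show False
      using qs(2) assms(1) by auto
  qed
  then have "{..<s} = {..s - 1}" "s - 1 \<ge> 1"
    by auto
  with qs assms(2) show False
    by auto
qed

end
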